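(* Let $(W_N)_N$ be positive integers with $\lim_{N\to\infty}W_N/N=\infty$ and $W_N\ge N$, and let $p_N=N/W_N$. Let $\{G_i^{(N)}\}_{1\le i\le N,\,N\in\mathbb{N}}$ be a triangular array with independent rows whose $N$-th row consists of i.i.d. geometric random variables with $\mathbb{P}\{G_i^{(N)}=k\}=p_N(1-p_N)^k$, $k=0,1,2,\dots$, and let $\mathbb{P}$ denote the law of the array. Define $$(X_1^N,\dots,X_N^N)=\begin{cases}(1,\dots,1),&\text{if }\sum_{i=1}^NG_i^{(N)}=0,\\[2pt] N\Big(\dfrac{G_1^{(N)}}{\sum_{i=1}^NG_i^{(N)}},\dots,\dfrac{G_N^{(N)}}{\sum_{i=1}^NG_i^{(N)}}\Big),&\text{otherwise,}\end{cases}$$ and the empirical measure $\mu_0^N=\frac1N\sum_{i=1}^N\delta_{X_i^N}$. Then $$\mu_0^N\Longrightarrow\mu_0\sim\mathrm{Exp}(1),\qquad\mathbb{P}\text{-a.s.}$$ As such, for all $t>0$ the mean-field limit $\mu_t$ satisfies $\mu_t\sim\mathrm{Exp}(1)$.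
   Context: $\mathrm{Exp}(1)$ is the exponential distribution with mean $1$, and $\Rightarrow$ denotes weak convergence of probability measures on $\mathbb{R}_+=[0,\infty)$. Mean-field limit: for each $N\ge 2$ start from the wealth vector $(X_1^N,\dots,X_N^N)$, whose total wealth is $N$, the continuous-time Markov jump process $(X_t^{1,N},\dots,X_t^{N,N})$ in which each ordered pair $(i,j)$, $i\ne j$, interacts at rate $1/N$. At an interaction, a fresh independent $r$ uniform on $[0,1]$ is drawn and $(X^{i,N},X^{j,N})$ is replaced by $(r(X^{i,N}+X^{j,N}),(1-r)(X^{i,N}+X^{j,N}))$. Let $\mu_t^N=\frac1N\sum_i\delta_{X_t^{i,N}}$. The mean-field limit $(\mu_t)_{t\ge0}$ is the limit in probability of $(\mu_t^N)_{t\ge0}$ as $N\to\infty$ in the Skorokhod space $D([0,\infty);\mathcal{M}_1(\mathbb{R}_+))$, with $\mathcal{M}_1(\mathbb{R}_+)$ the probability measures on $\mathbb{R}_+$ with the weak topology. It solves the kinetic equation, for all bounded continuous $g$ on $\mathbb{R}_+$, $$\int g\,d\mu_t=\int g\,d\mu_0+\int_0^t\int_0^1\int_{\mathbb{R}_+^2}\big(g(r(x+y))+g((1-r)(x+y))-g(x)-g(y)\big)\mu_s(dx)\mu_s(dy)\,dr\,ds.$$ *)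

theory Defs
  imports "HOL-Probability.Probability"
begin

subsection \<open>Wealth vectors and empirical measures\<close>

text \<open>
  A wealth vector of \<open>N\<close> agents is an extensional function on \<open>{1..N}\<close>, i.e. a point of
  \<open>\<Pi>\<^sub>M i\<in>{1..N}. borel\<close>.
\<close>

definition initial_wealth :: "nat \<Rightarrow> (nat \<Rightarrow> nat) \<Rightarrow> nat \<Rightarrow> real" where
  "initial_wealth N g =
     (\<lambda>i\<in>{1..N}. if (\<Sum>j=1..N. g j) = 0 then 1
                 else real N * (real (g i) / real (\<Sum>j=1..N. g j)))"

text \<open>
  The image of the uniform distribution on \<open>{1..N}\<close> under \<open>x\<close>, that is, the average of the
  Dirac measures at \<open>x 1, \<dots>, x N\<close>.
\<close>

definition empirical_measure :: "nat \<Rightarrow> (nat \<Rightarrow> real) \<Rightarrow> real measure" where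
  "empirical_measure N x = distr (uniform_count_measure {1..N}) borel x"

definition Exp1 :: "real measure" where
  "Exp1 = density lborel (\<lambda>x. ennreal (exponential_density 1 x))"


subsection \<open>Markov jump processes\<close>

text \<open>
  The transition semigroup \<open>exp (t L)\<close> of a bounded generator \<open>L\<close> acting on bounded measurable
  functions.
\<close>

definition jump_semigroup ::
    "(('b \<Rightarrow> real) \<Rightarrow> ('b \<Rightarrow> real)) \<Rightarrow> real \<Rightarrow> ('b \<Rightarrow> real) \<Rightarrow> 'b \<Rightarrow> real" where
  "jump_semigroup L t f x = (\<Sum>n. t ^ n / fact n * (L ^^ n) f x)"

definition history :: "'a measure \<Rightarrow> 'b measure \<Rightarrow> (real \<Rightarrow> 'a \<Rightarrow> 'b) \<Rightarrow> real \<Rightarrow> 'a measure" where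
  "history M S X s =
     sigma (space M) (\<Union>u\<in>{0..s}. {X u -` A \<inter> space M | A. A \<in> sets S})"

text \<open>
  Right-continuous paths that are constant between isolated jump times; by compactness such a
  path has finitely many jumps in every bounded time interval.
\<close>

definition jump_path :: "(real \<Rightarrow> 'b) \<Rightarrow> bool" where
  "jump_path x \<longleftrightarrow>
     (\<forall>t\<ge>0. eventually (\<lambda>s. x s = x t) (at_right t)) \<and>
     (\<forall>t>0. \<exists>v. eventually (\<lambda>s. x s = v) (at_left t))"

definition markov_jump_process ::
    "'a measure \<Rightarrow> 'b measure \<Rightarrow> (('b \<Rightarrow> real) \<Rightarrow> ('b \<Rightarrow> real)) \<Rightarrow> (real \<Rightarrow> 'a \<Rightarrow> 'b) \<Rightarrow> bool" where
  "markov_jump_process M S L X \<longleftrightarrow>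
     (\<forall>t\<ge>0. X t \<in> M \<rightarrow>\<^sub>M S) \<and>
     (\<forall>\<omega>\<in>space M. jump_path (\<lambda>t. X t \<omega>)) \<and>
     (\<forall>s\<ge>0. \<forall>t\<ge>0. \<forall>f\<in>borel_measurable S. bounded (f ` space S) \<longrightarrow>
        (AE \<omega> in M. real_cond_exp M (history M S X s) (\<lambda>\<omega>. f (X (s + t) \<omega>)) \<omega>
                      = jump_semigroup L t f (X s \<omega>)))"


subsection \<open>The wealth exchange dynamics\<close>

definition exchange :: "nat \<Rightarrow> nat \<Rightarrow> real \<Rightarrow> (nat \<Rightarrow> real) \<Rightarrow> (nat \<Rightarrow> real)" where
  "exchange i j r x = x(i := r * (x i + x j), j := (1 - r) * (x i + x j))"

text \<open>Each ordered pair \<open>(i, j)\<close> with \<open>i \<noteq> j\<close> interacts at rate \<open>1 / N\<close>, with \<open>r\<close> uniform on \<open>[0, 1]\<close>.\<close>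

definition exchange_generator ::
    "nat \<Rightarrow> ((nat \<Rightarrow> real) \<Rightarrow> real) \<Rightarrow> (nat \<Rightarrow> real) \<Rightarrow> real" where
  "exchange_generator N f x =
     (\<Sum>(i, j) | i \<in> {1..N} \<and> j \<in> {1..N} \<and> i \<noteq> j.
        (1 / real N) * (\<integral>r. (f (exchange i j r x) - f x) \<partial>uniform_measure lborel {0..1}))"

definition exchange_process :: "'a measure \<Rightarrow> nat \<Rightarrow> (real \<Rightarrow> 'a \<Rightarrow> nat \<Rightarrow> real) \<Rightarrow> bool" where
  "exchange_process M N X \<longleftrightarrow>
     markov_jump_process M (\<Pi>\<^sub>M i\<in>{1..N}. borel) (exchange_generator N) X"


subsection \<open>The space of probability measures on the half-line\<close>

text \<open>
  Probability measures on \<open>[0, \<infinity>)\<close> are identified with the Borel probability measures on the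
  real line that give full mass to \<open>[0, \<infinity>)\<close>. Since \<open>[0, \<infinity>)\<close> is closed, the weak topology is
  the one inherited from the real line; it is metrised by the Prohorov distance.
\<close>

definition half_line_prob_measures :: "real measure set" where
  "half_line_prob_measures = {\<nu>. real_distribution \<nu> \<and> measure \<nu> {0..} = 1}"

definition prohorov_dist :: "real measure \<Rightarrow> real measure \<Rightarrow> real" where
  "prohorov_dist \<nu> \<nu>' =
     Inf {\<epsilon>. \<epsilon> > 0 \<and> (\<forall>F. closed F \<longrightarrow> measure \<nu> F \<le> measure \<nu>' (\<Union>y\<in>F. ball y \<epsilon>) + \<epsilon>)}"


subsection \<open>The Skorokhod space over the time interval \<open>[0, \<infinity>)\<close>\<close>

text \<open>
  Right-continuous paths with left limits in the space \<open>E\<close> with metric \<open>d\<close>. Paths are functions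
  on the real line of which only the restriction to \<open>[0, \<infinity>)\<close> matters.
\<close>

definition skorokhod_space :: "'e set \<Rightarrow> ('e \<Rightarrow> 'e \<Rightarrow> real) \<Rightarrow> (real \<Rightarrow> 'e) set" where
  "skorokhod_space E d =
     {x. (\<forall>t\<ge>0. x t \<in> E) \<and>
         (\<forall>t\<ge>0. ((\<lambda>s. d (x s) (x t)) \<longlongrightarrow> 0) (at_right t)) \<and>
         (\<forall>t>0. \<exists>v\<in>E. ((\<lambda>s. d (x s) v) \<longlongrightarrow> 0) (at_left t))}"

definition time_changes :: "(real \<Rightarrow> real) set" where
  "time_changes = {\<tau>. strict_mono_on {0..} \<tau> \<and> \<tau> ` {0..} = {0..}}"

definition distortion :: "(real \<Rightarrow> real) \<Rightarrow> ennreal" where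
  "distortion \<tau> =
     (SUP (s, t)\<in>{(s, t). 0 \<le> t \<and> t < s}. ennreal \<bar>ln ((\<tau> s - \<tau> t) / (s - t))\<bar>)"

text \<open>
  The metric of Ethier and Kurtz (Markov Processes, Section 3.5) for Skorokhod's \<open>J\<^sub>1\<close> topology.
  They restrict the infimum to time changes of finite distortion; the others contribute the
  value \<open>\<infinity>\<close> here.
\<close>

definition skorokhod_dist ::
    "('e \<Rightarrow> 'e \<Rightarrow> real) \<Rightarrow> (real \<Rightarrow> 'e) \<Rightarrow> (real \<Rightarrow> 'e) \<Rightarrow> ennreal" where
  "skorokhod_dist d x y =
     (INF \<tau>\<in>time_changes.
        max (distortion \<tau>)
          (\<integral>\<^sup>+u\<in>{0..}. (ennreal (exp (- u)) *
             (SUP t\<in>{0..}. ennreal (min 1 (d (x (min t u)) (y (min (\<tau> t) u)))))) \<partial>lborel))"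


subsection \<open>Mean-field limits\<close>

text \<open>
  Convergence in probability to a deterministic limit. It is phrased with outer probability;
  for measurable \<open>{\<omega>. d (Y n \<omega>) y > \<epsilon>}\<close> one can take \<open>A n\<close> to be this event for large \<open>n\<close>.
\<close>

definition tendsto_in_probability ::
    "'a measure \<Rightarrow> ('e \<Rightarrow> 'e \<Rightarrow> ennreal) \<Rightarrow> (nat \<Rightarrow> 'a \<Rightarrow> 'e) \<Rightarrow> 'e \<Rightarrow> bool" where
  "tendsto_in_probability M d Y y \<longleftrightarrow>
     (\<forall>\<epsilon>>0. \<exists>A. (\<forall>n. A n \<in> sets M) \<and>
        eventually (\<lambda>n. {\<omega>\<in>space M. d (Y n \<omega>) y > \<epsilon>} \<subseteq> A n) sequentially \<and>
        (\<lambda>n. measure M (A n)) \<longlonglongrightarrow> 0)"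

definition mean_field_limit ::
    "'a measure \<Rightarrow> (nat \<Rightarrow> real \<Rightarrow> 'a \<Rightarrow> nat \<Rightarrow> real) \<Rightarrow> (real \<Rightarrow> real measure) \<Rightarrow> bool" where
  "mean_field_limit M X \<mu> \<longleftrightarrow>
     \<mu> \<in> skorokhod_space half_line_prob_measures prohorov_dist \<and>
     tendsto_in_probability M (skorokhod_dist prohorov_dist)
       (\<lambda>N \<omega> t. empirical_measure N (X N t \<omega>)) \<mu>"

end

theory Submission
  imports Defs
begin

text \<open>
  Independent \<open>Exp(1)\<close> wealths are stationary for the exchange dynamics: the total of two
  independent \<open>Exp(1)\<close> variables is independent of their ratio, the share of the first one is uniform on
  \<open>[0, 1]\<close>, and an exchange keeps the total and draws the share anew
  (\<open>exp_vector_exchange_nn_integral\<close>). The theorem holds because the geometric initial wealth is a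
  perturbation of this stationary law that is negligible in the limit and stays negligible under the
  dynamics.
  
  The perturbation is made explicit by a coupling. Rounding an \<open>Exp(1)\<close> variable down to a multiple of
  \<open>c = - ln (1 - p)\<close> gives \<open>c\<close> times a geometric variable of parameter \<open>p\<close>. So the initial wealth has the law
  of a function of an exponential vector \<open>e\<close>, and this function differs from \<open>e\<close> by at most
  \<open>\<bar>N - \<Sum>i. e i\<bar> + 2 c N\<close> in the \<open>l\<^sup>1\<close>-norm (\<open>rounded_wealth_close\<close>). Since \<open>p\<close>, and with it \<open>c\<close>, tends to \<open>0\<close>,
  and since the sample mean of \<open>e\<close> is close to \<open>1\<close> up to an exponentially small probability
  (\<open>sample_mean_deviation_summable\<close>), the difference is \<open>o(N)\<close>.
  
  For the almost sure convergence at time \<open>0\<close>, the same exponential bound applies to the sample means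
  of bounded Lipschitz functions of \<open>e\<close>. The coupling transfers it to the initial wealth, and the
  Borel-Cantelli lemma applies; countably many ramp functions determine weak convergence.
  
  For \<open>t > 0\<close>, two wealth vectors that undergo the same exchanges do not move apart in the \<open>l\<^sup>1\<close>-norm.
  The semigroup is a Poisson mixture of powers of the averaged exchange
  (\<open>jump_semigroup_poisson_sums\<close>), so it preserves \<open>l\<^sup>1\<close>-Lipschitz constants
  (\<open>jump_semigroup_lipschitz\<close>). The expected sample mean of a bounded Lipschitz function \<open>g\<close> at time \<open>t\<close>
  therefore differs by \<open>o(1)\<close> from its value under the stationary law, which is \<open>\<integral>g dExp(1)\<close>
  (\<open>exchange_process_sample_mean\<close>). The mean-field limit is deterministic, so these expectations
  identify it. Convergence in the Skorokhod space controls the empirical measure at a time slightly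
  after \<open>t\<close> in terms of the limit path slightly after \<open>t\<close>, and right-continuity of the limit path leads
  back to \<open>\<mu> t\<close> (\<open>mean_field_limit_levy_close\<close>).
\<close>

section \<open>Poisson mixtures\<close>

text \<open>
  If a linear operator \<open>L\<close> has the form \<open>c (K - I)\<close>, then the numbers \<open>a n k = (K\<^sup>k L\<^sup>n f) x\<close> satisfy
  the recurrence assumed here, so that this is the binomial expansion of \<open>L\<^sup>n = c\<^sup>n (K - I)\<^sup>n\<close>.
  Working with the numbers instead of the operators keeps the measurability and boundedness that
  linearity of \<open>K\<close> depends on out of the combinatorics.
\<close>

lemma iterated_difference:
  fixes a :: "nat \<Rightarrow> nat \<Rightarrow> real"
  assumes rec: "\<And>n k. a (Suc n) k = c * (a n (Suc k) - a n k)"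
  shows "a n k = c ^ n * (\<Sum>j\<le>n. real (n choose j) * (-1) ^ (n - j) * a 0 (k + j))"
proof (induction n arbitrary: k)
  case 0
  show ?case by simp
next
  case (Suc n)
  define b where "b j = a 0 (k + j)" for j
  have "(\<Sum>j\<le>Suc n. real (Suc n choose j) * (-1) ^ (Suc n - j) * b j)
      = (-1) ^ Suc n * b 0 + (\<Sum>j\<le>n. (real (n choose j) + real (n choose Suc j)) * (-1) ^ (n - j) * b (Suc j))"
    by (simp only: sum.atMost_Suc_shift binomial_n_0 binomial_Suc_Suc diff_Suc_Suc diff_zero of_nat_add of_nat_1 mult_1)
  also have "\<dots> = (\<Sum>j\<le>n. real (n choose j) * (-1) ^ (n - j) * b (Suc j))
      + ((-1) ^ Suc n * b 0 + (\<Sum>j\<le>n. real (n choose Suc j) * (-1) ^ (n - j) * b (Suc j)))"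
    by (simp add: algebra_simps sum.distrib)
  also have "(-1) ^ Suc n * b 0 + (\<Sum>j\<le>n. real (n choose Suc j) * (-1) ^ (n - j) * b (Suc j))
      = (\<Sum>j\<le>Suc n. real (n choose j) * (-1) ^ (Suc n - j) * b j)"
    by (subst sum.atMost_Suc_shift) simp
  also have "\<dots> = - (\<Sum>j\<le>n. real (n choose j) * (-1) ^ (n - j) * b j)"
    by (simp add: sum_negf[symmetric] Suc_diff_le)
  finally have *: "(\<Sum>j\<le>Suc n. real (Suc n choose j) * (-1) ^ (Suc n - j) * b j) =
      (\<Sum>j\<le>n. real (n choose j) * (-1) ^ (n - j) * b (Suc j)) -
      (\<Sum>j\<le>n. real (n choose j) * (-1) ^ (n - j) * b j)" by simp
  have IH: "a n k = c ^ n * (\<Sum>j\<le>n. real (n choose j) * (-1) ^ (n - j) * b j)"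
    "a n (Suc k) = c ^ n * (\<Sum>j\<le>n. real (n choose j) * (-1) ^ (n - j) * b (Suc j))"
    using Suc.IH[of k] Suc.IH[of "Suc k"] by (simp_all add: b_def)
  have "a (Suc n) k = c ^ Suc n * (\<Sum>j\<le>Suc n. real (Suc n choose j) * (-1) ^ (Suc n - j) * b j)"
    unfolding * rec IH by (simp only: power_Suc right_diff_distrib mult.assoc)
  then show ?case unfolding b_def .
qed

text \<open>
  Uniformization: \<open>exp (t c (K - I)) = exp (- c t) exp (c t K)\<close> is a mixture of the powers of \<open>K\<close>
  with Poisson weights. The terms of the exponential series on the right-hand side are the Cauchy
  product of the two series on the left. For a Markov operator \<open>K\<close> the mixture shows what the
  alternating series hides, namely that the semigroup inherits every property of the powers of
  \<open>K\<close> that is stable under convex combinations.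
\<close>

lemma poisson_mixture_sums:
  fixes a :: "nat \<Rightarrow> nat \<Rightarrow> real"
  assumes rec: "\<And>n k. a (Suc n) k = c * (a n (Suc k) - a n k)"
    and bound: "\<And>k. \<bar>a 0 k\<bar> \<le> C"
  shows "(\<lambda>k. exp (- (c * t)) * ((c * t) ^ k / fact k) * a 0 k) sums (\<Sum>n. t ^ n / fact n * a n 0)"
proof -
  define u where "u k = (c * t) ^ k / fact k * a 0 k" for k
  define v where "v k = (- (c * t)) ^ k / fact k" for k
  have e: "(\<lambda>k. x ^ k / fact k) sums exp x" for x :: real
    using exp_converges[of x] by (simp only: real_scaleR_def divide_inverse mult.commute)
  have abs_term: "\<bar>x ^ k / fact k\<bar> = \<bar>x\<bar> ^ k / fact k" for x :: real and k
    unfolding abs_divide power_abs by simp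
  have v: "summable (\<lambda>k. norm (v k))"
    unfolding v_def real_norm_def abs_term using e sums_summable by blast
  have u: "summable (\<lambda>k. norm (u k))"
  proof (rule summable_comparison_test')
    show "summable (\<lambda>k. C * (\<bar>c * t\<bar> ^ k / fact k))"
      by (rule summable_mult) (use e sums_summable in blast)
    show "norm (norm (u k)) \<le> C * (\<bar>c * t\<bar> ^ k / fact k)" for k
    proof -
      have "\<bar>u k\<bar> = \<bar>a 0 k\<bar> * (\<bar>c * t\<bar> ^ k / fact k)"
        unfolding u_def abs_mult[of "(c * t) ^ k / fact k"] abs_term by (simp only: mult.commute)
      also have "\<dots> \<le> C * (\<bar>c * t\<bar> ^ k / fact k)"
        by (intro mult_right_mono bound divide_nonneg_pos zero_le_power) auto
      finally show ?thesis by simp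
    qed
  qed
  have "(\<Sum>i\<le>n. u i * v (n - i)) = t ^ n / fact n * a n 0" for n
  proof -
    have "u i * v (n - i) = t ^ n / fact n * (c ^ n * (real (n choose i) * (-1) ^ (n - i) * a 0 (0 + i)))"
      if i: "i \<le> n" for i
    proof -
      have "(- (c * t)) ^ (n - i) = (-1) ^ (n - i) * (c * t) ^ (n - i)"
        by (simp only: power_mult_distrib[symmetric] mult_minus1)
      then have "u i * v (n - i) = ((c * t) ^ i * (c * t) ^ (n - i)) * ((-1) ^ (n - i) / (fact i * fact (n - i)) * a 0 i)"
        unfolding u_def v_def by (simp only: times_divide_eq_left times_divide_eq_right divide_divide_eq_left mult_ac)
      also have "(c * t) ^ i * (c * t) ^ (n - i) = (c * t) ^ n"
        using i by (simp only: power_add[symmetric] le_add_diff_inverse)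
      also have "1 / (fact i * fact (n - i)) = real (n choose i) / fact n"
        using i by (simp add: binomial_fact)
      then have "(-1) ^ (n - i) / (fact i * fact (n - i)) = (-1) ^ (n - i) * (real (n choose i) / fact n)"
        by (metis mult.right_neutral times_divide_eq_right)
      finally show ?thesis
        by (simp add: power_mult_distrib)
    qed
    then show ?thesis
      unfolding iterated_difference[where a = a and n = n and k = 0, OF rec] sum_distrib_left
      by (intro sum.cong) auto
  qed
  then have "(\<lambda>n. t ^ n / fact n * a n 0) sums ((\<Sum>k. u k) * (\<Sum>k. v k))"
    using Cauchy_product_sums[OF u v] by (simp only:)
  then have "(\<Sum>n. t ^ n / fact n * a n 0) = (\<Sum>k. u k) * (\<Sum>k. v k)"
    by (rule sums_unique[symmetric])
  moreover have "(\<Sum>k. v k) = exp (- (c * t))"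
    unfolding v_def by (rule sums_unique[symmetric, OF e])
  ultimately have eq: "(\<Sum>n. t ^ n / fact n * a n 0) = exp (- (c * t)) * (\<Sum>k. u k)"
    by (simp only: mult.commute)
  have "(\<lambda>k. exp (- (c * t)) * u k) sums (exp (- (c * t)) * (\<Sum>k. u k))"
    by (rule sums_mult[OF summable_sums[OF summable_norm_cancel[OF u]]])
  then show ?thesis unfolding eq u_def by (simp only: mult.assoc)
qed

lemma exp_weights_sums: "(\<lambda>k. exp (- s) * (s ^ k / fact k)) sums (1 :: real)"
proof -
  have "(\<lambda>k. exp (- s) * (s ^ k /\<^sub>R fact k)) sums (exp (- s) * exp s)"
    by (intro sums_mult exp_converges)
  then show ?thesis by (simp only: real_scaleR_def divide_inverse mult.commute exp_minus right_inverse exp_not_eq_zero not_False_eq_True)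
qed

section \<open>The averaged exchange operator\<close>

abbreviation wealth_space :: "nat \<Rightarrow> (nat \<Rightarrow> real) measure" where
  "wealth_space N \<equiv> \<Pi>\<^sub>M i\<in>{1..N}. borel"

abbreviation unif :: "real measure" where
  "unif \<equiv> uniform_measure lborel {0..1}"

definition agent_pairs :: "nat \<Rightarrow> (nat \<times> nat) set" where
  "agent_pairs N = {(i, j). i \<in> {1..N} \<and> j \<in> {1..N} \<and> i \<noteq> j}"

text \<open>
  The transition operator of the embedded chain: one exchange by a uniformly chosen ordered pair of
  agents. Every pair has rate \<open>1 / N\<close>, so exchanges happen at the total rate \<open>N - 1\<close>.
\<close>

definition mean_exchange :: "nat \<Rightarrow> ((nat \<Rightarrow> real) \<Rightarrow> real) \<Rightarrow> (nat \<Rightarrow> real) \<Rightarrow> real" where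
  "mean_exchange N f x =
     (\<Sum>(i, j)\<in>agent_pairs N. \<integral>r. f (exchange i j r x) \<partial>unif) / real (card (agent_pairs N))"

lemma prob_space_unif: "prob_space unif"
  by (rule prob_space_uniform_measure) auto

lemma AE_unif: "AE r in unif. r \<in> {0..1}"
  by (rule AE_uniform_measureI) auto

lemma finite_agent_pairs [simp]: "finite (agent_pairs N)"
  by (rule finite_subset[of _ "{1..N} \<times> {1..N}"]) (auto simp: agent_pairs_def)

lemma card_agent_pairs: "card (agent_pairs N) = N * (N - 1)"
proof -
  have "agent_pairs N = (SIGMA i:{1..N}. {1..N} - {i})"
    by (auto simp: agent_pairs_def)
  then show ?thesis by simp
qed

lemma measurable_exchange:
  assumes "i \<in> {1..N}" "j \<in> {1..N}"
  shows "(\<lambda>(x, r). exchange i j r x) \<in> wealth_space N \<Otimes>\<^sub>M borel \<rightarrow>\<^sub>M wealth_space N"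
proof -
  have coord: "(\<lambda>p. fst p k) \<in> borel_measurable (wealth_space N \<Otimes>\<^sub>M borel)" if "k \<in> {1..N}" for k
    using that by measurable
  show ?thesis
  proof (rule measurable_PiM_single')
    fix k assume k: "k \<in> {1..N}"
    note [measurable] = coord[OF assms(1)] coord[OF assms(2)] coord[OF k]
    show "(\<lambda>p. (case p of (x, r) \<Rightarrow> exchange i j r x) k) \<in> borel_measurable (wealth_space N \<Otimes>\<^sub>M borel)"
      unfolding exchange_def case_prod_beta fun_upd_apply by measurable
  next
    show "(\<lambda>p k. (case p of (x, r) \<Rightarrow> exchange i j r x) k)
        \<in> space (wealth_space N \<Otimes>\<^sub>M borel) \<rightarrow> (\<Pi>\<^sub>E i\<in>{1..N}. space borel)"
      using assms by (auto simp: space_pair_measure space_PiM PiE_def extensional_def exchange_def)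
  qed
qed

lemma exchange_in_space:
  assumes "i \<in> {1..N}" "j \<in> {1..N}" "x \<in> space (wealth_space N)"
  shows "exchange i j r x \<in> space (wealth_space N)"
  using assms by (auto simp: space_PiM PiE_def extensional_def exchange_def)

lemma measurable_exchange_share:
  assumes "(i, j) \<in> agent_pairs N" "x \<in> space (wealth_space N)"
  shows "(\<lambda>r. exchange i j r x) \<in> borel \<rightarrow>\<^sub>M wealth_space N"
  using measurable_compose[OF measurable_Pair1'[OF assms(2)] measurable_exchange] assms(1)
  by (auto simp: agent_pairs_def)

lemma integrable_exchange:
  assumes "(i, j) \<in> agent_pairs N" "x \<in> space (wealth_space N)"
    and f: "f \<in> borel_measurable (wealth_space N)" "\<And>x. x \<in> space (wealth_space N) \<Longrightarrow> \<bar>f x\<bar> \<le> (C :: real)"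
  shows "integrable unif (\<lambda>r. f (exchange i j r x))"
proof -
  interpret prob_space unif by (rule prob_space_unif)
  show ?thesis
  proof (rule integrable_const_bound[where B = C])
    show "(\<lambda>r. f (exchange i j r x)) \<in> borel_measurable unif"
      using measurable_compose[OF measurable_exchange_share[OF assms(1,2)] f(1)] by simp
    show "AE r in unif. norm (f (exchange i j r x)) \<le> C"
      using exchange_in_space[of i N j x] assms by (auto intro!: f(2) simp: agent_pairs_def)
  qed
qed

lemma mean_exchange_measurable:
  assumes f: "f \<in> borel_measurable (wealth_space N)"
  shows "mean_exchange N f \<in> borel_measurable (wealth_space N)"
proof -
  interpret prob_space unif by (rule prob_space_unif)
  have "(\<lambda>x. \<integral>r. f (exchange i j r x) \<partial>unif) \<in> borel_measurable (wealth_space N)"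
    if "(i, j) \<in> agent_pairs N" for i j
  proof (rule borel_measurable_lebesgue_integral)
    have "(\<lambda>p. f (case p of (x, r) \<Rightarrow> exchange i j r x)) \<in> borel_measurable (wealth_space N \<Otimes>\<^sub>M borel)"
      using that by (intro measurable_compose[OF measurable_exchange f]) (auto simp: agent_pairs_def)
    moreover have "sets (wealth_space N \<Otimes>\<^sub>M unif) = sets (wealth_space N \<Otimes>\<^sub>M borel)"
      by (intro sets_pair_measure_cong) auto
    ultimately show "(\<lambda>(x, r). f (exchange i j r x)) \<in> borel_measurable (wealth_space N \<Otimes>\<^sub>M unif)"
      by (simp add: case_prod_beta cong: measurable_cong_sets)
  qed
  then have "(\<lambda>x. (\<Sum>p\<in>agent_pairs N. \<integral>r. f (exchange (fst p) (snd p) r x) \<partial>unif) / real (card (agent_pairs N)))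
      \<in> borel_measurable (wealth_space N)"
    by (intro borel_measurable_divide borel_measurable_sum borel_measurable_const) auto
  then show ?thesis
    unfolding mean_exchange_def[abs_def] case_prod_beta .
qed

text \<open>
  Exchanging in \<open>x\<close> and in \<open>y\<close> with the same pair and the same share couples the two averages; a bound
  that holds for every pair and share survives averaging. Boundedness and Lipschitz continuity of
  averages are both instances.
\<close>

lemma mean_exchange_diff_le:
  assumes N: "N \<ge> 2" and xy: "x \<in> space (wealth_space N)" "y \<in> space (wealth_space N)"
    and f: "f \<in> borel_measurable (wealth_space N)" "\<And>x. x \<in> space (wealth_space N) \<Longrightarrow> \<bar>f x\<bar> \<le> C"
    and g: "g \<in> borel_measurable (wealth_space N)" "\<And>x. x \<in> space (wealth_space N) \<Longrightarrow> \<bar>g x\<bar> \<le> C"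
    and le: "\<And>i j r. (i, j) \<in> agent_pairs N \<Longrightarrow> r \<in> {0..1} \<Longrightarrow>
                \<bar>f (exchange i j r x) - g (exchange i j r y)\<bar> \<le> D"
  shows "\<bar>mean_exchange N f x - mean_exchange N g y\<bar> \<le> D"
proof -
  interpret prob_space unif by (rule prob_space_unif)
  have pos: "real (card (agent_pairs N)) > 0"
    using N by (simp add: card_agent_pairs)
  have 1: "\<bar>(\<integral>r. f (exchange i j r x) \<partial>unif) - (\<integral>r. g (exchange i j r y) \<partial>unif)\<bar> \<le> D"
    if p: "(i, j) \<in> agent_pairs N" for i j
  proof -
    have int: "integrable unif (\<lambda>r. f (exchange i j r x))" "integrable unif (\<lambda>r. g (exchange i j r y))"
      using integrable_exchange[OF p xy(1) f] integrable_exchange[OF p xy(2) g] by auto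
    have "\<bar>(\<integral>r. f (exchange i j r x) \<partial>unif) - (\<integral>r. g (exchange i j r y) \<partial>unif)\<bar>
        = \<bar>\<integral>r. f (exchange i j r x) - g (exchange i j r y) \<partial>unif\<bar>"
      using int by simp
    also have "\<dots> \<le> (\<integral>r. \<bar>f (exchange i j r x) - g (exchange i j r y)\<bar> \<partial>unif)"
      by (rule integral_abs_bound)
    also have "\<dots> \<le> D"
    proof (rule integral_le_const)
      show "AE r in unif. \<bar>f (exchange i j r x) - g (exchange i j r y)\<bar> \<le> D"
        using AE_unif by eventually_elim (rule le[OF p])
    qed (use int in auto)
    finally show ?thesis .
  qed
  have "\<bar>mean_exchange N f x - mean_exchange N g y\<bar>
      = \<bar>\<Sum>(i, j)\<in>agent_pairs N. (\<integral>r. f (exchange i j r x) \<partial>unif) - (\<integral>r. g (exchange i j r y) \<partial>unif)\<bar>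
         / real (card (agent_pairs N))"
    using pos by (simp add: mean_exchange_def case_prod_beta sum_subtractf diff_divide_distrib[symmetric] abs_divide)
  also have "\<dots> \<le> (\<Sum>(i, j)\<in>agent_pairs N. D) / real (card (agent_pairs N))"
    using pos 1 by (intro divide_right_mono order_trans[OF sum_abs] sum_mono) auto
  also have "\<dots> = D"
    using pos by (cases "agent_pairs N = {}") auto
  finally show ?thesis .
qed

lemma mean_exchange_bound:
  assumes "N \<ge> 2" "x \<in> space (wealth_space N)"
    and "f \<in> borel_measurable (wealth_space N)" "\<And>x. x \<in> space (wealth_space N) \<Longrightarrow> \<bar>f x\<bar> \<le> C"
  shows "\<bar>mean_exchange N f x\<bar> \<le> C"
proof -
  have C: "0 \<le> C" using assms(4)[OF assms(2)] by linarith
  have "\<bar>mean_exchange N f x - mean_exchange N (\<lambda>_. 0) x\<bar> \<le> C"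
    by (rule mean_exchange_diff_le[OF assms(1) assms(2) assms(2) assms(3,4)])
       (use C assms in \<open>auto intro!: assms(4) exchange_in_space simp: agent_pairs_def\<close>)
  then show ?thesis by (simp add: mean_exchange_def)
qed

lemma mean_exchange_cong:
  assumes "x \<in> space (wealth_space N)" "\<And>x. x \<in> space (wealth_space N) \<Longrightarrow> f x = g x"
  shows "mean_exchange N f x = mean_exchange N g x"
proof -
  have "f (exchange i j r x) = g (exchange i j r x)" if "(i, j) \<in> agent_pairs N" for i j r
    using that assms by (auto intro!: assms(2) exchange_in_space simp: agent_pairs_def)
  then show ?thesis
    unfolding mean_exchange_def case_prod_beta
    by (intro arg_cong2[where f = "(/)"] sum.cong refl Bochner_Integration.integral_cong) auto
qed

lemma mean_exchange_lincomb:
  assumes "x \<in> space (wealth_space N)"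
    and f: "f \<in> borel_measurable (wealth_space N)" "\<And>x. x \<in> space (wealth_space N) \<Longrightarrow> \<bar>f x\<bar> \<le> C"
    and g: "g \<in> borel_measurable (wealth_space N)" "\<And>x. x \<in> space (wealth_space N) \<Longrightarrow> \<bar>g x\<bar> \<le> D"
  shows "mean_exchange N (\<lambda>x. c * (f x - g x)) x = c * (mean_exchange N f x - mean_exchange N g x)"
proof -
  have "(\<integral>r. c * (f (exchange i j r x) - g (exchange i j r x)) \<partial>unif)
      = c * ((\<integral>r. f (exchange i j r x) \<partial>unif) - (\<integral>r. g (exchange i j r x) \<partial>unif))"
    if "(i, j) \<in> agent_pairs N" for i j
    using integrable_exchange[OF that assms(1) f] integrable_exchange[OF that assms(1) g] by simp
  then have "(\<Sum>(i, j)\<in>agent_pairs N. \<integral>r. c * (f (exchange i j r x) - g (exchange i j r x)) \<partial>unif)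
    = (\<Sum>(i, j)\<in>agent_pairs N. c * ((\<integral>r. f (exchange i j r x) \<partial>unif) - (\<integral>r. g (exchange i j r x) \<partial>unif)))"
    by (intro sum.cong) auto
  also have "\<dots> = c * ((\<Sum>(i, j)\<in>agent_pairs N. \<integral>r. f (exchange i j r x) \<partial>unif)
      - (\<Sum>(i, j)\<in>agent_pairs N. \<integral>r. g (exchange i j r x) \<partial>unif))"
    unfolding case_prod_beta sum_subtractf[symmetric] sum_distrib_left by simp
  finally show ?thesis
    unfolding mean_exchange_def diff_divide_distrib[symmetric] by simp
qed

lemma exchange_generator_eq:
  assumes N: "N \<ge> 2" and x: "x \<in> space (wealth_space N)"
    and f: "f \<in> borel_measurable (wealth_space N)" "\<And>x. x \<in> space (wealth_space N) \<Longrightarrow> \<bar>f x\<bar> \<le> C"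
  shows "exchange_generator N f x = (real N - 1) * (mean_exchange N f x - f x)"
proof -
  interpret prob_space unif by (rule prob_space_unif)
  have "(\<integral>r. (f (exchange i j r x) - f x) \<partial>unif) = (\<integral>r. f (exchange i j r x) \<partial>unif) - f x"
    if "(i, j) \<in> agent_pairs N" for i j
    using integrable_exchange[OF that x f] by (simp add: prob_space)
  then have "exchange_generator N f x = (\<Sum>(i, j)\<in>agent_pairs N. (1 / real N) * ((\<integral>r. f (exchange i j r x) \<partial>unif) - f x))"
    unfolding exchange_generator_def agent_pairs_def[symmetric] by (intro sum.cong) auto
  also have "\<dots> = ((\<Sum>(i, j)\<in>agent_pairs N. \<integral>r. f (exchange i j r x) \<partial>unif) - real (card (agent_pairs N)) * f x) / real N"
    by (simp add: case_prod_beta sum_divide_distrib[symmetric] sum_subtractf)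
  also have "\<dots> = (real N - 1) * (mean_exchange N f x - f x)"
    using N by (simp add: mean_exchange_def card_agent_pairs of_nat_diff field_simps)
  finally show ?thesis .
qed

text \<open>
  With the pair and the share fixed, an exchange is linear, and it splits the difference of the two
  pair totals into parts of the same sign, of total size at most the sum of the two old differences.
\<close>

lemma exchange_l1_contraction:
  assumes "(i, j) \<in> agent_pairs N" "r \<in> {0..1}"
  shows "(\<Sum>k=1..N. \<bar>exchange i j r x k - exchange i j r y k\<bar>) \<le> (\<Sum>k=1..N. \<bar>x k - y k\<bar>)"
proof -
  have ij: "i \<in> {1..N}" "j \<in> {1..N} - {i}" "i \<noteq> j"
    using assms(1) by (auto simp: agent_pairs_def)
  have split: "(\<Sum>k=1..N. h k) = h i + h j + (\<Sum>k\<in>{1..N} - {i} - {j}. h k)" for h :: "nat \<Rightarrow> real"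
    unfolding sum.remove[OF _ ij(1), of h, OF finite_atLeastAtMost]
      sum.remove[OF _ ij(2), of h, OF finite_Diff[OF finite_atLeastAtMost]] by simp
  define s where "s = (x i + x j) - (y i + y j)"
  have "\<bar>exchange i j r x i - exchange i j r y i\<bar> + \<bar>exchange i j r x j - exchange i j r y j\<bar>
      = \<bar>r * s\<bar> + \<bar>(1 - r) * s\<bar>"
    using ij(3) by (simp add: exchange_def s_def algebra_simps)
  also have "\<dots> = r * \<bar>s\<bar> + (1 - r) * \<bar>s\<bar>"
    using assms(2) by (simp add: abs_mult)
  also have "\<dots> = \<bar>s\<bar>"
    by (simp add: algebra_simps)
  also have "\<dots> \<le> \<bar>x i - y i\<bar> + \<bar>x j - y j\<bar>"
    by (simp add: s_def)
  finally have "\<bar>exchange i j r x i - exchange i j r y i\<bar> + \<bar>exchange i j r x j - exchange i j r y j\<bar>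
      \<le> \<bar>x i - y i\<bar> + \<bar>x j - y j\<bar>" .
  moreover have "(\<Sum>k\<in>{1..N} - {i} - {j}. \<bar>exchange i j r x k - exchange i j r y k\<bar>)
      = (\<Sum>k\<in>{1..N} - {i} - {j}. \<bar>x k - y k\<bar>)"
    by (intro sum.cong) (auto simp: exchange_def)
  ultimately show ?thesis
    unfolding split by linarith
qed

section \<open>The transition semigroup of the exchange process\<close>

lemma mean_exchange_iter:
  assumes N: "N \<ge> 2"
    and f: "f \<in> borel_measurable (wealth_space N)" "\<And>x. x \<in> space (wealth_space N) \<Longrightarrow> \<bar>f x\<bar> \<le> C"
  shows "(mean_exchange N ^^ k) f \<in> borel_measurable (wealth_space N)"
    and "x \<in> space (wealth_space N) \<Longrightarrow> \<bar>(mean_exchange N ^^ k) f x\<bar> \<le> C"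
proof (induction k arbitrary: x)
  case (Suc k)
  { case 1 then show ?case using mean_exchange_measurable[OF Suc(1)] by simp }
  { case 2 then show ?case using mean_exchange_bound[OF N 2 Suc(1,2)] by simp }
qed (use f in auto)

lemma mean_exchange_iter_cong:
  assumes "x \<in> space (wealth_space N)" "\<And>x. x \<in> space (wealth_space N) \<Longrightarrow> f x = g x"
  shows "(mean_exchange N ^^ k) f x = (mean_exchange N ^^ k) g x"
  using assms(1)
proof (induction k arbitrary: x)
  case (Suc k)
  show ?case using mean_exchange_cong[OF Suc.prems Suc.IH] by simp
qed (use assms(2) in auto)

lemma mean_exchange_iter_lincomb:
  assumes N: "N \<ge> 2" and "x \<in> space (wealth_space N)"
    and f: "f \<in> borel_measurable (wealth_space N)" "\<And>x. x \<in> space (wealth_space N) \<Longrightarrow> \<bar>f x\<bar> \<le> C"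
    and g: "g \<in> borel_measurable (wealth_space N)" "\<And>x. x \<in> space (wealth_space N) \<Longrightarrow> \<bar>g x\<bar> \<le> D"
  shows "(mean_exchange N ^^ k) (\<lambda>x. c * (f x - g x)) x
       = c * ((mean_exchange N ^^ k) f x - (mean_exchange N ^^ k) g x)"
  using assms(2)
proof (induction k arbitrary: x)
  case (Suc k)
  have "(mean_exchange N ^^ Suc k) (\<lambda>x. c * (f x - g x)) x
      = mean_exchange N (\<lambda>y. c * ((mean_exchange N ^^ k) f y - (mean_exchange N ^^ k) g y)) x"
    using mean_exchange_cong[OF Suc.prems Suc.IH] by simp
  also have "\<dots> = c * ((mean_exchange N ^^ Suc k) f x - (mean_exchange N ^^ Suc k) g x)"
    using mean_exchange_lincomb[OF Suc.prems mean_exchange_iter[OF N f] mean_exchange_iter[OF N g]] by simp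
  finally show ?case .
qed simp

lemma exchange_generator_iter:
  assumes N: "N \<ge> 2"
    and f: "f \<in> borel_measurable (wealth_space N)" "\<And>x. x \<in> space (wealth_space N) \<Longrightarrow> \<bar>f x\<bar> \<le> C"
  shows "(exchange_generator N ^^ n) f \<in> borel_measurable (wealth_space N)"
    and "\<exists>D. \<forall>x\<in>space (wealth_space N). \<bar>(exchange_generator N ^^ n) f x\<bar> \<le> D"
proof (induction n)
  case (Suc n)
  define g where "g = (exchange_generator N ^^ n) f"
  from Suc(2) obtain D where D: "\<bar>g x\<bar> \<le> D" if "x \<in> space (wealth_space N)" for x
    unfolding g_def by blast
  have g: "g \<in> borel_measurable (wealth_space N)" using Suc(1) by (simp add: g_def)
  have eq: "exchange_generator N g x = (real N - 1) * (mean_exchange N g x - g x)"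
    if "x \<in> space (wealth_space N)" for x
    by (rule exchange_generator_eq[OF N that g D])
  { case 1
    have "(\<lambda>x. (real N - 1) * (mean_exchange N g x - g x)) \<in> borel_measurable (wealth_space N)"
      using g mean_exchange_measurable[OF g] by measurable
    then have "exchange_generator N g \<in> borel_measurable (wealth_space N)"
      by (subst measurable_cong[OF eq])
    then show ?case by (simp add: g_def) }
  { case 2
    have "\<bar>exchange_generator N g x\<bar> \<le> (real N - 1) * (D + D)" if x: "x \<in> space (wealth_space N)" for x
    proof -
      have "\<bar>mean_exchange N g x\<bar> \<le> D"
        by (rule mean_exchange_bound[OF N x g D])
      then show ?thesis
        using N D[OF x] unfolding eq[OF x] abs_mult by (intro mult_mono) auto
    qed
    then show ?case unfolding g_def by auto }
qed (use f in auto)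

lemma jump_semigroup_poisson_sums:
  assumes N: "N \<ge> 2" and x: "x \<in> space (wealth_space N)"
    and f: "f \<in> borel_measurable (wealth_space N)" "\<And>x. x \<in> space (wealth_space N) \<Longrightarrow> \<bar>f x\<bar> \<le> C"
  shows "(\<lambda>k. exp (- ((real N - 1) * t)) * (((real N - 1) * t) ^ k / fact k) * (mean_exchange N ^^ k) f x)
           sums jump_semigroup (exchange_generator N) t f x"
proof -
  define a where "a n k = (mean_exchange N ^^ k) ((exchange_generator N ^^ n) f) x" for n k
  have "(\<lambda>k. exp (- ((real N - 1) * t)) * (((real N - 1) * t) ^ k / fact k) * a 0 k) sums (\<Sum>n. t ^ n / fact n * a n 0)"
  proof (rule poisson_mixture_sums)
    fix n k
    define g where "g = (exchange_generator N ^^ n) f"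
    obtain D where D: "\<bar>g x\<bar> \<le> D" if "x \<in> space (wealth_space N)" for x
      unfolding g_def using exchange_generator_iter(2)[where n = n, OF N f] by blast
    have g: "g \<in> borel_measurable (wealth_space N)"
      unfolding g_def by (rule exchange_generator_iter(1)[OF N f])
    have "a (Suc n) k = (mean_exchange N ^^ k) (\<lambda>y. (real N - 1) * (mean_exchange N g y - g y)) x"
      unfolding a_def using mean_exchange_iter_cong[OF x exchange_generator_eq[OF N _ g D]]
      by (simp add: g_def)
    also have "\<dots> = (real N - 1) * ((mean_exchange N ^^ k) (mean_exchange N g) x - (mean_exchange N ^^ k) g x)"
      by (rule mean_exchange_iter_lincomb[OF N x mean_exchange_measurable[OF g]
          mean_exchange_bound[OF N _ g D] g D])
    also have "\<dots> = (real N - 1) * (a n (Suc k) - a n k)"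
      by (simp add: a_def g_def funpow_swap1)
    finally show "a (Suc n) k = (real N - 1) * (a n (Suc k) - a n k)" .
  next
    show "\<bar>a 0 k\<bar> \<le> C" for k
      using mean_exchange_iter(2)[OF N f x] by (simp add: a_def)
  qed
  then show ?thesis
    by (simp add: a_def jump_semigroup_def)
qed

lemma jump_semigroup_measurable:
  assumes N: "N \<ge> 2"
    and f: "f \<in> borel_measurable (wealth_space N)" "\<And>x. x \<in> space (wealth_space N) \<Longrightarrow> \<bar>f x\<bar> \<le> C"
  shows "jump_semigroup (exchange_generator N) t f \<in> borel_measurable (wealth_space N)"
proof -
  have [measurable]: "(exchange_generator N ^^ n) f \<in> borel_measurable (wealth_space N)" for n
    by (rule exchange_generator_iter(1)[OF N f])
  show ?thesis
    unfolding jump_semigroup_def[abs_def] by measurable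
qed

lemma jump_semigroup_bound:
  assumes N: "N \<ge> 2" and x: "x \<in> space (wealth_space N)" and t: "t \<ge> 0"
    and f: "f \<in> borel_measurable (wealth_space N)" "\<And>x. x \<in> space (wealth_space N) \<Longrightarrow> \<bar>f x\<bar> \<le> C"
  shows "\<bar>jump_semigroup (exchange_generator N) t f x\<bar> \<le> C"
proof -
  define w where "w k = exp (- ((real N - 1) * t)) * (((real N - 1) * t) ^ k / fact k)" for k
  have w: "w k \<ge> 0" for k using t N by (simp add: w_def)
  have sums: "(\<lambda>k. w k * (mean_exchange N ^^ k) f x) sums jump_semigroup (exchange_generator N) t f x"
    unfolding w_def by (rule jump_semigroup_poisson_sums[OF N x f])
  have C: "(\<lambda>k. w k * C) sums C"
    using sums_mult2[OF exp_weights_sums, where c = C] by (simp add: w_def)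
  have le: "w k * (mean_exchange N ^^ k) f x \<le> w k * C" "w k * - C \<le> w k * (mean_exchange N ^^ k) f x" for k
    using mean_exchange_iter(2)[where k = k, OF N f x] w[of k] by (intro mult_left_mono; simp add: abs_le_iff)+
  have "jump_semigroup (exchange_generator N) t f x \<le> C"
    by (rule sums_le[OF le(1) sums C])
  moreover have "- C \<le> jump_semigroup (exchange_generator N) t f x"
    by (rule sums_le[OF le(2) _ sums]) (use sums_minus[OF C] in simp)
  ultimately show ?thesis by simp
qed

text \<open>
  The constant \<open>L\<close> depends neither on the time nor on the number of agents, although the number of
  exchanges grows with both. This stability lets an initial error of size \<open>o(N)\<close> persist as an
  error of size \<open>o(N)\<close>.
\<close>

lemma jump_semigroup_lipschitz:
  assumes N: "N \<ge> 2" and xy: "x \<in> space (wealth_space N)" "y \<in> space (wealth_space N)" and t: "t \<ge> 0"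
    and f: "f \<in> borel_measurable (wealth_space N)" "\<And>x. x \<in> space (wealth_space N) \<Longrightarrow> \<bar>f x\<bar> \<le> C"
    and L: "L \<ge> 0"
    and lip: "\<And>x y. x \<in> space (wealth_space N) \<Longrightarrow> y \<in> space (wealth_space N) \<Longrightarrow>
                \<bar>f x - f y\<bar> \<le> L * (\<Sum>i=1..N. \<bar>x i - y i\<bar>)"
  shows "\<bar>jump_semigroup (exchange_generator N) t f x - jump_semigroup (exchange_generator N) t f y\<bar>
           \<le> L * (\<Sum>i=1..N. \<bar>x i - y i\<bar>)"
proof -
  have K: "\<bar>(mean_exchange N ^^ k) f x - (mean_exchange N ^^ k) f y\<bar> \<le> L * (\<Sum>i=1..N. \<bar>x i - y i\<bar>)"
    if "x \<in> space (wealth_space N)" "y \<in> space (wealth_space N)" for k x y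
    using that
  proof (induction k arbitrary: x y)
    case (Suc k)
    define h where "h = (mean_exchange N ^^ k) f"
    have h: "h \<in> borel_measurable (wealth_space N)" "\<bar>h z\<bar> \<le> C" if "z \<in> space (wealth_space N)" for z
      unfolding h_def using mean_exchange_iter[where k = k, OF N f] that by auto
    have "\<bar>mean_exchange N h x - mean_exchange N h y\<bar> \<le> L * (\<Sum>i=1..N. \<bar>x i - y i\<bar>)"
    proof (rule mean_exchange_diff_le[OF N Suc.prems, where C = C])
      fix i j and r :: real
      assume p: "(i, j) \<in> agent_pairs N" and r: "r \<in> {0..1}"
      have "exchange i j r x \<in> space (wealth_space N)" "exchange i j r y \<in> space (wealth_space N)"
        using p Suc.prems exchange_in_space[of i N j] by (simp_all add: agent_pairs_def)
      then have "\<bar>h (exchange i j r x) - h (exchange i j r y)\<bar>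
          \<le> L * (\<Sum>l=1..N. \<bar>exchange i j r x l - exchange i j r y l\<bar>)"
        unfolding h_def by (rule Suc.IH)
      also have "\<dots> \<le> L * (\<Sum>l=1..N. \<bar>x l - y l\<bar>)"
        by (rule mult_left_mono[OF exchange_l1_contraction[OF p r] L])
      finally show "\<bar>h (exchange i j r x) - h (exchange i j r y)\<bar> \<le> L * (\<Sum>i=1..N. \<bar>x i - y i\<bar>)" .
    qed (use h Suc.prems in auto)
    then show ?case by (simp add: h_def)
  qed (use lip in auto)
  define M where "M = L * (\<Sum>i=1..N. \<bar>x i - y i\<bar>)"
  define w where "w k = exp (- ((real N - 1) * t)) * (((real N - 1) * t) ^ k / fact k)" for k
  have w: "w k \<ge> 0" for k using t N by (simp add: w_def)
  have sums: "(\<lambda>k. w k * (mean_exchange N ^^ k) f x - w k * (mean_exchange N ^^ k) f y)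
      sums (jump_semigroup (exchange_generator N) t f x - jump_semigroup (exchange_generator N) t f y)"
    unfolding w_def by (intro sums_diff jump_semigroup_poisson_sums[OF N _ f] xy)
  have M: "(\<lambda>k. w k * M) sums M"
    using sums_mult2[OF exp_weights_sums, where c = M] by (simp add: w_def)
  have le: "w k * (mean_exchange N ^^ k) f x - w k * (mean_exchange N ^^ k) f y \<le> w k * M"
     "w k * - M \<le> w k * (mean_exchange N ^^ k) f x - w k * (mean_exchange N ^^ k) f y" for k
    using K[OF xy, where k = k] w[of k] unfolding right_diff_distrib[symmetric] M_def[symmetric]
    by (intro mult_left_mono; simp add: abs_le_iff)+
  have "jump_semigroup (exchange_generator N) t f x - jump_semigroup (exchange_generator N) t f y \<le> M"
    by (rule sums_le[OF le(1) sums M])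
  moreover have "- M \<le> jump_semigroup (exchange_generator N) t f x - jump_semigroup (exchange_generator N) t f y"
    by (rule sums_le[OF le(2) _ sums]) (use sums_minus[OF M] in simp)
  ultimately show ?thesis unfolding M_def by linarith
qed

text \<open>
  Invariance under a single averaged exchange passes to all powers of the averaging operator, hence
  to their Poisson mixture.
\<close>

lemma jump_semigroup_stationary:
  assumes N: "N \<ge> 2" and t: "t \<ge> 0"
    and Q: "prob_space Q" "sets Q = sets (wealth_space N)"
    and inv: "\<And>g C. g \<in> borel_measurable (wealth_space N) \<Longrightarrow>
                (\<And>x. x \<in> space (wealth_space N) \<Longrightarrow> \<bar>g x\<bar> \<le> C) \<Longrightarrow>
                (\<integral>x. mean_exchange N g x \<partial>Q) = (\<integral>x. g x \<partial>Q)"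
    and f: "f \<in> borel_measurable (wealth_space N)" "\<And>x. x \<in> space (wealth_space N) \<Longrightarrow> \<bar>f x\<bar> \<le> C"
  shows "(\<integral>x. jump_semigroup (exchange_generator N) t f x \<partial>Q) = (\<integral>x. f x \<partial>Q)"
proof -
  interpret Q: prob_space Q by fact
  have space: "space Q = space (wealth_space N)" by (rule sets_eq_imp_space_eq[OF Q(2)])
  define w where "w k = exp (- ((real N - 1) * t)) * (((real N - 1) * t) ^ k / fact k)" for k
  have w: "w k \<ge> 0" for k using t N by (simp add: w_def)
  have wsum: "w sums 1" unfolding w_def[abs_def] by (rule exp_weights_sums)
  have meas: "(mean_exchange N ^^ k) f \<in> borel_measurable Q" for k
    using mean_exchange_iter(1)[OF N f] by (simp add: Q(2) cong: measurable_cong_sets)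
  have bound: "\<bar>(mean_exchange N ^^ k) f x\<bar> \<le> C" if "x \<in> space Q" for k x
    using mean_exchange_iter(2)[OF N f] that by (simp add: space)
  have int: "integrable Q ((mean_exchange N ^^ k) f)" for k
    by (rule Q.integrable_const_bound[where B = C]) (use meas bound in auto)
  have eq: "(\<integral>x. (mean_exchange N ^^ k) f x \<partial>Q) = (\<integral>x. f x \<partial>Q)" for k
  proof (induction k)
    case (Suc k)
    then show ?case using inv[OF mean_exchange_iter[where k = k, OF N f]] by simp
  qed simp
  have le: "norm (w k * (mean_exchange N ^^ k) f x) \<le> w k * C" if "x \<in> space Q" for k x
    using mult_left_mono[OF bound[OF that, of k] w[of k]] w[of k] by (simp add: abs_mult)
  have sumC: "summable (\<lambda>k. w k * C)"
    by (rule summable_mult2[OF sums_summable[OF wsum]])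
  have "(\<lambda>k. \<integral>x. w k * (mean_exchange N ^^ k) f x \<partial>Q) sums (\<integral>x. (\<Sum>k. w k * (mean_exchange N ^^ k) f x) \<partial>Q)"
  proof (rule sums_integral)
    show "integrable Q (\<lambda>x. w k * (mean_exchange N ^^ k) f x)" for k
      using int by simp
    show "AE x in Q. summable (\<lambda>k. norm (w k * (mean_exchange N ^^ k) f x))"
    proof (rule AE_I2, rule summable_comparison_test'[OF sumC])
      show "norm (norm (w k * (mean_exchange N ^^ k) f x)) \<le> w k * C" if "x \<in> space Q" for x k
        using le[OF that] by simp
    qed
    show "summable (\<lambda>k. \<integral>x. norm (w k * (mean_exchange N ^^ k) f x) \<partial>Q)"
    proof (rule summable_comparison_test'[OF sumC])
      fix k
      have "(\<integral>x. norm (w k * (mean_exchange N ^^ k) f x) \<partial>Q) \<le> w k * C"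
        by (rule Q.integral_le_const) (use int[of k] le[of _ k] in auto)
      then show "norm (\<integral>x. norm (w k * (mean_exchange N ^^ k) f x) \<partial>Q) \<le> w k * C" by simp
    qed
  qed
  moreover have "(\<integral>x. (\<Sum>k. w k * (mean_exchange N ^^ k) f x) \<partial>Q)
      = (\<integral>x. jump_semigroup (exchange_generator N) t f x \<partial>Q)"
    unfolding w_def
    by (intro Bochner_Integration.integral_cong refl sums_unique[symmetric] jump_semigroup_poisson_sums[OF N _ f])
       (simp_all add: space)
  moreover have "(\<lambda>k. \<integral>x. w k * (mean_exchange N ^^ k) f x \<partial>Q) sums (\<integral>x. f x \<partial>Q)"
    using sums_mult2[OF wsum, of "\<integral>x. f x \<partial>Q"] by (simp add: eq)
  ultimately show ?thesis
    by (simp add: sums_iff)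
qed

text \<open>
  The Markov property at time \<open>0\<close>, averaged over the initial state.
\<close>

lemma markov_expectation:
  assumes M: "prob_space M" and mp: "markov_jump_process M S L X" and t: "t \<ge> 0"
    and f: "f \<in> borel_measurable S" "\<And>x. x \<in> space S \<Longrightarrow> \<bar>f x\<bar> \<le> C"
    and meas: "jump_semigroup L t f \<in> borel_measurable S"
  shows "(\<integral>\<omega>. f (X t \<omega>) \<partial>M) = (\<integral>\<omega>. jump_semigroup L t f (X 0 \<omega>) \<partial>M)"
proof -
  interpret prob_space M by fact
  have X: "X u \<in> M \<rightarrow>\<^sub>M S" if "u \<ge> 0" for u
    using mp that unfolding markov_jump_process_def by blast
  have "bounded (f ` space S)"
    unfolding bounded_iff using f(2) by auto
  then have AE: "AE \<omega> in M. real_cond_exp M (history M S X 0) (\<lambda>\<omega>. f (X (0 + t) \<omega>)) \<omega> = jump_semigroup L t f (X 0 \<omega>)"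
    using mp t f(1) unfolding markov_jump_process_def by blast
  have sub: "subalgebra M (history M S X 0)"
  proof -
    have "(\<Union>u\<in>{0..0}. {X u -` A \<inter> space M | A. A \<in> sets S}) \<subseteq> sets M"
      using measurable_sets[OF X] by auto
    then show ?thesis
      unfolding subalgebra_def history_def
      by (simp add: space_measure_of_conv sets_measure_of_conv sets.sigma_sets_subset
          sets.space_closed subset_trans)
  qed
  interpret finite_measure_subalgebra M "history M S X 0"
    by standard (rule sub)
  have meas_fX: "(\<lambda>\<omega>. f (X t \<omega>)) \<in> borel_measurable M"
    by (rule measurable_compose[OF X[OF t] f(1)])
  have "integrable M (\<lambda>\<omega>. f (X t \<omega>))"
    by (rule integrable_const_bound[where B = C])
       (use meas_fX measurable_space[OF X[OF t]] f(2) in auto)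
  then have "(\<integral>\<omega>. f (X t \<omega>) \<partial>M) = (\<integral>\<omega>. real_cond_exp M (history M S X 0) (\<lambda>\<omega>. f (X t \<omega>)) \<omega> \<partial>M)"
    by (rule real_cond_exp_int(2)[symmetric])
  also have "\<dots> = (\<integral>\<omega>. jump_semigroup L t f (X 0 \<omega>) \<partial>M)"
    by (rule integral_cong_AE)
       (use AE measurable_compose[OF X meas] in auto)
  finally show ?thesis .
qed

section \<open>Stationarity of independent exponential wealths\<close>

lemma sets_Exp1 [measurable_cong, simp]: "sets Exp1 = sets borel"
  by (simp add: Exp1_def)

lemma space_Exp1 [simp]: "space Exp1 = UNIV"
  by (simp add: Exp1_def)

lemma prob_space_Exp1: "prob_space Exp1"
  unfolding Exp1_def by (rule prob_space_exponential_density) simp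

lemma nn_integral_Exp1:
  assumes [measurable]: "f \<in> borel_measurable borel"
  shows "(\<integral>\<^sup>+x. f x \<partial>Exp1) = (\<integral>\<^sup>+x. ennreal (exp (- x)) * f x * indicator {0..} x \<partial>lborel)"
  unfolding Exp1_def
  by (subst nn_integral_density)
     (auto intro!: nn_integral_cong simp: exponential_density_def split: split_indicator)

lemma nn_integral_unif:
  assumes [measurable]: "f \<in> borel_measurable borel"
  shows "(\<integral>\<^sup>+r. f r \<partial>unif) = (\<integral>\<^sup>+r. f r * indicator {0..1} r \<partial>lborel)"
  by (subst nn_integral_uniform_measure) (auto simp: divide_ennreal_def)

text \<open>
  In the coordinates total \<open>s = a + b\<close> and share \<open>r = a / s\<close>, two independent \<open>Exp(1)\<close> variables have
  the product density \<open>s exp (- s)\<close> on \<open>s > 0\<close> times the uniform density on \<open>0 \<le> r \<le> 1\<close>.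
  The change of variables is a translation in \<open>b\<close> for fixed \<open>a\<close>, followed by a dilation in \<open>a\<close> for
  fixed \<open>s\<close>.
\<close>

lemma exponential_pair_as_sum_and_share:
  fixes h :: "real \<Rightarrow> real \<Rightarrow> ennreal"
  assumes [measurable]: "case_prod h \<in> borel_measurable (borel \<Otimes>\<^sub>M borel)"
  shows "(\<integral>\<^sup>+b. \<integral>\<^sup>+a. h a b \<partial>Exp1 \<partial>Exp1)
       = (\<integral>\<^sup>+s. ennreal (s * exp (- s)) * (\<integral>\<^sup>+r. h (r * s) ((1 - r) * s) * indicator {0..1} r \<partial>lborel) * indicator {0<..} s \<partial>lborel)"
proof -
  have h [measurable]: "(\<lambda>x. h (u x) (v x)) \<in> borel_measurable M"
    if "u \<in> borel_measurable M" "v \<in> borel_measurable M" for u v :: "'z \<Rightarrow> real" and M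
    using measurable_compose[OF measurable_Pair[OF that] assms] by simp
  have "(\<integral>\<^sup>+b. \<integral>\<^sup>+a. h a b \<partial>Exp1 \<partial>Exp1)
    = (\<integral>\<^sup>+b. ennreal (exp (- b)) * (\<integral>\<^sup>+a. ennreal (exp (- a)) * h a b * indicator {0..} a \<partial>lborel) * indicator {0..} b \<partial>lborel)"
    by (simp add: nn_integral_Exp1)
  also have "\<dots> = (\<integral>\<^sup>+b. \<integral>\<^sup>+a. ennreal (exp (- b)) * ennreal (exp (- a)) * h a b * indicator {0..} a * indicator {0..} b \<partial>lborel \<partial>lborel)"
    by (subst nn_integral_cmult[symmetric] nn_integral_multc[symmetric], measurable)+ (simp add: mult_ac)
  also have "\<dots> = (\<integral>\<^sup>+b. \<integral>\<^sup>+a. ennreal (exp (- (a + b))) * h a b * indicator {0..} a * indicator {0..} b \<partial>lborel \<partial>lborel)"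
    by (simp add: ennreal_mult[symmetric] exp_add[symmetric] add.commute)
  also have "\<dots> = (\<integral>\<^sup>+a. \<integral>\<^sup>+b. ennreal (exp (- (a + b))) * h a b * indicator {0..} a * indicator {0..} b \<partial>lborel \<partial>lborel)"
    by (rule lborel_pair.Fubini') measurable
  also have "\<dots> = (\<integral>\<^sup>+a. \<integral>\<^sup>+s. ennreal (exp (- s)) * h a (s - a) * indicator {0..} a * indicator {0..} (s - a) \<partial>lborel \<partial>lborel)"
  proof (rule nn_integral_cong)
    fix a :: real
    show "(\<integral>\<^sup>+b. ennreal (exp (- (a + b))) * h a b * indicator {0..} a * indicator {0..} b \<partial>lborel)
        = (\<integral>\<^sup>+s. ennreal (exp (- s)) * h a (s - a) * indicator {0..} a * indicator {0..} (s - a) \<partial>lborel)"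
      by (subst (2) nn_integral_real_affine[where c = 1 and t = a])
         (auto intro!: nn_integral_cong split: split_indicator)
  qed
  also have "\<dots> = (\<integral>\<^sup>+s. \<integral>\<^sup>+a. ennreal (exp (- s)) * h a (s - a) * indicator {0..} a * indicator {0..} (s - a) \<partial>lborel \<partial>lborel)"
    by (rule lborel_pair.Fubini') measurable
  also have "\<dots> = (\<integral>\<^sup>+s. ennreal (s * exp (- s)) * (\<integral>\<^sup>+r. h (r * s) ((1 - r) * s) * indicator {0..1} r \<partial>lborel) * indicator {0<..} s \<partial>lborel)"
  proof (rule nn_integral_cong_AE)
    have "AE s in lborel. s \<noteq> (0 :: real)"
      by (rule AE_lborel_singleton)
    then show "AE s in lborel. (\<integral>\<^sup>+a. ennreal (exp (- s)) * h a (s - a) * indicator {0..} a * indicator {0..} (s - a) \<partial>lborel)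
        = ennreal (s * exp (- s)) * (\<integral>\<^sup>+r. h (r * s) ((1 - r) * s) * indicator {0..1} r \<partial>lborel) * indicator {0<..} s"
    proof eventually_elim
      fix s :: real assume "s \<noteq> 0"
      then consider "s < 0" | "s > 0" by linarith
      then show "(\<integral>\<^sup>+a. ennreal (exp (- s)) * h a (s - a) * indicator {0..} a * indicator {0..} (s - a) \<partial>lborel)
        = ennreal (s * exp (- s)) * (\<integral>\<^sup>+r. h (r * s) ((1 - r) * s) * indicator {0..1} r \<partial>lborel) * indicator {0<..} s"
      proof cases
        case 1
        then have "(\<integral>\<^sup>+a. ennreal (exp (- s)) * h a (s - a) * indicator {0..} a * indicator {0..} (s - a) \<partial>lborel) = (\<integral>\<^sup>+a. 0 \<partial>(lborel :: real measure))"
          by (intro nn_integral_cong) (auto split: split_indicator)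
        then show ?thesis using 1 by simp
      next
        case 2
        have "(\<integral>\<^sup>+a. ennreal (exp (- s)) * h a (s - a) * indicator {0..} a * indicator {0..} (s - a) \<partial>lborel)
            = (\<integral>\<^sup>+a. ennreal (exp (- s)) * (h a (s - a) * indicator {0..s} a) \<partial>lborel)"
          by (intro nn_integral_cong) (auto split: split_indicator)
        also have "\<dots> = ennreal (exp (- s)) * (\<integral>\<^sup>+a. h a (s - a) * indicator {0..s} a \<partial>lborel)"
          by (rule nn_integral_cmult) measurable
        also have "(\<integral>\<^sup>+a. h a (s - a) * indicator {0..s} a \<partial>lborel)
            = ennreal s * (\<integral>\<^sup>+r. h (r * s) ((1 - r) * s) * indicator {0..1} r \<partial>lborel)"
          using 2
          by (subst nn_integral_real_affine[where c = s and t = 0])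
             (auto intro!: nn_integral_cong arg_cong2[where f = "(*)"] simp: algebra_simps mult_le_cancel_left1 zero_le_mult_iff split: split_indicator)
        finally show ?thesis
          using 2 by (simp add: ennreal_mult mult_ac)
      qed
    qed
  qed
  finally show ?thesis .
qed

text \<open>
  An exchange keeps the total and replaces the share by a fresh uniform one. The share of two
  independent \<open>Exp(1)\<close> variables is already uniform and independent of their total.
\<close>

lemma exponential_pair_exchange:
  fixes h :: "real \<Rightarrow> real \<Rightarrow> ennreal"
  assumes [measurable]: "case_prod h \<in> borel_measurable (borel \<Otimes>\<^sub>M borel)"
  shows "(\<integral>\<^sup>+b. \<integral>\<^sup>+a. \<integral>\<^sup>+r. h (r * (a + b)) ((1 - r) * (a + b)) \<partial>unif \<partial>Exp1 \<partial>Exp1)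
       = (\<integral>\<^sup>+b. \<integral>\<^sup>+a. h a b \<partial>Exp1 \<partial>Exp1)"
proof -
  have h [measurable]: "(\<lambda>x. h (u x) (v x)) \<in> borel_measurable M"
    if "u \<in> borel_measurable M" "v \<in> borel_measurable M" for u v :: "'z \<Rightarrow> real" and M
    using measurable_compose[OF measurable_Pair[OF that] assms] by simp
  define H where "H s = (\<integral>\<^sup>+r. h (r * s) ((1 - r) * s) * indicator {0..1} r \<partial>lborel)" for s
  have H [measurable]: "H \<in> borel_measurable borel"
    unfolding H_def[abs_def] by measurable
  have "(\<integral>\<^sup>+b. \<integral>\<^sup>+a. \<integral>\<^sup>+r. h (r * (a + b)) ((1 - r) * (a + b)) \<partial>unif \<partial>Exp1 \<partial>Exp1)
      = (\<integral>\<^sup>+b. \<integral>\<^sup>+a. H (a + b) \<partial>Exp1 \<partial>Exp1)"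
    unfolding H_def by (intro nn_integral_cong nn_integral_unif) measurable
  also have "\<dots> = (\<integral>\<^sup>+s. ennreal (s * exp (- s)) * (\<integral>\<^sup>+r. H s * indicator {0..1} r \<partial>(lborel :: real measure)) * indicator {0<..} s \<partial>lborel)"
  proof -
    have "r * s + (1 - r) * s = s" for r s :: real
      by (simp add: algebra_simps)
    moreover have "case_prod (\<lambda>a b. H (a + b)) \<in> borel_measurable (borel \<Otimes>\<^sub>M borel)"
      by measurable
    ultimately show ?thesis
      using exponential_pair_as_sum_and_share[of "\<lambda>a b. H (a + b)"] by (simp only:)
  qed
  also have "\<dots> = (\<integral>\<^sup>+s. ennreal (s * exp (- s)) * H s * indicator {0<..} s \<partial>lborel)"
    by (simp add: nn_integral_cmult)
  also have "\<dots> = (\<integral>\<^sup>+b. \<integral>\<^sup>+a. h a b \<partial>Exp1 \<partial>Exp1)"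
    unfolding H_def by (rule exponential_pair_as_sum_and_share[symmetric]) fact
  finally show ?thesis .
qed

abbreviation exp_vector :: "nat \<Rightarrow> (nat \<Rightarrow> real) measure" where
  "exp_vector N \<equiv> \<Pi>\<^sub>M i\<in>{1..N}. Exp1"

lemma sets_exp_vector: "sets (exp_vector N) = sets (wealth_space N)"
  by (rule sets_PiM_cong) auto

lemma space_exp_vector: "space (exp_vector N) = space (wealth_space N)"
  by (rule sets_eq_imp_space_eq[OF sets_exp_vector])

lemma prob_space_exp_vector: "prob_space (exp_vector N)"
  by (rule prob_space_PiM) (rule prob_space_Exp1)

text \<open>
  Conditionally on the coordinates of all other agents, an exchange between \<open>i\<close> and \<open>j\<close> is an exchange
  between two independent \<open>Exp(1)\<close> variables. Tonelli's theorem for nonnegative functions allows the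
  integration over the two coordinates to come first.
\<close>

lemma exp_vector_exchange_nn_integral:
  fixes f :: "(nat \<Rightarrow> real) \<Rightarrow> ennreal"
  assumes p: "(i, j) \<in> agent_pairs N" and f: "f \<in> borel_measurable (wealth_space N)"
  shows "(\<integral>\<^sup>+x. \<integral>\<^sup>+r. f (exchange i j r x) \<partial>unif \<partial>exp_vector N) = (\<integral>\<^sup>+x. f x \<partial>exp_vector N)"
proof -
  interpret product_sigma_finite "\<lambda>_ :: nat. Exp1"
    by (intro product_sigma_finite.intro prob_space_imp_sigma_finite prob_space_Exp1)
  interpret U: prob_space unif by (rule prob_space_unif)
  define J where "J = {1..N} - {i} - {j}"
  have ij: "i \<noteq> j" "i \<in> {1..N}" "j \<in> {1..N}" using p by (auto simp: agent_pairs_def)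
  have J: "{1..N} = insert i (insert j J)" "finite J" "i \<notin> insert j J" "j \<notin> J" "finite (insert j J)"
    using ij by (auto simp: J_def)
  have split: "(\<integral>\<^sup>+x. g x \<partial>exp_vector N)
      = (\<integral>\<^sup>+w. \<integral>\<^sup>+b. \<integral>\<^sup>+a. g (w(j := b, i := a)) \<partial>Exp1 \<partial>Exp1 \<partial>(\<Pi>\<^sub>M k\<in>J. Exp1))"
    if g: "g \<in> borel_measurable (wealth_space N)" for g :: "(nat \<Rightarrow> real) \<Rightarrow> ennreal"
  proof -
    have g': "g \<in> borel_measurable (\<Pi>\<^sub>M k\<in>insert i (insert j J). Exp1)"
      using g unfolding J(1)[symmetric] by (simp add: sets_exp_vector cong: measurable_cong_sets)
    have "(\<integral>\<^sup>+x. g x \<partial>exp_vector N)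
        = (\<integral>\<^sup>+z. \<integral>\<^sup>+a. g (z(i := a)) \<partial>Exp1 \<partial>(\<Pi>\<^sub>M k\<in>insert j J. Exp1))"
      unfolding J(1) by (rule product_nn_integral_insert[OF J(5,3) g'])
    also have "\<dots> = (\<integral>\<^sup>+w. \<integral>\<^sup>+b. \<integral>\<^sup>+a. g (w(j := b, i := a)) \<partial>Exp1 \<partial>Exp1 \<partial>(\<Pi>\<^sub>M k\<in>J. Exp1))"
    proof (rule product_nn_integral_insert[OF J(2,4)])
      have "(\<lambda>(z, a). g (z(i := a))) \<in> borel_measurable ((\<Pi>\<^sub>M k\<in>insert j J. Exp1) \<Otimes>\<^sub>M Exp1)"
        using measurable_compose[OF measurable_add_dim g'] by (simp add: case_prod_beta)
      then show "(\<lambda>z. \<integral>\<^sup>+a. g (z(i := a)) \<partial>Exp1) \<in> borel_measurable (\<Pi>\<^sub>M k\<in>insert j J. Exp1)"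
        by (rule sigma_finite_measure.borel_measurable_nn_integral[OF sigma_finite_measures])
    qed
    finally show ?thesis .
  qed
  have fr: "(\<lambda>(x, r). f (exchange i j r x)) \<in> borel_measurable (wealth_space N \<Otimes>\<^sub>M unif)"
  proof -
    have "(\<lambda>p. f (case p of (x, r) \<Rightarrow> exchange i j r x)) \<in> borel_measurable (wealth_space N \<Otimes>\<^sub>M borel)"
      using ij by (intro measurable_compose[OF measurable_exchange f]) auto
    moreover have "sets (wealth_space N \<Otimes>\<^sub>M unif) = sets (wealth_space N \<Otimes>\<^sub>M borel)"
      by (intro sets_pair_measure_cong) auto
    ultimately show ?thesis
      by (simp add: case_prod_beta cong: measurable_cong_sets)
  qed
  have "(\<integral>\<^sup>+x. \<integral>\<^sup>+r. f (exchange i j r x) \<partial>unif \<partial>exp_vector N)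
      = (\<integral>\<^sup>+w. \<integral>\<^sup>+b. \<integral>\<^sup>+a. \<integral>\<^sup>+r. f (exchange i j r (w(j := b, i := a))) \<partial>unif \<partial>Exp1 \<partial>Exp1 \<partial>(\<Pi>\<^sub>M k\<in>J. Exp1))"
    by (rule split) (rule U.borel_measurable_nn_integral[OF fr])
  also have "\<dots> = (\<integral>\<^sup>+w. \<integral>\<^sup>+b. \<integral>\<^sup>+a. \<integral>\<^sup>+r. f (w(j := (1 - r) * (a + b), i := r * (a + b))) \<partial>unif \<partial>Exp1 \<partial>Exp1 \<partial>(\<Pi>\<^sub>M k\<in>J. Exp1))"
  proof -
    have "exchange i j r (w(j := b, i := a)) = w(j := (1 - r) * (a + b), i := r * (a + b))" for r w a b
      using ij(1) by (auto simp: exchange_def fun_eq_iff)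
    then show ?thesis by simp
  qed
  also have "\<dots> = (\<integral>\<^sup>+w. \<integral>\<^sup>+b. \<integral>\<^sup>+a. f (w(j := b, i := a)) \<partial>Exp1 \<partial>Exp1 \<partial>(\<Pi>\<^sub>M k\<in>J. Exp1))"
  proof (rule nn_integral_cong)
    fix w assume w: "w \<in> space (\<Pi>\<^sub>M k\<in>J. Exp1)"
    have "(\<lambda>p. w(j := snd p, i := fst p)) \<in> borel \<Otimes>\<^sub>M borel \<rightarrow>\<^sub>M wealth_space N"
    proof (rule measurable_PiM_single')
      fix k assume "k \<in> {1..N}"
      show "(\<lambda>p. (w(j := snd p, i := fst p)) k) \<in> borel_measurable (borel \<Otimes>\<^sub>M borel)"
        unfolding fun_upd_apply by measurable
    next
      show "(\<lambda>p k. (w(j := snd p, i := fst p)) k) \<in> space (borel \<Otimes>\<^sub>M borel) \<rightarrow> (\<Pi>\<^sub>E i\<in>{1..N}. space borel)"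
        using w unfolding J(1) by (auto simp: space_PiM PiE_def extensional_def)
    qed
    from measurable_compose[OF this f]
    have "case_prod (\<lambda>a b. f (w(j := b, i := a))) \<in> borel_measurable (borel \<Otimes>\<^sub>M borel)"
      by (simp add: case_prod_beta)
    then show "(\<integral>\<^sup>+b. \<integral>\<^sup>+a. \<integral>\<^sup>+r. f (w(j := (1 - r) * (a + b), i := r * (a + b))) \<partial>unif \<partial>Exp1 \<partial>Exp1)
        = (\<integral>\<^sup>+b. \<integral>\<^sup>+a. f (w(j := b, i := a)) \<partial>Exp1 \<partial>Exp1)"
      by (rule exponential_pair_exchange)
  qed
  also have "\<dots> = (\<integral>\<^sup>+x. f x \<partial>exp_vector N)"
    by (rule split[OF f, symmetric])
  finally show ?thesis .
qed

lemma exp_vector_exchange_integral: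
  fixes f :: "(nat \<Rightarrow> real) \<Rightarrow> real"
  assumes p: "(i, j) \<in> agent_pairs N"
    and f: "f \<in> borel_measurable (wealth_space N)" "\<And>x. x \<in> space (wealth_space N) \<Longrightarrow> \<bar>f x\<bar> \<le> C"
  shows "(\<integral>x. \<integral>r. f (exchange i j r x) \<partial>unif \<partial>exp_vector N) = (\<integral>x. f x \<partial>exp_vector N)"
    and "integrable (exp_vector N) (\<lambda>x. \<integral>r. f (exchange i j r x) \<partial>unif)"
proof -
  interpret E: prob_space "exp_vector N" by (rule prob_space_exp_vector)
  interpret U: prob_space unif by (rule prob_space_unif)
  interpret EU: pair_prob_space "exp_vector N" unif ..
  let ?T = "\<lambda>(x, r). exchange i j r x"
  have "sets (exp_vector N \<Otimes>\<^sub>M unif) = sets (wealth_space N \<Otimes>\<^sub>M borel)"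
    by (intro sets_pair_measure_cong sets_exp_vector) auto
  then have T: "?T \<in> exp_vector N \<Otimes>\<^sub>M unif \<rightarrow>\<^sub>M wealth_space N"
    using measurable_exchange[of i N j] p by (auto simp: agent_pairs_def cong: measurable_cong_sets)
  have "distr (exp_vector N \<Otimes>\<^sub>M unif) (wealth_space N) ?T = exp_vector N"
  proof (rule measure_eqI)
    show "sets (distr (exp_vector N \<Otimes>\<^sub>M unif) (wealth_space N) ?T) = sets (exp_vector N)"
      by (simp only: sets_distr sets_exp_vector)
    fix A assume "A \<in> sets (distr (exp_vector N \<Otimes>\<^sub>M unif) (wealth_space N) ?T)"
    then have A: "A \<in> sets (wealth_space N)" by simp
    have ind: "indicator A \<in> borel_measurable (wealth_space N)"
      using A by (rule borel_measurable_indicator)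
    have m: "(\<lambda>p. indicator A (?T p) :: ennreal) \<in> borel_measurable (exp_vector N \<Otimes>\<^sub>M unif)"
      by (rule measurable_compose[OF T borel_measurable_indicator[OF A]])
    have "emeasure (distr (exp_vector N \<Otimes>\<^sub>M unif) (wealth_space N) ?T) A
        = (\<integral>\<^sup>+p. indicator A (?T p) \<partial>(exp_vector N \<Otimes>\<^sub>M unif))"
      using A nn_integral_distr[OF T, of "indicator A"] nn_integral_indicator[of A "distr (exp_vector N \<Otimes>\<^sub>M unif) (wealth_space N) ?T"]
      by simp
    also have "\<dots> = (\<integral>\<^sup>+x. \<integral>\<^sup>+r. indicator A (exchange i j r x) \<partial>unif \<partial>exp_vector N)"
      using U.nn_integral_fst[OF m] by simp
    also have "\<dots> = (\<integral>\<^sup>+x. indicator A x \<partial>exp_vector N)"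
      by (rule exp_vector_exchange_nn_integral[OF p ind])
    also have "\<dots> = emeasure (exp_vector N) A"
      using A by (simp add: sets_exp_vector)
    finally show "emeasure (distr (exp_vector N \<Otimes>\<^sub>M unif) (wealth_space N) ?T) A = emeasure (exp_vector N) A" .
  qed
  then have eq: "(\<integral>x. f x \<partial>exp_vector N) = (\<integral>p. f (?T p) \<partial>(exp_vector N \<Otimes>\<^sub>M unif))"
    using integral_distr[OF T f(1)] by simp
  have "integrable (exp_vector N \<Otimes>\<^sub>M unif) (\<lambda>p. f (?T p))"
  proof (rule EU.integrable_const_bound[where B = C])
    show "(\<lambda>p. f (?T p)) \<in> borel_measurable (exp_vector N \<Otimes>\<^sub>M unif)"
      by (rule measurable_compose[OF T f(1)])
    show "AE p in exp_vector N \<Otimes>\<^sub>M unif. norm (f (?T p)) \<le> C"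
      using measurable_space[OF T] by (intro AE_I2) (simp add: f(2))
  qed
  then have int: "integrable (exp_vector N \<Otimes>\<^sub>M unif) (\<lambda>(x, r). f (exchange i j r x))"
    by (simp add: case_prod_unfold)
  show "(\<integral>x. \<integral>r. f (exchange i j r x) \<partial>unif \<partial>exp_vector N) = (\<integral>x. f x \<partial>exp_vector N)"
    unfolding eq using EU.integral_fst'[OF int] by (simp add: case_prod_unfold)
  show "integrable (exp_vector N) (\<lambda>x. \<integral>r. f (exchange i j r x) \<partial>unif)"
    using EU.integrable_fst'[OF int] by (simp add: case_prod_unfold)
qed

lemma exp_vector_mean_exchange:
  assumes N: "N \<ge> 2"
    and f: "f \<in> borel_measurable (wealth_space N)" "\<And>x. x \<in> space (wealth_space N) \<Longrightarrow> \<bar>f x\<bar> \<le> C"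
  shows "(\<integral>x. mean_exchange N f x \<partial>exp_vector N) = (\<integral>x. f x \<partial>exp_vector N)"
proof -
  have "(\<integral>x. mean_exchange N f x \<partial>exp_vector N)
      = (\<Sum>p\<in>agent_pairs N. \<integral>x. \<integral>r. f (exchange (fst p) (snd p) r x) \<partial>unif \<partial>exp_vector N) / real (card (agent_pairs N))"
    unfolding mean_exchange_def case_prod_beta using exp_vector_exchange_integral(2)[OF _ f]
    by (simp add: Bochner_Integration.integral_sum)
  also have "\<dots> = (\<Sum>p\<in>agent_pairs N. \<integral>x. f x \<partial>exp_vector N) / real (card (agent_pairs N))"
    using exp_vector_exchange_integral(1)[OF _ f] by simp
  also have "\<dots> = (\<integral>x. f x \<partial>exp_vector N)"
    using N by (simp add: card_agent_pairs)
  finally show ?thesis .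
qed

section \<open>Coupling geometric and exponential variables\<close>

lemma AE_Exp1_pos: "AE x in Exp1. 0 < x"
proof -
  have "AE x in lborel. x \<noteq> (0 :: real)"
    by (rule AE_lborel_singleton)
  then have "AE x in lborel. 0 < ennreal (exponential_density 1 x) \<longrightarrow> 0 < x"
    by eventually_elim (auto simp: exponential_density_def split: if_splits)
  then show ?thesis
    unfolding Exp1_def by (subst AE_density) auto
qed

lemma distributed_Exp1: "distributed Exp1 lborel (\<lambda>x. x) (exponential_density 1)"
  unfolding distributed_def
  by (auto simp: Exp1_def distr_id2 intro!: distr_id2)

lemma measure_Exp1_atLeast:
  assumes "0 \<le> a"
  shows "measure Exp1 {a..} = exp (- a)"
proof -
  interpret prob_space Exp1 by (rule prob_space_Exp1)
  have "AE x in lborel. x \<noteq> a"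
    by (rule AE_lborel_singleton)
  then have "AE x in Exp1. x \<noteq> a"
    unfolding Exp1_def by (subst AE_density) auto
  then have "measure Exp1 {a..} = measure Exp1 {x \<in> space Exp1. a < x}"
    by (intro finite_measure_eq_AE) auto
  also have "\<dots> = exp (- a)"
    using exponential_distributedD_gt[OF distributed_Exp1 assms] by simp
  finally show ?thesis .
qed

text \<open>
  The event that the rounded value is at least \<open>k\<close> is \<open>x \<ge> c k\<close>, which has probability
  \<open>exp (- c k) = (1 - p)\<^sup>k\<close>.
\<close>

lemma measure_Exp1_floor_eq:
  assumes p: "0 < p" "p < 1" and c: "c = - ln (1 - p)"
  shows "measure Exp1 {x. nat \<lfloor>x / c\<rfloor> = k} = p * (1 - p) ^ k"
proof -
  interpret prob_space Exp1 by (rule prob_space_Exp1)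
  have c0: "c > 0" using p by (simp add: c)
  have ge: "measure Exp1 {x. k \<le> nat \<lfloor>x / c\<rfloor>} = (1 - p) ^ k" for k :: nat
  proof (cases "k = 0")
    case True
    then show ?thesis using prob_space by simp
  next
    case False
    have "k \<le> nat \<lfloor>x / c\<rfloor> \<longleftrightarrow> c * k \<le> x" for x
    proof -
      have "k \<le> nat \<lfloor>x / c\<rfloor> \<longleftrightarrow> int k \<le> \<lfloor>x / c\<rfloor>"
        using False by linarith
      also have "\<dots> \<longleftrightarrow> c * k \<le> x"
        using c0 by (simp add: le_floor_iff field_simps)
      finally show ?thesis .
    qed
    then have "{x. k \<le> nat \<lfloor>x / c\<rfloor>} = {c * k..}" by auto
    moreover have "exp (- (c * k)) = (1 - p) ^ k"
    proof -
      have "- (c * k) = real k * ln (1 - p)" by (simp add: c)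
      then show ?thesis using p by (simp add: exp_of_nat_mult)
    qed
    ultimately show ?thesis using c0 by (simp add: measure_Exp1_atLeast)
  qed
  have meas: "{x. k \<le> nat \<lfloor>x / c\<rfloor>} \<in> sets Exp1" for k :: nat
  proof -
    have "{x \<in> space borel. k \<le> nat \<lfloor>x / c\<rfloor>} \<in> sets borel" by measurable
    then show ?thesis by simp
  qed
  have "{x. nat \<lfloor>x / c\<rfloor> = k} = {x. k \<le> nat \<lfloor>x / c\<rfloor>} - {x. Suc k \<le> nat \<lfloor>x / c\<rfloor>}"
    by auto
  also have "measure Exp1 \<dots> = (1 - p) ^ k - (1 - p) ^ Suc k"
    by (subst finite_measure_Diff) (auto simp only: meas ge)
  also have "\<dots> = p * (1 - p) ^ k"
    by (simp add: algebra_simps)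
  finally show ?thesis .
qed

text \<open>
  A row of an array of independent variables, indexed by the second coordinate alone.
\<close>

lemma (in prob_space) indep_vars_section:
  assumes "indep_vars (\<lambda>_. M') X {(m, i). i \<in> I m}"
  shows "indep_vars (\<lambda>_. M') (\<lambda>i. X (n, i)) (I n)"
proof -
  define F where "F k = {X k -` A \<inter> space M | A. A \<in> sets M'}" for k
  have rv: "random_variable M' (X k)" if "k \<in> {(m, i). i \<in> I m}" for k
    using assms that unfolding indep_vars_def2 by blast
  have F: "indep_sets F {(m, i). i \<in> I m}"
    using assms unfolding indep_vars_def2 F_def[abs_def] by blast
  have "indep_sets (\<lambda>i. F (n, i)) (I n)"
  proof (rule indep_setsI)
    show "F (n, i) \<subseteq> events" if "i \<in> I n" for i
      using F that unfolding indep_sets_def by auto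
    fix A J assume J: "J \<noteq> {}" "J \<subseteq> I n" "finite J" "\<forall>j\<in>J. A j \<in> F (n, j)"
    have "prob (\<Inter>k\<in>Pair n ` J. A (snd k)) = (\<Prod>k\<in>Pair n ` J. prob (A (snd k)))"
      by (rule indep_setsD[OF F]) (use J in auto)
    then show "prob (\<Inter>j\<in>J. A j) = (\<Prod>j\<in>J. prob (A j))"
      by (simp add: prod.reindex inj_on_def)
  qed
  then show ?thesis
    unfolding indep_vars_def2 F_def using rv by auto
qed

lemma geometric_vector_distr:
  fixes H :: "nat \<Rightarrow> 'a \<Rightarrow> nat"
  assumes P: "prob_space P" and N: "N \<ge> 1"
    and indep: "prob_space.indep_vars P (\<lambda>_. count_space UNIV) H {1..N}"
    and geo: "\<And>i k. i \<in> {1..N} \<Longrightarrow> measure P {\<omega>\<in>space P. H i \<omega> = k} = p * (1 - p) ^ k"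
    and p: "0 < p" "p < 1" and c: "c = - ln (1 - p)"
  shows "distr P (\<Pi>\<^sub>M i\<in>{1..N}. count_space UNIV) (\<lambda>\<omega>. \<lambda>i\<in>{1..N}. H i \<omega>)
       = distr (exp_vector N) (\<Pi>\<^sub>M i\<in>{1..N}. count_space UNIV) (compose {1..N} (\<lambda>x. nat \<lfloor>x / c\<rfloor>))"
proof -
  interpret P: prob_space P by fact
  interpret E: prob_space Exp1 by (rule prob_space_Exp1)
  have H [measurable]: "H i \<in> P \<rightarrow>\<^sub>M count_space UNIV" if "i \<in> {1..N}" for i
    using indep that unfolding P.indep_vars_def2 by blast
  have r [measurable]: "(\<lambda>x :: real. nat \<lfloor>x / c\<rfloor>) \<in> Exp1 \<rightarrow>\<^sub>M count_space UNIV"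
    by measurable
  have marginal: "distr P (count_space UNIV) (H i) = distr Exp1 (count_space UNIV) (\<lambda>x. nat \<lfloor>x / c\<rfloor>)"
    if i: "i \<in> {1..N}" for i
  proof (rule measure_eqI_countable[where A = UNIV])
    fix k
    have "emeasure (distr P (count_space UNIV) (H i)) {k} = ennreal (measure P {\<omega>\<in>space P. H i \<omega> = k})"
      using H[OF i] by (subst emeasure_distr) (auto simp: P.emeasure_eq_measure vimage_def Int_def conj_commute)
    also have "\<dots> = ennreal (measure Exp1 {x. nat \<lfloor>x / c\<rfloor> = k})"
      by (simp add: geo[OF i] measure_Exp1_floor_eq[OF p c])
    also have "\<dots> = emeasure (distr Exp1 (count_space UNIV) (\<lambda>x. nat \<lfloor>x / c\<rfloor>)) {k}"
      by (subst emeasure_distr) (auto simp: E.emeasure_eq_measure vimage_def)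
    finally show "emeasure (distr P (count_space UNIV) (H i)) {k}
        = emeasure (distr Exp1 (count_space UNIV) (\<lambda>x. nat \<lfloor>x / c\<rfloor>)) {k}" .
  qed auto
  have "{1..N} \<noteq> {}" using N by auto
  from P.indep_vars_iff_distr_eq_PiM'[OF this, of H "\<lambda>_. count_space UNIV"] indep H
  have "distr P (\<Pi>\<^sub>M i\<in>{1..N}. count_space UNIV) (\<lambda>\<omega>. \<lambda>i\<in>{1..N}. H i \<omega>)
      = (\<Pi>\<^sub>M i\<in>{1..N}. distr P (count_space UNIV) (H i))"
    by auto
  also have "\<dots> = (\<Pi>\<^sub>M i\<in>{1..N}. distr Exp1 (count_space UNIV) (\<lambda>x. nat \<lfloor>x / c\<rfloor>))"
    by (intro PiM_cong refl marginal)
  also have "\<dots> = distr (exp_vector N) (\<Pi>\<^sub>M i\<in>{1..N}. count_space UNIV) (compose {1..N} (\<lambda>x. nat \<lfloor>x / c\<rfloor>))"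
  proof -
    \<comment> \<open>The image of a product is a product for maps into probability spaces; the point mass at \<open>0\<close> supplies the discrete \<open>\<sigma>\<close>-algebra on such a space.\<close>
    have "distr (exp_vector N) (\<Pi>\<^sub>M i\<in>{1..N}. return (count_space UNIV) 0) (compose {1..N} (\<lambda>x. nat \<lfloor>x / c\<rfloor>))
        = (\<Pi>\<^sub>M i\<in>{1..N}. distr Exp1 (return (count_space UNIV) 0) (\<lambda>x. nat \<lfloor>x / c\<rfloor>))"
      by (rule distr_PiM_finite_prob_space') (auto intro: prob_space_Exp1 prob_space_return)
    moreover have "sets (\<Pi>\<^sub>M i\<in>{1..N}. return (count_space UNIV) 0) = sets (\<Pi>\<^sub>M i\<in>{1..N}. count_space (UNIV :: nat set))"
      by (intro sets_PiM_cong) auto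
    moreover have "distr Exp1 (return (count_space UNIV) 0) (\<lambda>x. nat \<lfloor>x / c\<rfloor>) = distr Exp1 (count_space UNIV) (\<lambda>x. nat \<lfloor>x / c\<rfloor>)"
      by (rule distr_cong) auto
    ultimately show ?thesis
      using distr_cong[of "exp_vector N" "exp_vector N" "\<Pi>\<^sub>M i\<in>{1..N}. return (count_space UNIV) 0"]
      by metis
  qed
  finally show ?thesis .
qed

text \<open>
  The wealth vector built from the geometric variables that arise by rounding the exponential
  variables \<open>e\<close> down to multiples of \<open>c\<close>. It lives on the same space as \<open>e\<close> and so can be compared with \<open>e\<close>
  coordinate by coordinate.
\<close>

definition rounded_wealth :: "nat \<Rightarrow> real \<Rightarrow> (nat \<Rightarrow> real) \<Rightarrow> nat \<Rightarrow> real" where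
  "rounded_wealth N c e = initial_wealth N (compose {1..N} (\<lambda>x. nat \<lfloor>x / c\<rfloor>) e)"

lemma initial_wealth_restrict: "initial_wealth N (\<lambda>i\<in>{1..N}. g i) = initial_wealth N g"
proof -
  have "(\<Sum>j=1..N. (\<lambda>i\<in>{1..N}. g i) j) = (\<Sum>j=1..N. g j)"
    by (intro sum.cong) auto
  then show ?thesis
    unfolding initial_wealth_def by (intro restrict_ext) simp
qed

lemma measurable_initial_wealth:
  "initial_wealth N \<in> (\<Pi>\<^sub>M i\<in>{1..N}. count_space UNIV) \<rightarrow>\<^sub>M wealth_space N"
  unfolding initial_wealth_def by measurable

lemma measurable_rounding:
  "compose {1..N} (\<lambda>x. nat \<lfloor>x / c\<rfloor>) \<in> wealth_space N \<rightarrow>\<^sub>M (\<Pi>\<^sub>M i\<in>{1..N}. count_space UNIV)"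
  unfolding compose_def by measurable

lemma measurable_rounded_wealth: "rounded_wealth N c \<in> exp_vector N \<rightarrow>\<^sub>M wealth_space N"
  unfolding rounded_wealth_def[abs_def]
  using measurable_compose[OF measurable_rounding measurable_initial_wealth]
  by (simp add: measurable_cong_sets[OF sets_exp_vector refl])

lemma initial_wealth_distr:
  fixes H :: "nat \<Rightarrow> 'a \<Rightarrow> nat"
  assumes P: "prob_space P" and N: "N \<ge> 1"
    and indep: "prob_space.indep_vars P (\<lambda>_. count_space UNIV) H {1..N}"
    and geo: "\<And>i k. i \<in> {1..N} \<Longrightarrow> measure P {\<omega>\<in>space P. H i \<omega> = k} = p * (1 - p) ^ k"
    and p: "0 < p" "p < 1" and c: "c = - ln (1 - p)"
  shows "(\<lambda>\<omega>. initial_wealth N (\<lambda>i. H i \<omega>)) \<in> P \<rightarrow>\<^sub>M wealth_space N"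
    and "distr P (wealth_space N) (\<lambda>\<omega>. initial_wealth N (\<lambda>i. H i \<omega>))
       = distr (exp_vector N) (wealth_space N) (rounded_wealth N c)"
proof -
  interpret P: prob_space P by fact
  let ?S = "\<Pi>\<^sub>M i\<in>{1..N}. count_space (UNIV :: nat set)"
  have H: "H i \<in> P \<rightarrow>\<^sub>M count_space UNIV" if "i \<in> {1..N}" for i
    using indep that unfolding P.indep_vars_def2 by blast
  have HS: "(\<lambda>\<omega>. \<lambda>i\<in>{1..N}. H i \<omega>) \<in> P \<rightarrow>\<^sub>M ?S"
    by (rule measurable_restrict) (rule H)
  show "(\<lambda>\<omega>. initial_wealth N (\<lambda>i. H i \<omega>)) \<in> P \<rightarrow>\<^sub>M wealth_space N"
    using measurable_compose[OF HS measurable_initial_wealth] by (simp only: initial_wealth_restrict)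
  have "distr P (wealth_space N) (\<lambda>\<omega>. initial_wealth N (\<lambda>i. H i \<omega>))
      = distr (distr P ?S (\<lambda>\<omega>. \<lambda>i\<in>{1..N}. H i \<omega>)) (wealth_space N) (initial_wealth N)"
    by (subst distr_distr[OF measurable_initial_wealth HS]) (simp only: comp_def initial_wealth_restrict)
  also have "\<dots> = distr (distr (exp_vector N) ?S (compose {1..N} (\<lambda>x. nat \<lfloor>x / c\<rfloor>))) (wealth_space N) (initial_wealth N)"
    by (simp only: geometric_vector_distr[OF P N indep geo p c])
  also have "\<dots> = distr (exp_vector N) (wealth_space N) (rounded_wealth N c)"
    using measurable_rounding[of N c]
    by (subst distr_distr[OF measurable_initial_wealth])
       (simp_all only: measurable_cong_sets[OF sets_exp_vector refl] comp_def rounded_wealth_def[abs_def])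
  finally show "distr P (wealth_space N) (\<lambda>\<omega>. initial_wealth N (\<lambda>i. H i \<omega>))
       = distr (exp_vector N) (wealth_space N) (rounded_wealth N c)" .
qed

text \<open>
  Rounding moves every coordinate by at most \<open>c\<close>. Rescaling the rounded vector, whose total is \<open>c S\<close>,
  to the total \<open>N\<close> moves it by \<open>\<bar>N - c S\<bar>\<close> in the \<open>l\<^sup>1\<close>-norm, and \<open>c S\<close> differs from the total of \<open>e\<close> by
  at most \<open>c N\<close>. If all rounded variables vanish, then the total of \<open>e\<close> is at most \<open>c N\<close>, and the
  bound holds for the vector of ones as well.
\<close>

lemma rounded_wealth_close:
  assumes c: "c > 0" and e: "\<And>i. i \<in> {1..N} \<Longrightarrow> e i \<ge> 0"
  shows "(\<Sum>i=1..N. \<bar>rounded_wealth N c e i - e i\<bar>) \<le> \<bar>real N - (\<Sum>i=1..N. e i)\<bar> + 2 * c * real N"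
proof -
  define g where "g i = nat \<lfloor>e i / c\<rfloor>" for i
  define S where "S = (\<Sum>i=1..N. g i)"
  have g: "c * g i \<le> e i" "e i \<le> c * g i + c" if "i \<in> {1..N}" for i
  proof -
    have "real (g i) = of_int \<lfloor>e i / c\<rfloor>"
      using e[OF that] c by (simp add: g_def)
    then have "g i \<le> e i / c" "e i / c \<le> g i + 1" by linarith+
    then show "c * g i \<le> e i" "e i \<le> c * g i + c"
      using c by (simp_all add: field_simps)
  qed
  have sum_close: "\<bar>(\<Sum>i=1..N. e i) - c * S\<bar> \<le> c * N"
  proof -
    have "\<bar>(\<Sum>i=1..N. e i) - c * S\<bar> = \<bar>\<Sum>i=1..N. e i - c * g i\<bar>"
      by (simp add: S_def sum_subtractf sum_distrib_left)
    also have "\<dots> \<le> (\<Sum>i=1..N. c)"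
      by (rule order_trans[OF sum_abs], rule sum_mono) (use g in \<open>auto simp: abs_le_iff\<close>, smt (verit))
    finally show ?thesis by (simp add: mult.commute)
  qed
  have rw: "rounded_wealth N c e i = (if S = 0 then 1 else N * (g i / S))" if "i \<in> {1..N}" for i
  proof -
    have "(\<Sum>j=1..N. compose {1..N} (\<lambda>x. nat \<lfloor>x / c\<rfloor>) e j) = S"
      unfolding S_def by (intro sum.cong) (auto simp: compose_def g_def)
    then show ?thesis
      using that by (simp add: rounded_wealth_def initial_wealth_def compose_def g_def)
  qed
  show ?thesis
  proof (cases "S = 0")
    case True
    have "(\<Sum>i=1..N. \<bar>rounded_wealth N c e i - e i\<bar>) \<le> (\<Sum>i=1..N. 1 + e i)"
      by (intro sum_mono) (use e True in \<open>auto simp: rw abs_le_iff\<close>)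
    also have "\<dots> = N + (\<Sum>i=1..N. e i)"
      by (simp add: sum.distrib)
    finally show ?thesis
      using sum_close True by simp
  next
    case False
    have "(\<Sum>i=1..N. \<bar>rounded_wealth N c e i - e i\<bar>) \<le> (\<Sum>i=1..N. \<bar>N / S - c\<bar> * g i + c)"
    proof (rule sum_mono)
      fix i assume i: "i \<in> {1..N}"
      have "rounded_wealth N c e i - e i = (N / S - c) * g i + (c * g i - e i)"
        using False by (simp add: rw[OF i] algebra_simps)
      also have "\<bar>\<dots>\<bar> \<le> \<bar>(N / S - c) * g i\<bar> + \<bar>c * g i - e i\<bar>"
        by (rule abs_triangle_ineq)
      also have "\<dots> \<le> \<bar>N / S - c\<bar> * g i + c"
        using g[OF i] by (simp add: abs_mult)
      finally show "\<bar>rounded_wealth N c e i - e i\<bar> \<le> \<bar>N / S - c\<bar> * g i + c" .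
    qed
    also have "\<dots> = \<bar>N / S - c\<bar> * S + c * N"
    proof -
      have "(\<Sum>i=1..N. A * g i + c) = A * S + c * N" for A :: real
        by (simp add: S_def sum.distrib sum_distrib_left)
      then show ?thesis .
    qed
    also have "\<bar>N / S - c\<bar> * S = \<bar>(N / S - c) * S\<bar>"
      by (simp add: abs_mult)
    also have "(N / S - c) * S = N - c * S"
      using False by (simp add: field_simps)
    finally show ?thesis
      using sum_close by linarith
  qed
qed

section \<open>Exponential concentration of sample means\<close>

text \<open>
  A second-order Taylor bound whose remainder is quadratic in \<open>l\<close> and otherwise independent of it;
  integrated, it bounds a moment generating function near \<open>0\<close> by the mean and one exponential moment.
\<close>

lemma exp_scaled_le:
  fixes l s :: real
  assumes "0 \<le> l" "l \<le> 1"
  shows "exp (l * s) \<le> 1 + l * s + l\<^sup>2 * exp (2 * \<bar>s\<bar>)"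
proof -
  obtain t where t: "\<bar>t\<bar> \<le> \<bar>l * s\<bar>" and eq: "exp (l * s) = (\<Sum>m<2. (l * s) ^ m / fact m) + exp t / fact 2 * (l * s) ^ 2"
    using Maclaurin_exp_le[of "l * s" 2] by blast
  have "\<bar>l * s\<bar> \<le> \<bar>s\<bar>"
    using assms mult_right_mono[of l 1 "\<bar>s\<bar>"] by (simp add: abs_mult)
  then have "exp t \<le> exp \<bar>s\<bar>" using t by simp
  moreover have "s\<^sup>2 / 2 \<le> exp \<bar>s\<bar>"
    using exp_lower_Taylor_quadratic[of "\<bar>s\<bar>"] by simp
  ultimately have "exp t * (s\<^sup>2 / 2) \<le> exp \<bar>s\<bar> * exp \<bar>s\<bar>"
    by (intro mult_mono) auto
  also have "\<dots> = exp (2 * \<bar>s\<bar>)"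
    by (simp flip: exp_add)
  finally have "l\<^sup>2 * (exp t * (s\<^sup>2 / 2)) \<le> l\<^sup>2 * exp (2 * \<bar>s\<bar>)"
    by (intro mult_left_mono) auto
  then show ?thesis
    unfolding eq by (simp add: numeral_2_eq_2 power_mult_distrib field_simps)
qed

text \<open>
  The moment generating function of \<open>Y - E Y - \<epsilon>\<close> has the value \<open>1\<close> and the slope \<open>- \<epsilon>\<close> at \<open>0\<close>, so it is
  below \<open>1\<close> somewhere to the right of \<open>0\<close>.
\<close>

lemma (in prob_space) exponential_moment_lt_1:
  fixes Y :: "'a \<Rightarrow> real"
  assumes Y [measurable]: "Y \<in> borel_measurable M" and b: "b > 0"
    and int: "integrable M (\<lambda>x. exp (b * \<bar>Y x\<bar>))" and \<epsilon>: "\<epsilon> > 0"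
  shows "integrable M Y"
    and "\<exists>\<theta>>0. \<exists>q<1. 0 \<le> q \<and> (\<integral>\<^sup>+x. ennreal (exp (\<theta> * (Y x - expectation Y - \<epsilon>))) \<partial>M) \<le> ennreal q"
proof -
  define m where "m = expectation Y"
  have "b * \<bar>Y x\<bar> \<le> exp (b * \<bar>Y x\<bar>)" for x
    using exp_ge_add_one_self[of "b * \<bar>Y x\<bar>"] by linarith
  then have "\<bar>Y x\<bar> \<le> exp (b * \<bar>Y x\<bar>) / b" for x
    using b by (simp add: field_simps)
  moreover have "integrable M (\<lambda>x. exp (b * \<bar>Y x\<bar>) / b)"
    using int by simp
  ultimately show intY: "integrable M Y"
    by (rule_tac Bochner_Integration.integrable_bound) (use b in auto)
  define Z where "Z x = Y x - m" for x
  have Z [measurable]: "Z \<in> borel_measurable M" unfolding Z_def by measurable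
  have intZ: "integrable M Z" "expectation Z = 0"
    unfolding Z_def using intY by (auto simp: m_def prob_space)
  have intE: "integrable M (\<lambda>x. exp (b * \<bar>Z x\<bar>))"
  proof (rule Bochner_Integration.integrable_bound[where f = "\<lambda>x. exp (b * \<bar>m\<bar>) * exp (b * \<bar>Y x\<bar>)"])
    have "b * \<bar>Z x\<bar> \<le> b * \<bar>m\<bar> + b * \<bar>Y x\<bar>" for x
      using b mult_left_mono[of "\<bar>Z x\<bar>" "\<bar>m\<bar> + \<bar>Y x\<bar>" b] by (simp add: Z_def algebra_simps)
    then show "AE x in M. norm (exp (b * \<bar>Z x\<bar>)) \<le> norm (exp (b * \<bar>m\<bar>) * exp (b * \<bar>Y x\<bar>))"
      by (simp flip: exp_add)
  qed (use int in auto)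
  define K where "K = expectation (\<lambda>x. exp (b * \<bar>Z x\<bar>))"
  have K: "K \<ge> 1"
    unfolding K_def by (rule integral_ge_const[OF intE]) (use b in auto)
  \<comment> \<open>\<open>l\<close> is so small that the quadratic error \<open>l\<^sup>2 K\<close> is at most half of the linear gain \<open>\<theta> \<epsilon> = l b \<epsilon> / 2\<close>.\<close>
  define l where "l = min 1 (b * \<epsilon> / (4 * K))"
  have l: "0 < l" "l \<le> 1" "l * K \<le> b * \<epsilon> / 4"
    using K b \<epsilon> by (auto simp: l_def min_def field_simps)
  define \<theta> where "\<theta> = l * (b / 2)"
  have bound: "exp (\<theta> * (Y x - m - \<epsilon>)) \<le> exp (- (\<theta> * \<epsilon>)) * (1 + \<theta> * Z x + l\<^sup>2 * exp (b * \<bar>Z x\<bar>))" for x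
  proof -
    have "exp (\<theta> * (Y x - m - \<epsilon>)) = exp (- (\<theta> * \<epsilon>)) * exp (l * (b / 2 * Z x))"
    proof -
      have "\<theta> * (Y x - m - \<epsilon>) = - (\<theta> * \<epsilon>) + l * (b / 2 * Z x)"
        by (simp add: Z_def \<theta>_def field_simps)
      then show ?thesis by (simp only: exp_add)
    qed
    also have "\<dots> \<le> exp (- (\<theta> * \<epsilon>)) * (1 + l * (b / 2 * Z x) + l\<^sup>2 * exp (2 * \<bar>b / 2 * Z x\<bar>))"
      using l by (intro mult_left_mono exp_scaled_le) auto
    also have "2 * \<bar>b / 2 * Z x\<bar> = b * \<bar>Z x\<bar>"
      using b by (simp add: abs_mult)
    finally show ?thesis by (simp add: \<theta>_def mult.assoc)
  qed
  have int3: "integrable M (\<lambda>x. exp (- (\<theta> * \<epsilon>)) * (1 + \<theta> * Z x + l\<^sup>2 * exp (b * \<bar>Z x\<bar>)))"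
    using intZ(1) intE by auto
  define q where "q = exp (- (\<theta> * \<epsilon>)) * (1 + l\<^sup>2 * K)"
  have "expectation (\<lambda>x. exp (- (\<theta> * \<epsilon>)) * (1 + \<theta> * Z x + l\<^sup>2 * exp (b * \<bar>Z x\<bar>))) = q"
    using intZ intE by (simp add: q_def K_def prob_space)
  then have "(\<integral>\<^sup>+x. ennreal (exp (- (\<theta> * \<epsilon>)) * (1 + \<theta> * Z x + l\<^sup>2 * exp (b * \<bar>Z x\<bar>))) \<partial>M) = ennreal q"
    using bound by (subst nn_integral_eq_integral[OF int3]) (auto intro!: AE_I2 order_trans[OF exp_ge_zero])
  moreover have "(\<integral>\<^sup>+x. ennreal (exp (\<theta> * (Y x - m - \<epsilon>))) \<partial>M)
      \<le> (\<integral>\<^sup>+x. ennreal (exp (- (\<theta> * \<epsilon>)) * (1 + \<theta> * Z x + l\<^sup>2 * exp (b * \<bar>Z x\<bar>))) \<partial>M)"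
    by (intro nn_integral_mono ennreal_leI bound)
  ultimately have "(\<integral>\<^sup>+x. ennreal (exp (\<theta> * (Y x - m - \<epsilon>))) \<partial>M) \<le> ennreal q" by simp
  moreover have "q < 1"
  proof -
    have "l\<^sup>2 * K \<le> l * (b * \<epsilon> / 4)"
      using mult_left_mono[OF l(3), of l] l(1) by (simp add: power2_eq_square mult.assoc)
    also have "\<dots> < \<theta> * \<epsilon>"
      using l(1) b \<epsilon> by (simp add: \<theta>_def)
    finally have "1 + l\<^sup>2 * K < exp (\<theta> * \<epsilon>)"
      using exp_ge_add_one_self[of "\<theta> * \<epsilon>"] by linarith
    then have "exp (- (\<theta> * \<epsilon>)) * (1 + l\<^sup>2 * K) < exp (- (\<theta> * \<epsilon>)) * exp (\<theta> * \<epsilon>)"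
      by (intro mult_strict_left_mono) auto
    then show ?thesis by (simp add: q_def flip: exp_add)
  qed
  moreover have "0 \<le> q" using K by (simp add: q_def)
  moreover have "\<theta> > 0" using l b by (simp add: \<theta>_def)
  ultimately show "\<exists>\<theta>>0. \<exists>q<1. 0 \<le> q \<and> (\<integral>\<^sup>+x. ennreal (exp (\<theta> * (Y x - expectation Y - \<epsilon>))) \<partial>M) \<le> ennreal q"
    unfolding m_def by blast
qed

text \<open>
  Chernoff's bound: the exponential of the sum is at least \<open>1\<close> on the event, and its mean is the \<open>N\<close>-th
  power of the mean of one factor.
\<close>

lemma chernoff_product:
  fixes h :: "'a \<Rightarrow> real"
  assumes M: "prob_space M" and h [measurable]: "h \<in> borel_measurable M"
    and q: "0 \<le> q" "(\<integral>\<^sup>+x. ennreal (exp (h x)) \<partial>M) \<le> ennreal q"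
  shows "measure (\<Pi>\<^sub>M i\<in>{1..N :: nat}. M) {x \<in> space (\<Pi>\<^sub>M i\<in>{1..N}. M). 0 \<le> (\<Sum>i=1..N. h (x i))} \<le> q ^ N"
proof -
  interpret prob_space M by fact
  interpret product_sigma_finite "\<lambda>_ :: nat. M"
    by (intro product_sigma_finite.intro prob_space_imp_sigma_finite M)
  let ?P = "\<Pi>\<^sub>M i\<in>{1..N}. M"
  interpret P: prob_space ?P by (rule prob_space_PiM) (rule M)
  have comp: "(\<lambda>x. h (x i)) \<in> borel_measurable ?P" if "i \<in> {1..N}" for i
    using that by measurable
  have [measurable]: "(\<lambda>x. \<Sum>i=1..N. h (x i)) \<in> borel_measurable ?P"
    by (rule borel_measurable_sum) (rule comp)
  let ?u = "\<lambda>x. ennreal (exp (\<Sum>i=1..N. h (x i)))"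
  have "{x \<in> space ?P. 0 \<le> (\<Sum>i=1..N. h (x i))} = {x \<in> space ?P. 1 \<le> 1 * ?u x}"
    by auto
  then have "emeasure ?P {x \<in> space ?P. 0 \<le> (\<Sum>i=1..N. h (x i))} \<le> 1 * (\<integral>\<^sup>+x. ?u x * indicator (space ?P) x \<partial>?P)"
    using nn_integral_Markov_inequality[of ?u "space ?P" ?P 1] by simp
  also have "\<dots> = (\<integral>\<^sup>+x. (\<Prod>i=1..N. ennreal (exp (h (x i)))) \<partial>?P)"
    by (auto intro!: nn_integral_cong simp: exp_sum prod_ennreal)
  also have "\<dots> = (\<Prod>i=1..N. \<integral>\<^sup>+x. ennreal (exp (h x)) \<partial>M)"
    by (rule product_nn_integral_prod) auto
  also have "\<dots> \<le> (\<Prod>i=1..N. ennreal q)"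
    by (intro prod_mono_ennreal) (use q in auto)
  also have "\<dots> = ennreal (q ^ N)"
    using q by (simp add: ennreal_power)
  finally show ?thesis
    using q unfolding P.emeasure_eq_measure by (simp only: ennreal_le_iff zero_le_power)
qed

text \<open>
  Both tails of the sample mean decay exponentially in \<open>N\<close>. Summability is what the Borel-Cantelli lemma
  asks for, and it implies that the probabilities tend to \<open>0\<close>.
\<close>

lemma sample_mean_deviation_summable:
  fixes Y :: "'a \<Rightarrow> real"
  assumes M: "prob_space M" and Y [measurable]: "Y \<in> borel_measurable M" and b: "b > 0"
    and int: "integrable M (\<lambda>x. exp (b * \<bar>Y x\<bar>))" and \<epsilon>: "\<epsilon> > 0"
  shows "summable (\<lambda>N. measure (\<Pi>\<^sub>M i\<in>{1..N :: nat}. M)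
           {x \<in> space (\<Pi>\<^sub>M i\<in>{1..N}. M). \<bar>(\<Sum>i=1..N. Y (x i)) - real N * (\<integral>x. Y x \<partial>M)\<bar> \<ge> \<epsilon> * real N})"
proof -
  interpret prob_space M by fact
  let ?P = "\<lambda>N :: nat. \<Pi>\<^sub>M i\<in>{1..N}. M"
  define m where "m = expectation Y"
  have one_side: "\<exists>q<1. 0 \<le> q \<and> (\<forall>N. measure (?P N) {x \<in> space (?P N). \<epsilon> * real N \<le> (\<Sum>i=1..N. Y (x i)) - real N * expectation Y} \<le> q ^ N)"
    if Y [measurable]: "Y \<in> borel_measurable M" and int: "integrable M (\<lambda>x. exp (b * \<bar>Y x\<bar>))" for Y
  proof -
    obtain \<theta> q where \<theta>: "\<theta> > 0" and q: "q < 1" "0 \<le> q"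
      "(\<integral>\<^sup>+x. ennreal (exp (\<theta> * (Y x - expectation Y - \<epsilon>))) \<partial>M) \<le> ennreal q"
      using exponential_moment_lt_1(2)[OF Y b int \<epsilon>] by blast
    have "measure (?P N) {x \<in> space (?P N). \<epsilon> * real N \<le> (\<Sum>i=1..N. Y (x i)) - real N * expectation Y} \<le> q ^ N" for N
    proof -
      have "(\<Sum>i=1..N. \<theta> * (Y (x i) - expectation Y - \<epsilon>)) = \<theta> * ((\<Sum>i=1..N. Y (x i)) - real N * expectation Y - \<epsilon> * real N)" for x
        by (simp add: sum_distrib_left[symmetric] sum_subtractf mult.commute)
      then have "{x \<in> space (?P N). \<epsilon> * real N \<le> (\<Sum>i=1..N. Y (x i)) - real N * expectation Y}
          = {x \<in> space (?P N). 0 \<le> (\<Sum>i=1..N. \<theta> * (Y (x i) - expectation Y - \<epsilon>))}"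
        using \<theta> by (auto simp: zero_le_mult_iff)
      then show ?thesis
        using chernoff_product[OF M _ q(2,3), of N] by simp
    qed
    then show ?thesis using q by blast
  qed
  obtain q1 where q1: "q1 < 1" "0 \<le> q1" "\<And>N. measure (?P N) {x \<in> space (?P N). \<epsilon> * real N \<le> (\<Sum>i=1..N. Y (x i)) - real N * m} \<le> q1 ^ N"
    using one_side[OF Y int] unfolding m_def by blast
  have "expectation (\<lambda>x. - Y x) = - m" by (simp add: m_def)
  then obtain q2 where q2: "q2 < 1" "0 \<le> q2" "\<And>N. measure (?P N) {x \<in> space (?P N). \<epsilon> * real N \<le> (\<Sum>i=1..N. - Y (x i)) - real N * (- m)} \<le> q2 ^ N"
    using one_side[of "\<lambda>x. - Y x"] int by auto
  have "measure (?P N) {x \<in> space (?P N). \<bar>(\<Sum>i=1..N. Y (x i)) - real N * m\<bar> \<ge> \<epsilon> * real N} \<le> q1 ^ N + q2 ^ N" for N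
  proof -
    interpret P: prob_space "?P N" by (rule prob_space_PiM) (rule M)
    have comp: "(\<lambda>x. Y (x i)) \<in> borel_measurable (?P N)" if "i \<in> {1..N}" for i
      using that by measurable
    have [measurable]: "(\<lambda>x. \<Sum>i=1..N. Y (x i)) \<in> borel_measurable (?P N)"
      by (rule borel_measurable_sum) (rule comp)
    have "measure (?P N) {x \<in> space (?P N). \<bar>(\<Sum>i=1..N. Y (x i)) - real N * m\<bar> \<ge> \<epsilon> * real N}
      \<le> measure (?P N) ({x \<in> space (?P N). \<epsilon> * real N \<le> (\<Sum>i=1..N. Y (x i)) - real N * m}
          \<union> {x \<in> space (?P N). \<epsilon> * real N \<le> (\<Sum>i=1..N. - Y (x i)) - real N * (- m)})"
      by (rule P.finite_measure_mono) (auto simp: sum_negf abs_if split: if_splits)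
    also have "\<dots> \<le> measure (?P N) {x \<in> space (?P N). \<epsilon> * real N \<le> (\<Sum>i=1..N. Y (x i)) - real N * m}
          + measure (?P N) {x \<in> space (?P N). \<epsilon> * real N \<le> (\<Sum>i=1..N. - Y (x i)) - real N * (- m)}"
      by (rule measure_Un_le) (auto simp: sum_negf)
    also have "\<dots> \<le> q1 ^ N + q2 ^ N"
      by (intro add_mono q1 q2)
    finally show ?thesis .
  qed
  moreover have "summable (\<lambda>N. q1 ^ N + q2 ^ N)"
    using q1 q2 by (intro summable_add summable_geometric) auto
  ultimately show ?thesis
    unfolding m_def[symmetric]
    by (rule_tac summable_comparison_test'[where g = "\<lambda>N. q1 ^ N + q2 ^ N" and N = 0]) simp_all
qed

lemma integrable_exp_half_Exp1: "integrable Exp1 (\<lambda>x. exp (1 / 2 * \<bar>x\<bar>))"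
proof -
  interpret D: prob_space "density lborel (exponential_density (1 / 2))"
    by (rule prob_space_exponential_density) simp
  have half: "2 * ennreal (exp z / 2) = ennreal (exp z)" for z :: real
    using ennreal_mult[of 2 "exp z / 2"] by simp
  \<comment> \<open>Tilting the density \<open>exp (- x)\<close> by \<open>exp (x / 2)\<close> gives twice the density of the exponential law of rate \<open>1 / 2\<close>.\<close>
  have "(\<integral>\<^sup>+x. ennreal (exp (1 / 2 * \<bar>x\<bar>)) \<partial>Exp1) = (\<integral>\<^sup>+x. ennreal 2 * ennreal (exponential_density (1 / 2) x) \<partial>lborel)"
    by (subst nn_integral_Exp1, measurable)
       (auto intro!: nn_integral_cong simp: exponential_density_def half ennreal_mult[symmetric] exp_add[symmetric]
          split: split_indicator)
  also have "\<dots> = 2"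
    using D.emeasure_space_1 by (simp add: nn_integral_cmult emeasure_density)
  finally show ?thesis
    by (intro integrableI_bounded) auto
qed

lemma integral_Exp1_id: "(\<integral>x. x \<partial>Exp1) = 1"
proof -
  interpret prob_space Exp1 by (rule prob_space_Exp1)
  show ?thesis using exponential_distributed_expectation[OF _ distributed_Exp1] by simp
qed

section \<open>Empirical measures of the coupled wealth\<close>

lemma measurable_empirical: "x \<in> uniform_count_measure {1..N} \<rightarrow>\<^sub>M borel"
  by (auto simp: measurable_def space_uniform_count_measure sets_uniform_count_measure)

lemma integral_empirical_measure:
  fixes g :: "real \<Rightarrow> real"
  assumes "g \<in> borel_measurable borel"
  shows "(\<integral>y. g y \<partial>empirical_measure N x) = (\<Sum>i=1..N. g (x i)) / real N"
  unfolding empirical_measure_def using assms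
  by (subst integral_distr[OF measurable_empirical]) (simp_all add: integral_uniform_count_measure)

lemma real_distribution_empirical_measure:
  assumes "N \<ge> 1"
  shows "real_distribution (empirical_measure N x)"
proof -
  have "prob_space (empirical_measure N x)"
    unfolding empirical_measure_def
    using assms by (intro prob_space.prob_space_distr prob_space_uniform_count_measure measurable_empirical) auto
  then show ?thesis
    by (simp add: real_distribution_def real_distribution_axioms_def empirical_measure_def)
qed

lemma real_distribution_Exp1: "real_distribution Exp1"
  by (simp add: real_distribution_def real_distribution_axioms_def prob_space_Exp1)

lemma measurable_cts_step [measurable]: "cts_step a b \<in> borel_measurable borel"
  unfolding cts_step_def[abs_def] by measurable

lemma cts_step_bounds:
  assumes "a < b"
  shows "0 \<le> cts_step a b x" "cts_step a b x \<le> 1"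
  using assms by (auto simp: cts_step_def field_simps)

lemma cts_step_lipschitz:
  assumes "a < b"
  shows "\<bar>cts_step a b x - cts_step a b y\<bar> \<le> 1 / (b - a) * \<bar>x - y\<bar>"
proof -
  have eq: "cts_step a b z = max 0 (min 1 ((b - z) / (b - a)))" for z
    using assms by (auto simp: cts_step_def max_def min_def field_simps)
  have "\<bar>cts_step a b x - cts_step a b y\<bar> \<le> \<bar>(b - x) / (b - a) - (b - y) / (b - a)\<bar>"
    unfolding eq by linarith
  also have "\<dots> = 1 / (b - a) * \<bar>x - y\<bar>"
    using assms by (simp add: diff_divide_distrib[symmetric] abs_divide)
  finally show ?thesis .
qed

text \<open>
  The ramps \<open>cts_step a b\<close> lie between the indicators of \<open>(-\<infinity>, a]\<close> and \<open>(-\<infinity>, b]\<close>, so their integrals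
  pinch the distribution functions. Rational ramps suffice, which leaves countably many almost
  sure statements to combine.
\<close>

lemma weak_conv_m_if_rational_steps:
  assumes M: "\<And>n. n \<ge> 1 \<Longrightarrow> real_distribution (M n)" and L: "real_distribution L"
    and conv: "\<And>a b :: rat. a < b \<Longrightarrow>
      (\<lambda>n. \<integral>x. cts_step (of_rat a) (of_rat b) x \<partial>M n) \<longlonglongrightarrow> (\<integral>x. cts_step (of_rat a) (of_rat b) x \<partial>L)"
  shows "weak_conv_m M L"
  unfolding weak_conv_m_def weak_conv_def
proof (intro allI impI order_tendstoI)
  interpret L: real_distribution L by fact
  fix x l :: real
  assume cont: "isCont (cdf L) x"
  { assume "l < cdf L x"
    with cont have "eventually (\<lambda>z. l < cdf L z) (at x)"
      by (intro order_tendstoD(1)) (auto simp: isCont_def)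
    then have "eventually (\<lambda>z. l < cdf L z) (at_left x)"
      by (rule filter_leD[OF at_le, rotated]) auto
    then obtain y where y: "y < x" "\<And>z. y < z \<Longrightarrow> z < x \<Longrightarrow> l < cdf L z"
      unfolding eventually_at_left_field by auto
    obtain a where a: "y < of_rat a" "of_rat a < x" using of_rat_dense[OF y(1)] by blast
    obtain b where b: "of_rat a < (of_rat b :: real)" "of_rat b < x" using of_rat_dense[OF a(2)] by blast
    have "l < (\<integral>x. cts_step (of_rat a) (of_rat b) x \<partial>L)"
      using y(2)[OF a] L.cdf_cts_step(1)[OF b(1)] by linarith
    moreover have "a < b" using b(1) by (simp add: of_rat_less)
    ultimately have "eventually (\<lambda>n. l < (\<integral>x. cts_step (of_rat a) (of_rat b) x \<partial>M n)) sequentially"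
      using order_tendstoD(1)[OF conv] by blast
    then show "eventually (\<lambda>n. l < cdf (M n) x) sequentially"
      using eventually_ge_at_top[of 1]
    proof eventually_elim
      case (elim n)
      interpret real_distribution "M n" using M elim by simp
      show ?case
        using elim(1) cdf_cts_step(2)[OF b(1)] cdf_nondecreasing[of "of_rat b" x] b(2) by linarith
    qed }
  { assume "cdf L x < l"
    with cont have "eventually (\<lambda>z. cdf L z < l) (at x)"
      by (intro order_tendstoD(2)) (auto simp: isCont_def)
    then have "eventually (\<lambda>z. cdf L z < l) (at_right x)"
      by (rule filter_leD[OF at_le, rotated]) auto
    then obtain y where y: "x < y" "\<And>z. x < z \<Longrightarrow> z < y \<Longrightarrow> cdf L z < l"
      unfolding eventually_at_right_field by auto
    obtain b where b: "x < of_rat b" "of_rat b < y" using of_rat_dense[OF y(1)] by blast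
    obtain a where a: "x < of_rat a" "of_rat a < (of_rat b :: real)" using of_rat_dense[OF b(1)] by blast
    have "(\<integral>x. cts_step (of_rat a) (of_rat b) x \<partial>L) < l"
      using y(2)[OF b] L.cdf_cts_step(2)[OF a(2)] by linarith
    moreover have "a < b" using a(2) by (simp add: of_rat_less)
    ultimately have "eventually (\<lambda>n. (\<integral>x. cts_step (of_rat a) (of_rat b) x \<partial>M n) < l) sequentially"
      using order_tendstoD(2)[OF conv] by blast
    then show "eventually (\<lambda>n. cdf (M n) x < l) sequentially"
      using eventually_ge_at_top[of 1]
    proof eventually_elim
      case (elim n)
      interpret real_distribution "M n" using M elim by simp
      show ?case
        using elim(1) cdf_cts_step(1)[OF a(2)] cdf_nondecreasing[of x "of_rat a"] a(1) by linarith
    qed }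
qed

lemma AE_exp_vector_nonneg: "AE e in exp_vector N. \<forall>i\<in>{1..N}. 0 \<le> e i"
proof (rule AE_finite_allI)
  fix i assume "i \<in> {1..N}"
  moreover have "AE x in Exp1. 0 \<le> x"
    using AE_Exp1_pos by eventually_elim simp
  ultimately show "AE e in exp_vector N. 0 \<le> e i"
    by (rule AE_PiM_component[OF prob_space_Exp1])
qed simp

text \<open>
  The exceptional event of the coupling: off this event rescaling an exponential vector to the total
  \<open>N\<close> changes it by at most \<open>\<delta> N\<close> in the \<open>l\<^sup>1\<close>-norm.
\<close>

definition far_total :: "nat \<Rightarrow> real \<Rightarrow> (nat \<Rightarrow> real) set" where
  "far_total N \<delta> = {e \<in> space (exp_vector N). \<bar>(\<Sum>i=1..N. e i) - real N\<bar> \<ge> \<delta> * real N}"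

lemma measurable_exp_vector_sum:
  fixes g :: "real \<Rightarrow> real"
  assumes [measurable]: "g \<in> borel_measurable borel"
  shows "(\<lambda>e. \<Sum>i=1..N. g (e i)) \<in> borel_measurable (exp_vector N)"
proof (rule borel_measurable_sum)
  fix i assume "i \<in> {1..N}"
  then show "(\<lambda>e. g (e i)) \<in> borel_measurable (exp_vector N)" by measurable
qed

lemma far_total_sets: "far_total N \<delta> \<in> sets (exp_vector N)"
proof -
  have [measurable]: "(\<lambda>e. \<Sum>i=1..N. e i) \<in> borel_measurable (exp_vector N)"
    by (rule measurable_exp_vector_sum) simp
  show ?thesis unfolding far_total_def by measurable
qed

lemma far_total_summable:
  assumes "\<delta> > 0"
  shows "summable (\<lambda>N. measure (exp_vector N) (far_total N \<delta>))"
  unfolding far_total_def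
  using sample_mean_deviation_summable[OF prob_space_Exp1 _ _ integrable_exp_half_Exp1 assms]
  by (simp add: integral_Exp1_id)

lemma rounded_wealth_near:
  assumes c: "c > 0"
  shows "AE e in exp_vector N. e \<notin> far_total N \<delta> \<longrightarrow>
           (\<Sum>i=1..N. \<bar>rounded_wealth N c e i - e i\<bar>) \<le> (\<delta> + 2 * c) * real N"
  using AE_exp_vector_nonneg AE_space
proof eventually_elim
  case (elim e)
  show ?case
  proof
    assume "e \<notin> far_total N \<delta>"
    then have "\<bar>real N - (\<Sum>i=1..N. e i)\<bar> \<le> \<delta> * real N"
      using elim(2) by (auto simp: far_total_def)
    then show "(\<Sum>i=1..N. \<bar>rounded_wealth N c e i - e i\<bar>) \<le> (\<delta> + 2 * c) * real N"
      using rounded_wealth_close[OF c, of N e] elim(1) by (simp add: algebra_simps)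
  qed
qed

text \<open>
  A deviation of the sample mean of the wealth vector forces a deviation of half the size for the
  exponential vector, unless the coupling fails. Both terms on the right-hand side are summable.
\<close>

lemma rounded_wealth_sample_mean:
  assumes N: "N \<ge> 1" and c: "c > 0" and L: "L \<ge> 0" "L * (\<delta> + 2 * c) \<le> \<epsilon> / 2"
    and g [measurable]: "g \<in> borel_measurable borel"
    and lip: "\<And>x y. \<bar>g x - g y\<bar> \<le> L * \<bar>x - y\<bar>"
  shows "measure (exp_vector N) {e \<in> space (exp_vector N). \<bar>(\<Sum>i=1..N. g (rounded_wealth N c e i)) / real N - m\<bar> > \<epsilon>}
    \<le> measure (exp_vector N) {e \<in> space (exp_vector N). \<bar>(\<Sum>i=1..N. g (e i)) - real N * m\<bar> \<ge> (\<epsilon> / 2) * real N}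
     + measure (exp_vector N) (far_total N \<delta>)"
    (is "measure _ ?A \<le> measure _ ?B + _")
proof -
  interpret prob_space "exp_vector N" by (rule prob_space_exp_vector)
  have [measurable]: "(\<lambda>e. \<Sum>i=1..N. g (e i)) \<in> borel_measurable (exp_vector N)"
    by (rule measurable_exp_vector_sum) simp
  have B: "?B \<in> sets (exp_vector N)" by measurable
  have "measure (exp_vector N) ?A \<le> measure (exp_vector N) (?B \<union> far_total N \<delta>)"
  proof (rule finite_measure_mono_AE)
    show "AE e in exp_vector N. e \<in> ?A \<longrightarrow> e \<in> ?B \<union> far_total N \<delta>"
      using rounded_wealth_near[OF c, of N \<delta>]
    proof eventually_elim
      case (elim e)
      show ?case
      proof
        assume e: "e \<in> ?A"
        show "e \<in> ?B \<union> far_total N \<delta>"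
        proof (cases "e \<in> far_total N \<delta>")
          case False
          let ?r = "rounded_wealth N c e"
          have "\<bar>(\<Sum>i=1..N. g (?r i)) - (\<Sum>i=1..N. g (e i))\<bar> \<le> (\<Sum>i=1..N. \<bar>g (?r i) - g (e i)\<bar>)"
            unfolding sum_subtractf[symmetric] by (rule sum_abs)
          also have "\<dots> \<le> (\<Sum>i=1..N. L * \<bar>?r i - e i\<bar>)"
            by (intro sum_mono lip)
          also have "\<dots> \<le> L * ((\<delta> + 2 * c) * real N)"
            using elim False L unfolding sum_distrib_left[symmetric] by (intro mult_left_mono) auto
          also have "\<dots> \<le> \<epsilon> / 2 * real N"
            using L(2) mult_right_mono[OF L(2), of "real N"] by (simp add: mult.assoc)
          finally have "\<bar>(\<Sum>i=1..N. g (?r i)) - (\<Sum>i=1..N. g (e i))\<bar> \<le> \<epsilon> / 2 * real N" .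
          moreover have "\<bar>(\<Sum>i=1..N. g (?r i)) - real N * m\<bar> > \<epsilon> * real N"
          proof -
            have "\<bar>(\<Sum>i=1..N. g (?r i)) - real N * m\<bar> = \<bar>(\<Sum>i=1..N. g (?r i)) / real N - m\<bar> * real N"
              using N by (simp add: field_simps abs_mult_pos')
            then show ?thesis using e N by simp
          qed
          ultimately have "\<epsilon> / 2 * real N \<le> \<bar>(\<Sum>i=1..N. g (e i)) - real N * m\<bar>"
            by linarith
          then show ?thesis using e by auto
        qed simp
      qed
    qed
  qed (use B far_total_sets in auto)
  also have "\<dots> \<le> measure (exp_vector N) ?B + measure (exp_vector N) (far_total N \<delta>)"
    by (rule measure_Un_le[OF B far_total_sets])
  finally show ?thesis .
qed

text \<open>
  In the application \<open>f\<close> is the semigroup applied to a sample mean, so its Lipschitz constant is of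
  order \<open>1 / N\<close> and compensates the \<open>l\<^sup>1\<close>-error of order \<open>N\<close>.
\<close>

lemma rounded_wealth_expectation:
  fixes f :: "(nat \<Rightarrow> real) \<Rightarrow> real"
  assumes N: "N \<ge> 1" and c: "c > 0" and L: "L \<ge> 0" and \<delta>: "\<delta> \<ge> 0"
    and f: "f \<in> borel_measurable (wealth_space N)" "\<And>x. x \<in> space (wealth_space N) \<Longrightarrow> \<bar>f x\<bar> \<le> C"
    and lip: "\<And>x y. x \<in> space (wealth_space N) \<Longrightarrow> y \<in> space (wealth_space N) \<Longrightarrow>
                \<bar>f x - f y\<bar> \<le> L / real N * (\<Sum>i=1..N. \<bar>x i - y i\<bar>)"
  shows "\<bar>(\<integral>e. f (rounded_wealth N c e) \<partial>exp_vector N) - (\<integral>e. f e \<partial>exp_vector N)\<bar>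
           \<le> L * (\<delta> + 2 * c) + 2 * C * measure (exp_vector N) (far_total N \<delta>)"
proof -
  interpret prob_space "exp_vector N" by (rule prob_space_exp_vector)
  let ?r = "rounded_wealth N c"
  have r: "?r e \<in> space (wealth_space N)" if "e \<in> space (exp_vector N)" for e
    using measurable_space[OF measurable_rounded_wealth that] .
  have f': "f \<in> borel_measurable (exp_vector N)"
    using f(1) by (simp only: measurable_cong_sets[OF sets_exp_vector refl])
  have fr: "(\<lambda>e. f (?r e)) \<in> borel_measurable (exp_vector N)"
    by (rule measurable_compose[OF measurable_rounded_wealth f(1)])
  have int: "integrable (exp_vector N) f" "integrable (exp_vector N) (\<lambda>e. f (?r e))"
    using f' fr f(2) r by (auto intro!: integrable_const_bound[where B = C] AE_I2 simp only: space_exp_vector real_norm_def)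
  have intB: "integrable (exp_vector N) (indicator (far_total N \<delta>) :: _ \<Rightarrow> real)"
    by (rule integrable_real_indicator[OF far_total_sets])
      (use emeasure_finite in \<open>simp only: less_top infinity_ennreal_def not_False_eq_True\<close>)
  have intS: "integrable (exp_vector N) (\<lambda>e. L * (\<delta> + 2 * c) + 2 * C * indicator (far_total N \<delta>) e)"
    by (rule Bochner_Integration.integrable_add[OF integrable_const integrable_mult_right[OF intB]])
  have "\<bar>(\<integral>e. f (?r e) \<partial>exp_vector N) - (\<integral>e. f e \<partial>exp_vector N)\<bar> = \<bar>\<integral>e. f (?r e) - f e \<partial>exp_vector N\<bar>"
    using int by simp
  also have "\<dots> \<le> (\<integral>e. \<bar>f (?r e) - f e\<bar> \<partial>exp_vector N)"
    by (rule integral_abs_bound)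
  also have "\<dots> \<le> (\<integral>e. L * (\<delta> + 2 * c) + 2 * C * indicator (far_total N \<delta>) e \<partial>exp_vector N)"
  proof (rule integral_mono_AE)
    show "AE e in exp_vector N. \<bar>f (?r e) - f e\<bar> \<le> L * (\<delta> + 2 * c) + 2 * C * indicator (far_total N \<delta>) e"
      using rounded_wealth_near[OF c, of N \<delta>] AE_space
    proof eventually_elim
      case (elim e)
      have e: "e \<in> space (wealth_space N)" using elim(2) by (simp only: space_exp_vector)
      show ?case
      proof (cases "e \<in> far_total N \<delta>")
        case True
        have "0 \<le> L * (\<delta> + 2 * c)" using L c \<delta> by simp
        then show ?thesis
          using True f(2)[OF e] f(2)[OF r[OF elim(2)]] by simp
      next
        case False
        have "\<bar>f (?r e) - f e\<bar> \<le> L / real N * (\<Sum>i=1..N. \<bar>?r e i - e i\<bar>)"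
          by (rule lip[OF r[OF elim(2)] e])
        also have "\<dots> \<le> L / real N * ((\<delta> + 2 * c) * real N)"
          using elim(1) False L by (intro mult_left_mono) auto
        also have "\<dots> = L * (\<delta> + 2 * c)"
          using N by simp
        finally show ?thesis using False by simp
      qed
    qed
  qed (use int intS in auto)
  also have "\<dots> = L * (\<delta> + 2 * c) + 2 * C * measure (exp_vector N) (far_total N \<delta>)"
    unfolding Bochner_Integration.integral_add[OF integrable_const integrable_mult_right[OF intB]]
    using far_total_sets[of N \<delta>] prob_space by (simp add: sets.Int_space_eq2)
  finally show ?thesis .
qed

section \<open>Skorokhod convergence and evaluation near a fixed time\<close>

text \<open>
  Closeness in the sense of Levy's distance. In contrast to the one-sided inequality that defines
  the Prohorov distance, it is evidently symmetric and composes by adding the errors.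
\<close>

definition levy_close :: "real \<Rightarrow> real measure \<Rightarrow> real measure \<Rightarrow> bool" where
  "levy_close \<epsilon> \<nu> \<nu>' \<longleftrightarrow> (\<forall>x. cdf \<nu> (x - \<epsilon>) \<le> cdf \<nu>' x + \<epsilon> \<and> cdf \<nu>' x \<le> cdf \<nu> (x + \<epsilon>) + \<epsilon>)"

lemma levy_close_trans:
  assumes "levy_close a \<nu>1 \<nu>2" "levy_close b \<nu>2 \<nu>3"
  shows "levy_close (a + b) \<nu>1 \<nu>3"
  unfolding levy_close_def
proof (intro allI conjI)
  fix x
  have "cdf \<nu>1 (x - b - a) \<le> cdf \<nu>2 (x - b) + a" "cdf \<nu>2 (x - b) \<le> cdf \<nu>3 x + b"
    "cdf \<nu>3 x \<le> cdf \<nu>2 (x + b) + b" "cdf \<nu>2 (x + b) \<le> cdf \<nu>1 (x + b + a) + a"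
    using assms unfolding levy_close_def by blast+
  moreover have "x - b - a = x - (a + b)" "x + b + a = x + (a + b)" by auto
  ultimately show "cdf \<nu>1 (x - (a + b)) \<le> cdf \<nu>3 x + (a + b)" "cdf \<nu>3 x \<le> cdf \<nu>1 (x + (a + b)) + (a + b)"
    by simp_all
qed

text \<open>
  Closed half-lines to the left give one of the two inequalities between the distribution functions,
  closed half-lines to the right give the other one by passing to complements.
\<close>

lemma levy_close_if_prohorov_dist_less:
  assumes "real_distribution \<nu>" "real_distribution \<nu>'" and less: "prohorov_dist \<nu> \<nu>' < \<epsilon>"
  shows "levy_close \<epsilon> \<nu> \<nu>'"
proof -
  interpret N: real_distribution \<nu> by fact
  interpret N': real_distribution \<nu>' by fact
  let ?S = "{\<epsilon>. \<epsilon> > 0 \<and> (\<forall>F. closed F \<longrightarrow> measure \<nu> F \<le> measure \<nu>' (\<Union>y\<in>F. ball y \<epsilon>) + \<epsilon>)}"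
  have "1 \<in> ?S"
    using N.prob_le_1 by (auto intro: add_increasing)
  then have "?S \<noteq> {}" by blast
  moreover have "bdd_below ?S"
    by (rule bdd_belowI[of _ 0]) auto
  ultimately obtain e where e: "0 < e" "e < \<epsilon>"
    and F: "\<And>F. closed F \<Longrightarrow> measure \<nu> F \<le> measure \<nu>' (\<Union>y\<in>F. ball y e) + e"
    using less unfolding prohorov_dist_def by (subst (asm) cInf_less_iff) auto
  have up: "cdf \<nu> x \<le> cdf \<nu>' (x + \<epsilon>) + \<epsilon>" for x
  proof -
    have "(\<Union>y\<in>{..x}. ball y e) \<subseteq> {..x + \<epsilon>}"
      using e by (auto simp: dist_real_def)
    then have "measure \<nu>' (\<Union>y\<in>{..x}. ball y e) \<le> cdf \<nu>' (x + \<epsilon>)"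
      unfolding cdf_def by (rule N'.finite_measure_mono) simp
    then show ?thesis
      using F[of "{..x}"] e by (simp add: cdf_def)
  qed
  have down: "cdf \<nu>' (x - \<epsilon>) \<le> cdf \<nu> x + \<epsilon>" for x
  proof -
    have "(\<Union>y\<in>{x..}. ball y e) \<subseteq> UNIV - {..x - \<epsilon>}"
      using e by (auto simp: dist_real_def)
    then have "measure \<nu>' (\<Union>y\<in>{x..}. ball y e) \<le> measure \<nu>' (UNIV - {..x - \<epsilon>})"
      by (rule N'.finite_measure_mono) simp
    also have "\<dots> = 1 - cdf \<nu>' (x - \<epsilon>)"
      using N'.prob_compl[of "{..x - \<epsilon>}"] by (simp add: cdf_def)
    finally have "measure \<nu> {x..} \<le> 1 - cdf \<nu>' (x - \<epsilon>) + e"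
      using F[of "{x..}"] by simp
    moreover have "measure \<nu> (UNIV - {..x}) \<le> measure \<nu> {x..}"
      by (rule N.finite_measure_mono) auto
    moreover have "measure \<nu> (UNIV - {..x}) = 1 - cdf \<nu> x"
      using N.prob_compl[of "{..x}"] by (simp add: cdf_def)
    ultimately show ?thesis using e by linarith
  qed
  show ?thesis
    unfolding levy_close_def
  proof (intro allI conjI)
    fix x
    show "cdf \<nu> (x - \<epsilon>) \<le> cdf \<nu>' x + \<epsilon>" using up[of "x - \<epsilon>"] by simp
    show "cdf \<nu>' x \<le> cdf \<nu> (x + \<epsilon>) + \<epsilon>" using down[of "x + \<epsilon>"] by simp
  qed
qed

lemma time_change_zero:
  assumes "\<tau> \<in> time_changes"
  shows "\<tau> 0 = 0"
proof -
  have mono: "strict_mono_on {0..} \<tau>" and im: "\<tau> ` {0..} = {0..}"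
    using assms by (auto simp: time_changes_def)
  from im obtain z where z: "z \<ge> 0" "\<tau> z = 0" by (metis atLeast_iff imageE order_refl)
  have "\<tau> 0 \<ge> 0" using im by auto
  then show ?thesis
    using strict_mono_onD[OF mono, of 0 z] z by (cases "z = 0") auto
qed

text \<open>
  Evaluation at a fixed time is not continuous in Skorokhod's topology. Nevertheless, the value of \<open>x\<close>
  at the midpoint \<open>t + \<delta>\<close> of the window from \<open>t\<close> to \<open>t + 2 \<delta>\<close> is close to a value of \<open>y\<close> in that window, because a time
  change of small distortion does not leave the window. The window is open at \<open>t\<close>, so right-continuity
  of \<open>y\<close> at \<open>t\<close> applies to the value found.
\<close>

lemma skorokhod_dist_less_near:
  assumes t: "0 \<le> t" and \<delta>: "0 < \<delta>" and \<epsilon>: "0 < \<epsilon>" "\<epsilon> < 1"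
  shows "\<exists>\<eta>>0. \<forall>x y. skorokhod_dist d x y < ennreal \<eta> \<longrightarrow>
           (\<exists>s. t < s \<and> s < t + 2 * \<delta> \<and> d (x (t + \<delta>)) (y s) < \<epsilon>)"
proof -
  define t' where "t' = t + \<delta>"
  define T where "T = t + 2 * \<delta>"
  have t': "t' > 0" using t \<delta> by (simp add: t'_def)
  \<comment> \<open>The first bound forces some horizon \<open>u\<close> between \<open>T\<close> and \<open>T + 1\<close> at which the paths stopped at \<open>u\<close> are \<open>\<epsilon>\<close>-close, the second keeps \<open>\<tau> t'\<close> within \<open>\<delta>\<close> of \<open>t'\<close>.\<close>
  define \<eta> where "\<eta> = min (\<epsilon> * exp (- (T + 1))) (ln (1 + \<delta> / t'))"
  have \<eta>: "\<eta> > 0" using \<epsilon> \<delta> t' ln_gt_zero[of "1 + \<delta> / t'"] by (simp add: \<eta>_def)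
  have "\<exists>s. t < s \<and> s < t + 2 * \<delta> \<and> d (x (t + \<delta>)) (y s) < \<epsilon>"
    if less: "skorokhod_dist d x y < ennreal \<eta>" for x y
  proof -
    define F where "F \<tau> u = (SUP t\<in>{0..}. ennreal (min 1 (d (x (min t u)) (y (min (\<tau> t) u)))))" for \<tau> u
    obtain \<tau> where \<tau>: "\<tau> \<in> time_changes" and dis: "distortion \<tau> < ennreal \<eta>"
      and int: "(\<integral>\<^sup>+u. ennreal (exp (- u)) * F \<tau> u * indicator {0..} u \<partial>lborel) < ennreal \<eta>"
      using less unfolding skorokhod_dist_def F_def[symmetric] by (auto simp: INF_less_iff)
    have "\<exists>u\<in>{T..T + 1}. F \<tau> u < ennreal \<epsilon>"
    proof (rule ccontr)
      assume "\<not> ?thesis"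
      then have ge: "ennreal \<epsilon> \<le> F \<tau> u" if "u \<in> {T..T + 1}" for u
        using that by (auto simp: not_less)
      have "ennreal \<eta> \<le> ennreal (\<epsilon> * exp (- (T + 1)))"
        by (rule ennreal_leI) (simp add: \<eta>_def)
      also have "\<dots> = (\<integral>\<^sup>+u. ennreal (\<epsilon> * exp (- (T + 1))) * indicator {T..T + 1} u \<partial>lborel)"
        by (simp add: nn_integral_cmult_indicator)
      also have "\<dots> \<le> (\<integral>\<^sup>+u. ennreal (exp (- u)) * F \<tau> u * indicator {0..} u \<partial>lborel)"
      proof (rule nn_integral_mono)
        fix u :: real
        show "ennreal (\<epsilon> * exp (- (T + 1))) * indicator {T..T + 1} u \<le> ennreal (exp (- u)) * F \<tau> u * indicator {0..} u"
        proof (cases "u \<in> {T..T + 1}")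
          case True
          have "ennreal (\<epsilon> * exp (- (T + 1))) = ennreal (exp (- (T + 1))) * ennreal \<epsilon>"
            using \<epsilon> by (simp add: ennreal_mult mult.commute)
          also have "\<dots> \<le> ennreal (exp (- u)) * F \<tau> u"
            using True by (intro mult_mono ge ennreal_leI) auto
          finally show ?thesis
            using True t \<delta> by (simp add: T_def)
        qed simp
      qed
      finally show False using int by simp
    qed
    then obtain u where u: "u \<ge> T" "F \<tau> u < ennreal \<epsilon>" by auto
    have near: "d (x (min s u)) (y (min (\<tau> s) u)) < \<epsilon>" if "s \<ge> 0" for s
    proof -
      have "ennreal (min 1 (d (x (min s u)) (y (min (\<tau> s) u)))) \<le> F \<tau> u"
        unfolding F_def using that by (intro SUP_upper) auto
      then have "ennreal (min 1 (d (x (min s u)) (y (min (\<tau> s) u)))) < ennreal \<epsilon>"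
        using u(2) by (rule le_less_trans)
      then have "min 1 (d (x (min s u)) (y (min (\<tau> s) u))) < \<epsilon>"
        by (meson ennreal_leI not_le)
      then show ?thesis using \<epsilon>(2) by (auto simp: min_def split: if_splits)
    qed
    have ratio: "\<bar>ln (\<tau> t' / t')\<bar> < \<eta>"
    proof -
      have "ennreal \<bar>ln ((\<tau> t' - \<tau> 0) / (t' - 0))\<bar> \<le> distortion \<tau>"
        unfolding distortion_def using t'
        by (intro SUP_upper2[of "(t', 0)"]) auto
      then have "ennreal \<bar>ln (\<tau> t' / t')\<bar> < ennreal \<eta>"
        using dis time_change_zero[OF \<tau>] by simp
      then show ?thesis using \<eta> by (meson ennreal_leI not_le)
    qed
    have pos: "\<tau> t' > 0"
    proof -
      have "strict_mono_on {0..} \<tau>" using \<tau> by (simp add: time_changes_def)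
      from strict_mono_onD[OF this, of 0 t'] show ?thesis
        using t' time_change_zero[OF \<tau>] by simp
    qed
    have ln_le: "\<bar>ln (\<tau> t' / t')\<bar> < ln (1 + \<delta> / t')"
      using ratio by (simp add: \<eta>_def)
    have "ln (\<tau> t' / t') < ln (1 + \<delta> / t')" using ln_le by simp
    then have "\<tau> t' / t' < 1 + \<delta> / t'"
      using pos t' \<delta> by (subst (asm) ln_less_cancel_iff) (auto intro!: add_pos_pos)
    then have upper: "\<tau> t' < t' + \<delta>" using t' by (simp add: field_simps)
    have "ln (t' / \<tau> t') < ln (1 + \<delta> / t')"
      using ln_le pos t' by (simp add: ln_div)
    then have "t' / \<tau> t' < 1 + \<delta> / t'"
      using pos t' \<delta> by (subst (asm) ln_less_cancel_iff) (auto intro!: add_pos_pos)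
    then have l: "t' * t' < \<tau> t' * (t' + \<delta>)" using t' pos by (simp add: field_simps)
    have lower: "t' - \<delta> < \<tau> t'"
    proof (rule ccontr)
      assume "\<not> t' - \<delta> < \<tau> t'"
      then have "\<tau> t' * (t' + \<delta>) \<le> (t' - \<delta>) * (t' + \<delta>)"
        using t' \<delta> by (intro mult_right_mono) auto
      also have "\<dots> \<le> t' * t'" by (simp add: algebra_simps)
      finally show False using l by simp
    qed
    have "min t' u = t'" "min (\<tau> t') u = \<tau> t'"
      using u(1) upper \<delta> by (auto simp: T_def t'_def)
    then have "d (x t') (y (\<tau> t')) < \<epsilon>"
      using near[of t'] t' by simp
    moreover have "t < \<tau> t'" "\<tau> t' < t + 2 * \<delta>"
      using lower upper by (auto simp: t'_def)
    ultimately show ?thesis unfolding t'_def by blast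
  qed
  then show ?thesis using \<eta> by blast
qed

text \<open>
  The time \<open>t'\<close> is deterministic and the same for all \<open>N\<close>, so the laws of the processes at the single
  time \<open>t'\<close> determine the limit at \<open>t\<close> up to \<open>\<epsilon>\<close>.
\<close>

lemma mean_field_limit_levy_close:
  assumes lim: "mean_field_limit M X \<mu>" and t: "t \<ge> 0" and \<epsilon>: "\<epsilon> > 0"
    and emp: "\<And>N x. N \<ge> 1 \<Longrightarrow> real_distribution (empirical_measure N x)"
  shows "\<exists>t'>t. \<exists>A. (\<forall>n. A n \<in> sets M) \<and> (\<lambda>n. measure M (A n)) \<longlonglongrightarrow> 0 \<and>
      (\<forall>\<^sub>F N in sequentially. \<forall>\<omega>\<in>space M - A N. levy_close \<epsilon> (empirical_measure N (X N t' \<omega>)) (\<mu> t))"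
proof -
  define e where "e = min (\<epsilon> / 2) (1 / 2)"
  have e: "0 < e" "e < 1" "e + e \<le> \<epsilon>" using \<epsilon> by (auto simp: e_def)
  have \<mu>: "\<mu> \<in> skorokhod_space half_line_prob_measures prohorov_dist"
    and conv: "tendsto_in_probability M (skorokhod_dist prohorov_dist) (\<lambda>N \<omega> t. empirical_measure N (X N t \<omega>)) \<mu>"
    using lim by (auto simp: mean_field_limit_def)
  have rd: "real_distribution (\<mu> s)" if "s \<ge> 0" for s
    using \<mu> that by (auto simp: skorokhod_space_def half_line_prob_measures_def)
  have "((\<lambda>s. prohorov_dist (\<mu> s) (\<mu> t)) \<longlongrightarrow> 0) (at_right t)"
    using \<mu> t by (auto simp: skorokhod_space_def)
  then have "\<forall>\<^sub>F s in at_right t. prohorov_dist (\<mu> s) (\<mu> t) < e"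
    using e(1) by (rule order_tendstoD(2))
  then obtain r where r: "r > t" "\<And>s. t < s \<Longrightarrow> s < r \<Longrightarrow> prohorov_dist (\<mu> s) (\<mu> t) < e"
    unfolding eventually_at_right_field by auto
  define \<delta> where "\<delta> = (r - t) / 2"
  have \<delta>: "\<delta> > 0" "t + 2 * \<delta> = r" using r(1) by (simp_all add: \<delta>_def field_simps)
  obtain \<eta> where \<eta>: "\<eta> > 0" and near: "\<And>x y. skorokhod_dist prohorov_dist x y < ennreal \<eta> \<Longrightarrow>
      \<exists>s. t < s \<and> s < t + 2 * \<delta> \<and> prohorov_dist (x (t + \<delta>)) (y s) < e"
    using skorokhod_dist_less_near[OF t \<delta>(1) e(1,2), of prohorov_dist] by blast
  have "ennreal (\<eta> / 2) > 0" using \<eta> by simp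
  then obtain A where A: "\<And>n. A n \<in> sets M" "(\<lambda>n. measure M (A n)) \<longlonglongrightarrow> 0"
    and ev: "\<forall>\<^sub>F n in sequentially. {\<omega>\<in>space M. skorokhod_dist prohorov_dist (\<lambda>t. empirical_measure n (X n t \<omega>)) \<mu> > ennreal (\<eta> / 2)} \<subseteq> A n"
    using conv unfolding tendsto_in_probability_def by blast
  have "\<forall>\<^sub>F N in sequentially. \<forall>\<omega>\<in>space M - A N. levy_close \<epsilon> (empirical_measure N (X N (t + \<delta>) \<omega>)) (\<mu> t)"
    using ev eventually_ge_at_top[of 1]
  proof eventually_elim
    case (elim N)
    show ?case
    proof
      fix \<omega> assume \<omega>: "\<omega> \<in> space M - A N"
      have "skorokhod_dist prohorov_dist (\<lambda>t. empirical_measure N (X N t \<omega>)) \<mu> \<le> ennreal (\<eta> / 2)"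
        using elim(1) \<omega> by (force simp: not_less[symmetric])
      also have "\<dots> < ennreal \<eta>" using \<eta> by (simp add: ennreal_lessI)
      finally obtain s where s: "t < s" "s < r"
        "prohorov_dist (empirical_measure N (X N (t + \<delta>) \<omega>)) (\<mu> s) < e"
        using near \<delta>(2) by blast
      have "levy_close e (empirical_measure N (X N (t + \<delta>) \<omega>)) (\<mu> s)"
        by (rule levy_close_if_prohorov_dist_less[OF emp[OF elim(2)] rd s(3)]) (use s t in simp)
      moreover have "levy_close e (\<mu> s) (\<mu> t)"
        by (rule levy_close_if_prohorov_dist_less[OF rd rd r(2)[OF s(1,2)]]) (use s t in auto)
      ultimately have "levy_close (e + e) (empirical_measure N (X N (t + \<delta>) \<omega>)) (\<mu> t)"
        by (rule levy_close_trans)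
      moreover have "cdf \<nu> (x - \<epsilon>) \<le> cdf \<nu> (x - (e + e))" "cdf \<nu> (x + (e + e)) \<le> cdf \<nu> (x + \<epsilon>)"
        if "real_distribution \<nu>" for \<nu> x
        using e(3) that
        by (auto intro!: finite_borel_measure.cdf_nondecreasing real_distribution.finite_borel_measure_M)
      ultimately show "levy_close \<epsilon> (empirical_measure N (X N (t + \<delta>) \<omega>)) (\<mu> t)"
        using emp[OF elim(2)] e(3) unfolding levy_close_def by (smt (verit))
    qed
  qed
  then show ?thesis using A \<delta>(1) by (intro exI[of _ "t + \<delta>"]) auto
qed

section \<open>Arrays of geometric variables\<close>

text \<open>
  Right-continuity of distribution functions turns the inequalities at separated points into
  inequalities at the same point.
\<close>

lemma real_distribution_eq_if_interlaced:
  assumes "real_distribution M" "real_distribution L"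
    and le: "\<And>x z. x < z \<Longrightarrow> cdf M x \<le> cdf L z" "\<And>x z. x < z \<Longrightarrow> cdf L x \<le> cdf M z"
  shows "M = L"
proof -
  have cdf_le: "cdf M x \<le> cdf L x"
    if "real_distribution L" and le: "\<And>x z. x < z \<Longrightarrow> cdf M x \<le> cdf L z" for M L :: "real measure" and x
  proof -
    interpret real_distribution L by fact
    have "(cdf L \<longlongrightarrow> cdf L x) (at_right x)"
      using cdf_is_right_cont[of x] by (simp add: continuous_within)
    moreover have "\<forall>\<^sub>F z in at_right x. cdf M x \<le> cdf L z"
      using le by (auto simp: eventually_at_right_field intro!: exI[of _ "x + 1"])
    ultimately show ?thesis
      by (rule tendsto_lowerbound) simp
  qed
  show ?thesis
    by (rule cdf_unique[OF assms(1,2)])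
       (intro ext antisym cdf_le assms)
qed

lemma measurable_wealth_space_sum:
  fixes g :: "real \<Rightarrow> real"
  assumes "g \<in> borel_measurable borel"
  shows "(\<lambda>x. (\<Sum>i=1..N. g (x i)) / real N) \<in> borel_measurable (wealth_space N)"
proof -
  have "(\<lambda>x. \<Sum>i=1..N. g (x i)) \<in> borel_measurable (wealth_space N)"
    using measurable_exp_vector_sum[OF assms, of N] by (simp only: measurable_cong_sets[OF sets_exp_vector refl])
  then show ?thesis by (rule borel_measurable_divide) simp
qed

locale geometric_array = prob_space P for P :: "'a measure" +
  fixes p :: "nat \<Rightarrow> real" and G :: "nat \<Rightarrow> nat \<Rightarrow> 'a \<Rightarrow> nat"
  assumes p_pos: "\<And>N. N \<ge> 1 \<Longrightarrow> 0 < p N"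
    and p_lim: "p \<longlonglongrightarrow> 0"
    and G_indep: "indep_vars (\<lambda>_. count_space UNIV) (\<lambda>(N, i). G N i) {(N, i). 1 \<le> i \<and> i \<le> N}"
    and G_geometric: "\<And>N i k. 1 \<le> i \<Longrightarrow> i \<le> N \<Longrightarrow> prob {\<omega>\<in>space P. G N i \<omega> = k} = p N * (1 - p N) ^ k"
begin

definition wealth :: "nat \<Rightarrow> 'a \<Rightarrow> nat \<Rightarrow> real" where
  "wealth N \<omega> = initial_wealth N (\<lambda>i. G N i \<omega>)"

text \<open>
  The spacing at which rounding an \<open>Exp(1)\<close> variable gives a geometric variable of parameter \<open>p N\<close>.
\<close>

definition mesh :: "nat \<Rightarrow> real" where
  "mesh N = - ln (1 - p N)"

lemma mesh_lim: "mesh \<longlonglongrightarrow> 0"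
proof -
  have "(\<lambda>N. - ln (1 - p N)) \<longlonglongrightarrow> - ln (1 - 0)"
    by (intro tendsto_intros p_lim) simp
  then show ?thesis by (simp add: mesh_def[abs_def])
qed

lemma p_less_1: "\<forall>\<^sub>F N in sequentially. p N < 1"
  using order_tendstoD(2)[OF p_lim, of 1] by simp

lemma mesh_pos: "N \<ge> 1 \<Longrightarrow> p N < 1 \<Longrightarrow> mesh N > 0"
  using p_pos[of N] by (simp add: mesh_def)

lemma row_indep: "indep_vars (\<lambda>_. count_space UNIV) (G N) {1..N}"
proof -
  have "indep_vars (\<lambda>_. count_space UNIV) (\<lambda>(N, i). G N i) {(m, i). i \<in> {1..m}}"
    using G_indep by simp
  from indep_vars_section[OF this, of N] show ?thesis by simp
qed

lemma wealth_measurable: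
  assumes "N \<ge> 1" "p N < 1"
  shows "wealth N \<in> P \<rightarrow>\<^sub>M wealth_space N"
  unfolding wealth_def[abs_def]
  using initial_wealth_distr(1)[OF prob_space_axioms assms(1) row_indep _ p_pos[OF assms(1)] assms(2) refl]
    G_geometric by simp

lemma wealth_distr:
  assumes "N \<ge> 1" "p N < 1"
  shows "distr P (wealth_space N) (wealth N) = distr (exp_vector N) (wealth_space N) (rounded_wealth N (mesh N))"
  unfolding wealth_def[abs_def]
  using initial_wealth_distr(2)[OF prob_space_axioms assms(1) row_indep _ p_pos[OF assms(1)] assms(2) mesh_def]
    G_geometric by simp

lemma prob_wealth:
  assumes "N \<ge> 1" "p N < 1" and B: "B \<in> sets (wealth_space N)"
  shows "prob {\<omega>\<in>space P. wealth N \<omega> \<in> B}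
       = measure (exp_vector N) {e \<in> space (exp_vector N). rounded_wealth N (mesh N) e \<in> B}"
proof -
  have "prob {\<omega>\<in>space P. wealth N \<omega> \<in> B} = measure (distr P (wealth_space N) (wealth N)) B"
    by (subst measure_distr[OF wealth_measurable[OF assms(1,2)] B]) (simp add: vimage_def Int_def conj_commute)
  also have "\<dots> = measure (exp_vector N) {e \<in> space (exp_vector N). rounded_wealth N (mesh N) e \<in> B}"
    unfolding wealth_distr[OF assms(1,2)]
    by (subst measure_distr[OF measurable_rounded_wealth B]) (simp add: vimage_def Int_def conj_commute)
  finally show ?thesis .
qed

text \<open>
  The probability of a deviation depends only on the law of the \<open>N\<close>-th row, so it can be estimated on the
  space of exponential vectors, where the coupling and Chernoff's bound make it summable in \<open>N\<close>.
\<close>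

lemma AE_wealth_sample_mean:
  fixes g :: "real \<Rightarrow> real"
  assumes g [measurable]: "g \<in> borel_measurable borel" and bound: "\<And>x. \<bar>g x\<bar> \<le> K"
    and L: "L \<ge> 0" and lip: "\<And>x y. \<bar>g x - g y\<bar> \<le> L * \<bar>x - y\<bar>"
  shows "AE \<omega> in P. (\<lambda>N. (\<Sum>i=1..N. g (wealth N \<omega> i)) / real N) \<longlonglongrightarrow> (\<integral>x. g x \<partial>Exp1)"
proof -
  define m where "m = (\<integral>x. g x \<partial>Exp1)"
  have "AE \<omega> in P. \<forall>\<^sub>F N in sequentially. \<bar>(\<Sum>i=1..N. g (wealth N \<omega> i)) / real N - m\<bar> \<le> \<epsilon>"
    if \<epsilon>: "\<epsilon> > 0" for \<epsilon>
  proof -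
    define \<delta> where "\<delta> = \<epsilon> / 4 / (L + 1)"
    have \<delta>: "\<delta> > 0" "L * (\<delta> + \<delta>) \<le> \<epsilon> / 2"
    proof -
      show "\<delta> > 0" using L \<epsilon> by (simp add: \<delta>_def)
      have "\<delta> * (L + 1) = \<epsilon> / 4" using L by (subst nonzero_eq_divide_eq[symmetric]) (auto simp: \<delta>_def)
      then show "L * (\<delta> + \<delta>) \<le> \<epsilon> / 2" using \<open>\<delta> > 0\<close> by (simp add: algebra_simps)
    qed
    have "\<forall>\<^sub>F N in sequentially. N \<ge> 1 \<and> p N < 1 \<and> mesh N < \<delta> / 2"
      using eventually_ge_at_top p_less_1 order_tendstoD(2)[OF mesh_lim, of "\<delta> / 2"] \<delta>
      by (auto intro: eventually_conj)
    then obtain N0 where N0: "\<And>N. N \<ge> N0 \<Longrightarrow> N \<ge> 1 \<and> p N < 1 \<and> mesh N < \<delta> / 2"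
      unfolding eventually_sequentially by blast
    define B where "B N = {x \<in> space (wealth_space N). \<bar>(\<Sum>i=1..N. g (x i)) / real N - m\<bar> > \<epsilon>}" for N
    have B: "B N \<in> sets (wealth_space N)" for N
    proof -
      have [measurable]: "(\<lambda>x. (\<Sum>i=1..N. g (x i)) / real N) \<in> borel_measurable (wealth_space N)"
        by (rule measurable_wealth_space_sum[OF g])
      show ?thesis unfolding B_def by measurable
    qed
    \<comment> \<open>Finitely many rows are discarded: for them \<open>p N = 1\<close> is possible, or the mesh is too coarse for \<open>\<epsilon>\<close>.\<close>
    define bad where "bad N = (if N \<ge> N0 then {\<omega>\<in>space P. wealth N \<omega> \<in> B N} else {})" for N
    have bad_sets: "bad N \<in> sets P" for N
      unfolding bad_def using measurable_sets[OF wealth_measurable B, of N] N0[of N]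
      by (auto simp: vimage_def Int_def conj_commute)
    have far: "summable (\<lambda>N. measure (exp_vector N) (far_total N \<delta>))"
      by (rule far_total_summable[OF \<delta>(1)])
    have dev: "summable (\<lambda>N. measure (exp_vector N)
        {e \<in> space (exp_vector N). \<bar>(\<Sum>i=1..N. g (e i)) - real N * m\<bar> \<ge> (\<epsilon> / 2) * real N})"
      unfolding m_def
    proof (rule sample_mean_deviation_summable[OF prob_space_Exp1])
      interpret E: prob_space Exp1 by (rule prob_space_Exp1)
      show "integrable Exp1 (\<lambda>x. exp (1 * \<bar>g x\<bar>))"
        by (rule E.integrable_const_bound[where B = "exp K"]) (auto simp: bound)
    qed (use \<epsilon> in auto)
    have "measure P (bad N) \<le> measure (exp_vector N)
        {e \<in> space (exp_vector N). \<bar>(\<Sum>i=1..N. g (e i)) - real N * m\<bar> \<ge> (\<epsilon> / 2) * real N}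
        + measure (exp_vector N) (far_total N \<delta>)" if N: "N \<ge> N0" for N
    proof -
      note N' = N0[OF N]
      have "measure P (bad N) = measure (exp_vector N) {e \<in> space (exp_vector N). rounded_wealth N (mesh N) e \<in> B N}"
        unfolding bad_def using N N' B by (simp add: prob_wealth)
      also have "{e \<in> space (exp_vector N). rounded_wealth N (mesh N) e \<in> B N}
          = {e \<in> space (exp_vector N). \<bar>(\<Sum>i=1..N. g (rounded_wealth N (mesh N) e i)) / real N - m\<bar> > \<epsilon>}"
        unfolding B_def using measurable_space[OF measurable_rounded_wealth] by blast
      also have "measure (exp_vector N) \<dots> \<le> measure (exp_vector N)
        {e \<in> space (exp_vector N). \<bar>(\<Sum>i=1..N. g (e i)) - real N * m\<bar> \<ge> (\<epsilon> / 2) * real N}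
        + measure (exp_vector N) (far_total N \<delta>)"
      proof (rule rounded_wealth_sample_mean[OF _ _ L _ g lip])
        show "L * (\<delta> + 2 * mesh N) \<le> \<epsilon> / 2"
          using \<delta>(2) mult_left_mono[of "\<delta> + 2 * mesh N" "\<delta> + \<delta>" L] N' L by linarith
      qed (use N' mesh_pos in auto)
      finally show ?thesis .
    qed
    then have "summable (\<lambda>N. measure P (bad N))"
      by (intro summable_comparison_test'[OF summable_add[OF dev far]]) auto
    then have "AE \<omega> in P. \<forall>\<^sub>F N in sequentially. \<omega> \<in> space P - bad N"
      using bad_sets by (intro borel_cantelli_AE1) (auto simp: emeasure_eq_measure)
    then show ?thesis
    proof eventually_elim
      case (elim \<omega>)
      show ?case
        using elim eventually_ge_at_top[of N0]
      proof eventually_elim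
        case (elim N)
        then have "wealth N \<omega> \<in> space (wealth_space N)"
          using measurable_space[OF wealth_measurable] N0[of N] by blast
        then show ?case
          using elim by (auto simp: bad_def B_def)
      qed
    qed
  qed
  then have "AE \<omega> in P. \<forall>k. \<forall>\<^sub>F N in sequentially.
      \<bar>(\<Sum>i=1..N. g (wealth N \<omega> i)) / real N - m\<bar> \<le> 1 / real (Suc k)"
    unfolding AE_all_countable by simp
  then show ?thesis
  proof eventually_elim
    case (elim \<omega>)
    show ?case
      unfolding m_def[symmetric]
    proof (rule tendstoI)
      fix r :: real assume "r > 0"
      then obtain k where k: "1 / real (Suc k) < r" using nat_approx_posE by blast
      show "\<forall>\<^sub>F N in sequentially. dist ((\<Sum>i=1..N. g (wealth N \<omega> i)) / real N) m < r"
        using elim[rule_format, of k] by eventually_elim (use k in \<open>simp add: dist_real_def\<close>)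
    qed
  qed
qed

lemma AE_wealth_weak_conv:
  "AE \<omega> in P. weak_conv_m (\<lambda>N. empirical_measure N (wealth N \<omega>)) Exp1"
proof -
  have "AE \<omega> in P. \<forall>a b :: rat. a < b \<longrightarrow>
    (\<lambda>N. (\<Sum>i=1..N. cts_step (of_rat a) (of_rat b) (wealth N \<omega> i)) / real N)
       \<longlonglongrightarrow> (\<integral>x. cts_step (of_rat a) (of_rat b) x \<partial>Exp1)"
    unfolding AE_all_countable
  proof (intro allI)
    fix a b :: rat
    show "AE \<omega> in P. a < b \<longrightarrow>
      (\<lambda>N. (\<Sum>i=1..N. cts_step (of_rat a) (of_rat b) (wealth N \<omega> i)) / real N)
         \<longlonglongrightarrow> (\<integral>x. cts_step (of_rat a) (of_rat b) x \<partial>Exp1)"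
    proof (cases "a < b")
      case True
      then have ab: "of_rat a < (of_rat b :: real)" by (simp add: of_rat_less)
      have "AE \<omega> in P. (\<lambda>N. (\<Sum>i=1..N. cts_step (of_rat a) (of_rat b) (wealth N \<omega> i)) / real N)
         \<longlonglongrightarrow> (\<integral>x. cts_step (of_rat a) (of_rat b) x \<partial>Exp1)"
      proof (rule AE_wealth_sample_mean[OF measurable_cts_step _ _ cts_step_lipschitz[OF ab]])
        show "\<bar>cts_step (of_rat a) (of_rat b) x\<bar> \<le> 1" for x
          using cts_step_bounds[OF ab, of x] by simp
      qed (use ab in simp)
      then show ?thesis by eventually_elim simp
    qed simp
  qed
  then show ?thesis
  proof eventually_elim
    case (elim \<omega>)
    show ?case
      by (rule weak_conv_m_if_rational_steps[OF real_distribution_empirical_measure real_distribution_Exp1])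
         (use elim in \<open>simp_all add: integral_empirical_measure\<close>)
  qed
qed

text \<open>
  The mean at time \<open>t\<close> is the mean of \<open>\<phi>\<close>, the semigroup applied to the sample mean, at the
  initial wealth. By the coupling and the Lipschitz bound for \<open>\<phi>\<close> it is close to the mean of \<open>\<phi>\<close> under
  the exponential vector, which stationarity identifies with the mean at time \<open>0\<close>.
\<close>

lemma exchange_process_sample_mean:
  fixes g :: "real \<Rightarrow> real"
  assumes X: "\<And>N. N \<ge> 2 \<Longrightarrow> exchange_process P N (X N)"
    and X0: "\<And>N \<omega>. N \<ge> 2 \<Longrightarrow> \<omega> \<in> space P \<Longrightarrow> X N 0 \<omega> = wealth N \<omega>"
    and t: "t \<ge> 0"
    and g: "g \<in> borel_measurable borel" and bound: "\<And>x. \<bar>g x\<bar> \<le> K"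
    and L: "L \<ge> 0" and lip: "\<And>x y. \<bar>g x - g y\<bar> \<le> L * \<bar>x - y\<bar>"
  shows "(\<lambda>N. \<integral>\<omega>. (\<Sum>i=1..N. g (X N t \<omega> i)) / real N \<partial>P) \<longlonglongrightarrow> (\<integral>x. g x \<partial>Exp1)"
proof -
  define m where "m = (\<integral>x. g x \<partial>Exp1)"
  have K: "K \<ge> 0" using bound[of 0] by linarith
  have close: "\<bar>(\<integral>\<omega>. (\<Sum>i=1..N. g (X N t \<omega> i)) / real N \<partial>P) - m\<bar>
      \<le> L * (\<delta> + 2 * mesh N) + 2 * K * measure (exp_vector N) (far_total N \<delta>)"
    if N: "N \<ge> 2" "p N < 1" and \<delta>: "\<delta> \<ge> 0" for N \<delta>
  proof -
    interpret E: prob_space "exp_vector N" by (rule prob_space_exp_vector)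
    define f where "f x = (\<Sum>i=1..N. g (x i)) / real N" for x
    define \<phi> where "\<phi> = jump_semigroup (exchange_generator N) t f"
    have N1: "N \<ge> 1" using N by simp
    have fm: "f \<in> borel_measurable (wealth_space N)"
      unfolding f_def[abs_def] by (rule measurable_wealth_space_sum[OF g])
    have fb: "\<bar>f x\<bar> \<le> K" for x
    proof -
      have "\<bar>\<Sum>i=1..N. g (x i)\<bar> \<le> (\<Sum>i=1..N. K)"
        by (rule order_trans[OF sum_abs]) (intro sum_mono bound)
      then show ?thesis using N by (simp add: f_def abs_divide field_simps)
    qed
    have fl: "\<bar>f x - f y\<bar> \<le> L / real N * (\<Sum>i=1..N. \<bar>x i - y i\<bar>)" for x y
    proof -
      have "\<bar>f x - f y\<bar> = \<bar>\<Sum>i=1..N. g (x i) - g (y i)\<bar> / real N"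
        using N by (simp add: f_def sum_subtractf diff_divide_distrib[symmetric] abs_divide)
      also have "\<dots> \<le> (\<Sum>i=1..N. L * \<bar>x i - y i\<bar>) / real N"
        by (intro divide_right_mono order_trans[OF sum_abs] sum_mono lip) simp
      finally show ?thesis by (simp add: sum_distrib_left[symmetric])
    qed
    have \<phi>m: "\<phi> \<in> borel_measurable (wealth_space N)"
      unfolding \<phi>_def by (rule jump_semigroup_measurable[OF N(1) fm fb])
    have \<phi>b: "\<bar>\<phi> x\<bar> \<le> K" if "x \<in> space (wealth_space N)" for x
      unfolding \<phi>_def by (rule jump_semigroup_bound[OF N(1) that t fm fb])
    have \<phi>l: "\<bar>\<phi> x - \<phi> y\<bar> \<le> L / real N * (\<Sum>i=1..N. \<bar>x i - y i\<bar>)"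
      if "x \<in> space (wealth_space N)" "y \<in> space (wealth_space N)" for x y
      unfolding \<phi>_def by (rule jump_semigroup_lipschitz[OF N(1) that t fm fb _ fl]) (use L in simp)
    have "(\<integral>\<omega>. f (X N t \<omega>) \<partial>P) = (\<integral>\<omega>. \<phi> (X N 0 \<omega>) \<partial>P)"
      unfolding \<phi>_def
      by (rule markov_expectation[OF prob_space_axioms _ t fm fb])
         (use X[OF N(1)] \<phi>m in \<open>simp_all add: exchange_process_def \<phi>_def\<close>)
    also have "\<dots> = (\<integral>\<omega>. \<phi> (wealth N \<omega>) \<partial>P)"
      by (rule Bochner_Integration.integral_cong) (simp_all add: X0[OF N(1)])
    also have "\<dots> = (\<integral>x. \<phi> x \<partial>distr P (wealth_space N) (wealth N))"
      by (rule integral_distr[symmetric, OF wealth_measurable[OF N1 N(2)] \<phi>m])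
    also have "\<dots> = (\<integral>e. \<phi> (rounded_wealth N (mesh N) e) \<partial>exp_vector N)"
      unfolding wealth_distr[OF N1 N(2)] by (rule integral_distr[OF measurable_rounded_wealth \<phi>m])
    finally have 1: "(\<integral>\<omega>. f (X N t \<omega>) \<partial>P) = (\<integral>e. \<phi> (rounded_wealth N (mesh N) e) \<partial>exp_vector N)" .
    have comp: "(\<integral>e. g (e i) \<partial>exp_vector N) = m" "integrable (exp_vector N) (\<lambda>e. g (e i))" if i: "i \<in> {1..N}" for i
    proof -
      have e: "(\<lambda>e. e i) \<in> exp_vector N \<rightarrow>\<^sub>M Exp1"
        by (rule measurable_component_singleton[OF i])
      have g1: "g \<in> borel_measurable Exp1" using g by simp
      have "distr (exp_vector N) Exp1 (\<lambda>e. e i) = Exp1"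
        by (rule distr_PiM_component[OF prob_space_Exp1 i])
      then show "(\<integral>e. g (e i) \<partial>exp_vector N) = m"
        using integral_distr[OF e g1] by (simp add: m_def)
      show "integrable (exp_vector N) (\<lambda>e. g (e i))"
        by (rule E.integrable_const_bound[where B = K])
           (use bound measurable_compose[OF e g1] in auto)
    qed
    have "(\<integral>e. \<phi> e \<partial>exp_vector N) = (\<integral>e. f e \<partial>exp_vector N)"
      unfolding \<phi>_def
      by (rule jump_semigroup_stationary[OF N(1) t prob_space_exp_vector sets_exp_vector
            exp_vector_mean_exchange[OF N(1)] fm fb])
    also have "\<dots> = (\<Sum>i=1..N. \<integral>e. g (e i) \<partial>exp_vector N) / real N"
      unfolding f_def using comp(2) by (subst integral_divide_zero, subst Bochner_Integration.integral_sum) auto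
    also have "\<dots> = m"
      using comp(1) N by simp
    finally have 2: "(\<integral>e. \<phi> e \<partial>exp_vector N) = m" .
    show ?thesis
      unfolding f_def[symmetric] 1
      using rounded_wealth_expectation[OF N1 mesh_pos[OF N1 N(2)] L \<delta> \<phi>m \<phi>b \<phi>l] unfolding 2 .
  qed
  show ?thesis
    unfolding m_def[symmetric]
  proof (rule tendstoI)
    fix r :: real assume r: "r > 0"
    define \<delta> where "\<delta> = r / 2 / (L + 1)"
    have \<delta>: "\<delta> > 0" "L * \<delta> < r"
    proof -
      show "\<delta> > 0" using L r by (simp add: \<delta>_def)
      have "\<delta> * (L + 1) = r / 2" using L by (subst nonzero_eq_divide_eq[symmetric]) (auto simp: \<delta>_def)
      then show "L * \<delta> < r" using \<open>\<delta> > 0\<close> r by (simp add: algebra_simps)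
    qed
    have "(\<lambda>N. measure (exp_vector N) (far_total N \<delta>)) \<longlonglongrightarrow> 0"
      by (rule summable_LIMSEQ_zero[OF far_total_summable[OF \<delta>(1)]])
    then have "(\<lambda>N. L * (\<delta> + 2 * mesh N) + 2 * K * measure (exp_vector N) (far_total N \<delta>))
        \<longlonglongrightarrow> L * (\<delta> + 2 * 0) + 2 * K * 0"
      by (intro tendsto_intros mesh_lim)
    then have "\<forall>\<^sub>F N in sequentially. L * (\<delta> + 2 * mesh N) + 2 * K * measure (exp_vector N) (far_total N \<delta>) < r"
      using \<delta>(2) by (intro order_tendstoD(2)) auto
    then show "\<forall>\<^sub>F N in sequentially. dist (\<integral>\<omega>. (\<Sum>i=1..N. g (X N t \<omega> i)) / real N \<partial>P) m < r"
      using p_less_1 eventually_ge_at_top[of 2]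
    proof eventually_elim
      case (elim N)
      then show ?case
        using close[of N \<delta>] \<delta>(1) by (simp add: dist_real_def)
    qed
  qed
qed

text \<open>
  The limit is deterministic, so convergence of expectations identifies it: an inequality between the
  constant \<open>cdf (\<mu> t)\<close> and a random ramp integral that holds with probability close to \<open>1\<close> becomes an
  inequality between \<open>cdf (\<mu> t)\<close> and the limit of the expected ramp integrals.
\<close>

lemma mean_field_limit_eq_Exp1:
  assumes X: "\<And>N. N \<ge> 2 \<Longrightarrow> exchange_process P N (X N)"
    and X0: "\<And>N \<omega>. N \<ge> 2 \<Longrightarrow> \<omega> \<in> space P \<Longrightarrow> X N 0 \<omega> = wealth N \<omega>"
    and lim: "mean_field_limit P X \<mu>" and t: "t \<ge> 0"
  shows "\<mu> t = Exp1"
proof -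
  have mu: "real_distribution (\<mu> t)"
    using lim t by (auto simp: mean_field_limit_def skorokhod_space_def half_line_prob_measures_def)
  interpret mu: real_distribution "\<mu> t" by fact
  interpret E: real_distribution Exp1 by (rule real_distribution_Exp1)
  have sandwich: "cdf (\<mu> t) (a - \<epsilon>) \<le> (\<integral>x. cts_step a b x \<partial>Exp1) + \<epsilon>"
      "(\<integral>x. cts_step a b x \<partial>Exp1) \<le> cdf (\<mu> t) (b + \<epsilon>) + \<epsilon>"
    if \<epsilon>: "\<epsilon> > 0" and ab: "a < b" for \<epsilon> a b
  proof -
    define m where "m = (\<integral>x. cts_step a b x \<partial>Exp1)"
    obtain t' A where t': "t' > t" and A: "\<And>n. A n \<in> events" "(\<lambda>n. prob (A n)) \<longlonglongrightarrow> 0"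
      and near: "\<forall>\<^sub>F N in sequentially. \<forall>\<omega>\<in>space P - A N. levy_close \<epsilon> (empirical_measure N (X N t' \<omega>)) (\<mu> t)"
      using mean_field_limit_levy_close[OF lim t \<epsilon> real_distribution_empirical_measure] by blast
    define Y where "Y N \<omega> = (\<Sum>i=1..N. cts_step a b (X N t' \<omega> i)) / real N" for N \<omega>
    have conv: "(\<lambda>N. \<integral>\<omega>. Y N \<omega> \<partial>P) \<longlonglongrightarrow> m"
      unfolding m_def Y_def
    proof (rule exchange_process_sample_mean[OF X X0 _ measurable_cts_step _ _ cts_step_lipschitz[OF ab]])
      show "\<bar>cts_step a b x\<bar> \<le> 1" for x
        using cts_step_bounds[OF ab, of x] by simp
    qed (use ab t t' in auto)
    have Y01: "0 \<le> Y N \<omega>" "Y N \<omega> \<le> 1" for N \<omega>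
    proof -
      show "0 \<le> Y N \<omega>"
        unfolding Y_def using cts_step_bounds[OF ab] by (intro divide_nonneg_nonneg sum_nonneg) auto
      have "(\<Sum>i=1..N. cts_step a b (X N t' \<omega> i)) \<le> (\<Sum>i=1..N. 1)"
        using cts_step_bounds[OF ab] by (intro sum_mono) auto
      then show "Y N \<omega> \<le> 1"
        unfolding Y_def by (auto simp: divide_le_eq)
    qed
    have ind: "integrable P (indicator (A N) :: _ \<Rightarrow> real)" "(\<integral>\<omega>. indicator (A N) \<omega> \<partial>P) = prob (A N)" for N
      using A(1)[of N] by (auto simp: emeasure_eq_measure)
    have int: "integrable P (Y N)" if "N \<ge> 2" for N
    proof (rule integrable_const_bound[where B = 1])
      have "X N t' \<in> P \<rightarrow>\<^sub>M wealth_space N"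
        using X[OF that] t t' unfolding exchange_process_def markov_jump_process_def by simp
      from measurable_compose[OF this measurable_wealth_space_sum[OF measurable_cts_step]]
      show "Y N \<in> borel_measurable P"
        unfolding Y_def[abs_def] .
    qed (use Y01 in auto)
    \<comment> \<open>All quantities lie between \<open>0\<close> and \<open>1\<close>, so adding the indicator of the exceptional event makes the bounds hold everywhere.\<close>
    have pointwise: "\<forall>\<^sub>F N in sequentially. N \<ge> 2 \<and> (\<forall>\<omega>\<in>space P.
        cdf (\<mu> t) (a - \<epsilon>) \<le> Y N \<omega> + \<epsilon> + indicator (A N) \<omega> \<and>
        Y N \<omega> \<le> cdf (\<mu> t) (b + \<epsilon>) + \<epsilon> + indicator (A N) \<omega>)"
      using near eventually_ge_at_top[of 2]
    proof eventually_elim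
      case (elim N)
      show ?case
      proof (intro conjI ballI)
        show "N \<ge> 2" by fact
        fix \<omega> assume \<omega>: "\<omega> \<in> space P"
        interpret emp: real_distribution "empirical_measure N (X N t' \<omega>)"
          using elim(2) by (intro real_distribution_empirical_measure) simp
        have Y: "Y N \<omega> = (\<integral>x. cts_step a b x \<partial>empirical_measure N (X N t' \<omega>))"
          unfolding Y_def by (rule integral_empirical_measure[symmetric]) simp
        have cdf: "cdf (empirical_measure N (X N t' \<omega>)) a \<le> Y N \<omega>" "Y N \<omega> \<le> cdf (empirical_measure N (X N t' \<omega>)) b"
          unfolding Y by (rule emp.cdf_cts_step[OF ab])+
        show "cdf (\<mu> t) (a - \<epsilon>) \<le> Y N \<omega> + \<epsilon> + indicator (A N) \<omega>"
        proof (cases "\<omega> \<in> A N")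
          case True
          then show ?thesis
            using mu.cdf_bounded_prob[of "a - \<epsilon>"] Y01(1)[of N \<omega>] \<epsilon> by simp
        next
          case False
          then have "cdf (\<mu> t) (a - \<epsilon>) \<le> cdf (empirical_measure N (X N t' \<omega>)) (a - \<epsilon> + \<epsilon>) + \<epsilon>"
            using elim(1) \<omega> unfolding levy_close_def by blast
          then show ?thesis using cdf(1) False by simp
        qed
        show "Y N \<omega> \<le> cdf (\<mu> t) (b + \<epsilon>) + \<epsilon> + indicator (A N) \<omega>"
        proof (cases "\<omega> \<in> A N")
          case True
          then show ?thesis
            using mu.cdf_nonneg[of "b + \<epsilon>"] Y01(2)[of N \<omega>] \<epsilon> by simp
        next
          case False
          then have "cdf (empirical_measure N (X N t' \<omega>)) (b + \<epsilon> - \<epsilon>) \<le> cdf (\<mu> t) (b + \<epsilon>) + \<epsilon>"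
            using elim(1) \<omega> unfolding levy_close_def by blast
          then show ?thesis using cdf(2) False by simp
        qed
      qed
    qed
    have "\<forall>\<^sub>F N in sequentially. cdf (\<mu> t) (a - \<epsilon>) \<le> (\<integral>\<omega>. Y N \<omega> \<partial>P) + \<epsilon> + prob (A N)
        \<and> (\<integral>\<omega>. Y N \<omega> \<partial>P) \<le> cdf (\<mu> t) (b + \<epsilon>) + \<epsilon> + prob (A N)"
      using pointwise
    proof eventually_elim
      case (elim N)
      have "cdf (\<mu> t) (a - \<epsilon>) \<le> (\<integral>\<omega>. Y N \<omega> + \<epsilon> + indicator (A N) \<omega> \<partial>P)"
        using elim int[of N] ind by (intro integral_ge_const) auto
      moreover have "(\<integral>\<omega>. Y N \<omega> \<partial>P) \<le> (\<integral>\<omega>. cdf (\<mu> t) (b + \<epsilon>) + \<epsilon> + indicator (A N) \<omega> \<partial>P)"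
        using elim int[of N] ind by (intro integral_mono) auto
      ultimately show ?case
        using elim int[of N] ind by (simp add: prob_space)
    qed
    then have le: "\<forall>\<^sub>F N in sequentially. cdf (\<mu> t) (a - \<epsilon>) \<le> (\<integral>\<omega>. Y N \<omega> \<partial>P) + \<epsilon> + prob (A N)"
      "\<forall>\<^sub>F N in sequentially. (\<integral>\<omega>. Y N \<omega> \<partial>P) \<le> cdf (\<mu> t) (b + \<epsilon>) + \<epsilon> + prob (A N)"
      by (auto elim: eventually_mono)
    have "(\<lambda>N. (\<integral>\<omega>. Y N \<omega> \<partial>P) + \<epsilon> + prob (A N)) \<longlonglongrightarrow> m + \<epsilon> + 0"
      by (intro tendsto_add conv tendsto_const A(2))
    from tendsto_lowerbound[OF this le(1)] show "cdf (\<mu> t) (a - \<epsilon>) \<le> (\<integral>x. cts_step a b x \<partial>Exp1) + \<epsilon>"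
      by (simp add: m_def)
    have "(\<lambda>N. cdf (\<mu> t) (b + \<epsilon>) + \<epsilon> + prob (A N)) \<longlonglongrightarrow> cdf (\<mu> t) (b + \<epsilon>) + \<epsilon> + 0"
      by (intro tendsto_add tendsto_const A(2))
    from tendsto_le[OF _ this conv le(2)] show "(\<integral>x. cts_step a b x \<partial>Exp1) \<le> cdf (\<mu> t) (b + \<epsilon>) + \<epsilon>"
      by (simp add: m_def)
  qed
  show ?thesis
  proof (rule real_distribution_eq_if_interlaced[OF mu real_distribution_Exp1])
    fix x z :: real assume xz: "x < z"
    show "cdf (\<mu> t) x \<le> cdf Exp1 z"
    proof (rule field_le_epsilon)
      fix e :: real assume e: "e > 0"
      define \<epsilon> where "\<epsilon> = min e ((z - x) / 2)"
      have \<epsilon>: "\<epsilon> > 0" "\<epsilon> \<le> e" "\<epsilon> \<le> (z - x) / 2"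
        unfolding \<epsilon>_def by (use e xz in simp, rule min.cobounded1, rule min.cobounded2)
      have mid: "(x + z) / 2 < z" using xz by simp
      have "x \<le> (x + z) / 2 - \<epsilon>" using \<epsilon>(3) by (simp add: field_simps)
      then have "cdf (\<mu> t) x \<le> cdf (\<mu> t) ((x + z) / 2 - \<epsilon>)" by (rule mu.cdf_nondecreasing)
      also have "\<dots> \<le> (\<integral>y. cts_step ((x + z) / 2) z y \<partial>Exp1) + \<epsilon>" by (rule sandwich(1)[OF \<epsilon>(1) mid])
      also have "\<dots> \<le> cdf Exp1 z + e" using E.cdf_cts_step(2)[OF mid] \<epsilon>(2) by simp
      finally show "cdf (\<mu> t) x \<le> cdf Exp1 z + e" .
    qed
    show "cdf Exp1 x \<le> cdf (\<mu> t) z"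
    proof (rule field_le_epsilon)
      fix e :: real assume e: "e > 0"
      define \<epsilon> where "\<epsilon> = min e ((z - x) / 2)"
      have \<epsilon>: "\<epsilon> > 0" "\<epsilon> \<le> e" "\<epsilon> \<le> (z - x) / 2"
        unfolding \<epsilon>_def by (use e xz in simp, rule min.cobounded1, rule min.cobounded2)
      have mid: "x < (x + z) / 2" using xz by simp
      have "cdf Exp1 x \<le> (\<integral>y. cts_step x ((x + z) / 2) y \<partial>Exp1)" by (rule E.cdf_cts_step(1)[OF mid])
      also have "\<dots> \<le> cdf (\<mu> t) ((x + z) / 2 + \<epsilon>) + \<epsilon>" by (rule sandwich(2)[OF \<epsilon>(1) mid])
      also have "cdf (\<mu> t) ((x + z) / 2 + \<epsilon>) \<le> cdf (\<mu> t) z"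
        by (rule mu.cdf_nondecreasing) (use \<epsilon>(3) in \<open>simp add: field_simps\<close>)
      finally show "cdf Exp1 x \<le> cdf (\<mu> t) z + e" using \<epsilon>(2) by simp
    qed
  qed
qed

end

theorem theorem6p3:
  fixes P :: "'a measure"
    and W :: "nat \<Rightarrow> nat"
    and p :: "nat \<Rightarrow> real"
    and G :: "nat \<Rightarrow> nat \<Rightarrow> 'a \<Rightarrow> nat"
  assumes P: "prob_space P"
    and W_pos: "\<And>N. N \<ge> 1 \<Longrightarrow> W N > 0"
    and W_ge: "\<And>N. N \<ge> 1 \<Longrightarrow> W N \<ge> N"
    and W_lim: "filterlim (\<lambda>N. real (W N) / real N) at_top sequentially"
    and p: "\<And>N. N \<ge> 1 \<Longrightarrow> p N = real N / real (W N)"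
    and G_indep: "prob_space.indep_vars P (\<lambda>_. count_space UNIV) (\<lambda>(N, i). G N i)
                    {(N, i). 1 \<le> i \<and> i \<le> N}"
    and G_geometric: "\<And>N i k. 1 \<le> i \<Longrightarrow> i \<le> N \<Longrightarrow>
                    measure P {\<omega>\<in>space P. G N i \<omega> = k} = p N * (1 - p N) ^ k"
  shows "(AE \<omega> in P. weak_conv_m
             (\<lambda>N. empirical_measure N (initial_wealth N (\<lambda>i. G N i \<omega>))) Exp1) \<and>
         (\<forall>(X :: nat \<Rightarrow> real \<Rightarrow> 'a \<Rightarrow> nat \<Rightarrow> real) \<mu>.
            (\<forall>N\<ge>2. exchange_process P N (X N) \<and>
                    (\<forall>\<omega>\<in>space P. X N 0 \<omega> = initial_wealth N (\<lambda>i. G N i \<omega>))) \<and>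
            mean_field_limit P X \<mu>
            \<longrightarrow> (\<forall>t>0. \<mu> t = Exp1))"
proof -
  interpret geometric_array P p G
  proof (intro geometric_array.intro geometric_array_axioms.intro P G_indep G_geometric)
    show "0 < p N" if "N \<ge> 1" for N
      using p[OF that] W_pos[OF that] that by simp
    have "(\<lambda>N. inverse (real (W N) / real N)) \<longlonglongrightarrow> 0"
      by (rule tendsto_inverse_0_at_top[OF W_lim])
    moreover have "\<forall>\<^sub>F N in sequentially. inverse (real (W N) / real N) = p N"
      using eventually_ge_at_top[of 1] by eventually_elim (simp add: p)
    ultimately show "p \<longlonglongrightarrow> 0"
      using tendsto_cong by force
  qed
  show ?thesis
  proof (intro conjI allI impI)
    show "AE \<omega> in P. weak_conv_m (\<lambda>N. empirical_measure N (initial_wealth N (\<lambda>i. G N i \<omega>))) Exp1"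
      using AE_wealth_weak_conv unfolding wealth_def .
    fix X \<mu> and t :: real
    assume "(\<forall>N\<ge>2. exchange_process P N (X N) \<and>
        (\<forall>\<omega>\<in>space P. X N 0 \<omega> = initial_wealth N (\<lambda>i. G N i \<omega>))) \<and> mean_field_limit P X \<mu>" and "t > 0"
    then show "\<mu> t = Exp1"
      by (intro mean_field_limit_eq_Exp1[of X]) (auto simp: wealth_def)
  qed
qed

end
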